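(* $[5,1,0,1]=5$. That is: let $n\ge 5$ and let $\mathcal{F}=\{r_1,r_2,r_3,g_1,g_2\}$ be a fault in $\mathcal{Q}_n$ with three distinct red vertices $r_1,r_2,r_3$ and two distinct green vertices $g_1,g_2$. If $g_3,g_4\in\mathcal{Q}_n-\mathcal{F}$ are two distinct green vertices, then there exists a Hamiltonian path of $\mathcal{Q}_n-\mathcal{F}$ that connects $g_3$ to $g_4$. The claim is not true if $n=3$ or $n=4$ (for each of these $n$ there are such vertices for which no such Hamiltonian path exists).
   Context: $\mathcal{Q}_n$ is the $n$-dimensional binary hypercube: its vertices are all binary sequences of length $n$, adjacent iff they differ in exactly one position. A vertex is even or odd according to the parity of its number of 1's; vertices of one parity are called red and those of the other parity green. A path covering of a graph is a set of vertex-disjoint paths that cover all vertices of the graph. A fault $\mathcal{F}$ in $\mathcal{Q}_n$ is a set of deleted vertices; its mass is $|\mathcal{F}|$ and its charge is $|r(\mathcal{F})-g(\mathcal{F})|$, where $r(\mathcal{F})$, $g(\mathcal{F})$ are the numbers of red and green vertices in $\mathcal{F}$. $\mathcal{Q}_n-\mathcal{F}$ is the subgraph induced by the non-deleted vertices. A pair of vertices (or a path, via its two endpoints) is neutral if the two vertices have opposite parity and charged if they have the same parity; a charged pair is red (green) if its elements are red (green). A set $\mathcal{E}$ of disjoint pairs of vertices is in balance with $\mathcal{F}$ if all vertices in the pairs lie in $\mathcal{Q}_n-\mathcal{F}$ and $r(\mathcal{F})-g(\mathcal{F})=g(\mathcal{E})-r(\mathcal{E})$, where $r(\mathcal{E})$,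 $g(\mathcal{E})$ are the numbers of red and green pairs in $\mathcal{E}$. For a fault $\mathcal{F}$ of mass $M$ and charge $C$ in $\mathcal{Q}_n$, one can freely prescribe ends for a path covering of $\mathcal{Q}_n-\mathcal{F}$ with $N$ neutral paths and $O$ charged paths if (i) there is at least one set $\mathcal{E}$ of disjoint pairs of vertices in balance with $\mathcal{F}$ containing exactly $N$ neutral and $O$ charged pairs, and (ii) for every such $\mathcal{E}$ there is a path covering of $\mathcal{Q}_n-\mathcal{F}$ whose set of pairs of end vertices is $\mathcal{E}$. For nonnegative integers $M,C,N,O$, $\mathcal{A}_{M,C,N,O}$ is the set of nonnegative integers $m$ such that $m\ge\log_2[M+C+2N+2O]$ and for every $n\ge m$ and every fault $\mathcal{F}$ of mass $M$ and charge $C$ in $\mathcal{Q}_n$ one can freely prescribe ends for a path covering of $\mathcal{Q}_n-\mathcal{F}$ with $N$ neutral and $O$ charged paths. $[M,C,N,O]$ is the smallest element of $\mathcal{A}_{M,C,N,O}$ if this set is nonempty. *)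

theory Defs
  imports Complex_Main "HOL-Library.Disjoint_Sets"
begin

type_synonym vertex = "bool list"

definition hypercube :: "nat \<Rightarrow> vertex set" where
  "hypercube n = {v. length v = n}"

definition adj :: "vertex \<Rightarrow> vertex \<Rightarrow> bool" where
  "adj u v \<longleftrightarrow> length u = length v \<and> card {i. i < length u \<and> u ! i \<noteq> v ! i} = 1"

text \<open>
  Which parity is called red is left open: \<open>c\<close> states whether the red vertices
  are the even ones.
\<close>

definition red :: "bool \<Rightarrow> vertex \<Rightarrow> bool" where
  "red c v \<longleftrightarrow> (even (count_list v True) \<longleftrightarrow> c)"

definition green :: "bool \<Rightarrow> vertex \<Rightarrow> bool" where
  "green c v \<longleftrightarrow> \<not> red c v"

definition fault :: "nat \<Rightarrow> vertex set \<Rightarrow> bool" where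
  "fault n F \<longleftrightarrow> F \<subseteq> hypercube n"

definition mass :: "vertex set \<Rightarrow> nat" where
  "mass F = card F"

definition charge :: "bool \<Rightarrow> vertex set \<Rightarrow> nat" where
  "charge c F = nat \<bar>int (card {v \<in> F. red c v}) - int (card {v \<in> F. green c v})\<bar>"

text \<open>
  The graph obtained by deleting a fault is an induced subgraph, so it is represented by its
  vertex set \<open>V\<close>, with adjacency \<^const>\<open>adj\<close>. A path is the list of its vertices in order.
\<close>

definition is_path :: "vertex set \<Rightarrow> vertex list \<Rightarrow> bool" where
  "is_path V p \<longleftrightarrow> p \<noteq> [] \<and> distinct p \<and> set p \<subseteq> V \<and> successively adj p"

definition hamiltonian_path :: "vertex set \<Rightarrow> vertex list \<Rightarrow> bool" where
  "hamiltonian_path V p \<longleftrightarrow> is_path V p \<and> set p = V"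

definition path_ends :: "vertex list \<Rightarrow> vertex set" where
  "path_ends p = {hd p, last p}"

text \<open>
  Vertex-disjointness also excludes that both orientations of one path occur in a covering.
\<close>

definition path_covering :: "vertex set \<Rightarrow> vertex list set \<Rightarrow> bool" where
  "path_covering V P \<longleftrightarrow>
     (\<forall>p\<in>P. is_path V p) \<and> disjoint_family_on set P \<and> (\<Union>p\<in>P. set p) = V"

text \<open>A pair of vertices is an unordered pair of two distinct vertices.\<close>

definition vertex_pair :: "vertex set \<Rightarrow> bool" where
  "vertex_pair e \<longleftrightarrow> (\<exists>u v. u \<noteq> v \<and> e = {u, v})"

definition red_pair :: "bool \<Rightarrow> vertex set \<Rightarrow> bool" where
  "red_pair c e \<longleftrightarrow> vertex_pair e \<and> (\<forall>v\<in>e. red c v)"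

definition green_pair :: "bool \<Rightarrow> vertex set \<Rightarrow> bool" where
  "green_pair c e \<longleftrightarrow> vertex_pair e \<and> (\<forall>v\<in>e. green c v)"

definition charged_pair :: "bool \<Rightarrow> vertex set \<Rightarrow> bool" where
  "charged_pair c e \<longleftrightarrow> red_pair c e \<or> green_pair c e"

definition neutral_pair :: "bool \<Rightarrow> vertex set \<Rightarrow> bool" where
  "neutral_pair c e \<longleftrightarrow> (\<exists>u v. e = {u, v} \<and> red c u \<and> green c v)"

definition disjoint_pairs :: "vertex set set \<Rightarrow> bool" where
  "disjoint_pairs E \<longleftrightarrow> (\<forall>e\<in>E. vertex_pair e) \<and> disjoint E"

definition in_balance :: "bool \<Rightarrow> nat \<Rightarrow> vertex set \<Rightarrow> vertex set set \<Rightarrow> bool" where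
  "in_balance c n F E \<longleftrightarrow>
     \<Union>E \<subseteq> hypercube n - F \<and>
     int (card {v \<in> F. red c v}) - int (card {v \<in> F. green c v}) =
     int (card {e \<in> E. green_pair c e}) - int (card {e \<in> E. red_pair c e})"

definition admissible_ends ::
    "bool \<Rightarrow> nat \<Rightarrow> vertex set \<Rightarrow> nat \<Rightarrow> nat \<Rightarrow> vertex set set \<Rightarrow> bool" where
  "admissible_ends c n F N Oc E \<longleftrightarrow>
     disjoint_pairs E \<and> in_balance c n F E \<and>
     card {e \<in> E. neutral_pair c e} = N \<and> card {e \<in> E. charged_pair c e} = Oc"

definition freely_prescribable ::
    "bool \<Rightarrow> nat \<Rightarrow> vertex set \<Rightarrow> nat \<Rightarrow> nat \<Rightarrow> bool" where
  "freely_prescribable c n F N Oc \<longleftrightarrow>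
     (\<exists>E. admissible_ends c n F N Oc E) \<and>
     (\<forall>E. admissible_ends c n F N Oc E \<longrightarrow>
        (\<exists>P. path_covering (hypercube n - F) P \<and> path_ends ` P = E))"

text \<open>
  When \<open>M = C = N = Oc = 0\<close> the logarithmic bound is vacuous, as \<open>log 2 0 = 0\<close> in HOL.
\<close>

definition A_set :: "bool \<Rightarrow> nat \<Rightarrow> nat \<Rightarrow> nat \<Rightarrow> nat \<Rightarrow> nat set" where
  "A_set c M C N Oc =
     {m. real m \<ge> log 2 (real (M + C + 2 * N + 2 * Oc)) \<and>
         (\<forall>n\<ge>m. \<forall>F. fault n F \<and> mass F = M \<and> charge c F = C \<longrightarrow>
            freely_prescribable c n F N Oc)}"

text \<open>Meaningful only if \<^const>\<open>A_set\<close> is nonempty at these arguments.\<close>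

definition bracket :: "bool \<Rightarrow> nat \<Rightarrow> nat \<Rightarrow> nat \<Rightarrow> nat \<Rightarrow> nat" where
  "bracket c M C N Oc = (LEAST m. m \<in> A_set c M C N Oc)"

end

theory Submission
  imports Defs "HOL-Combinatorics.Permutations"
begin

text \<open>
  Call the vertices of the two parities vertices of sign \<open>1\<close> and \<open>- 1\<close>. If the assertion about
  \<open>n \<ge> 5\<close> holds in some dimension, then so does the analogue for every balanced fault of mass at most
  5: delete an end \<open>t\<close>, too, and connect the other end to a free neighbour of \<open>t\<close>. This makes the
  assertion inductive. For the step, choose a coordinate in which two of the three red vertices
  differ. In each distribution of the deleted vertices and of the ends over the two halves of the
  cube, Hamiltonian paths of the halves with at most 5 deleted vertices, together with a few short
  paths chosen beforehand, are joined along edges between the halves.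

  In dimension 5 the halves only allow 3 deleted vertices. This suffices if some coordinate
  separates both the two green vertices and two of the red ones. The remaining faults
  form four orbits under translations and coordinate permutations, and these, as well as the
  faults of mass 3 in dimension 4, are settled by explicit paths.
\<close>

section \<open>Hamiltonian paths of vertex sets\<close>

text \<open>Signs turn every parity question into arithmetic: the signs of the two ends of a
  Hamiltonian path add up to twice the total sign of its vertex set, and each half of a cube has
  total sign 0. So the vertices deleted from a half restrict the pieces of the path inside it. If
  their signs cancel, one piece with ends of opposite sign can do; if their total is
  \<open>1\<close> or \<open>- 1\<close>, one piece with ends of equal sign; if two vertices of the
  same sign are missing and nothing else, at least two pieces are forced. The last situation is the
  obstacle. It arises when both deleted vertices of sign \<open>- 1\<close> lie in the half with
  only one of sign \<open>1\<close>. A short path is then reserved, and its vertices are treated as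
  deleted, until each remaining half can be handled by a single Hamiltonian path. This raises the
  number of missing vertices in a half to 5, so the induction hypothesis must admit every balanced
  fault up to that mass, not just those of the original shape. For the same reason the induction
  cannot start from dimension 4, where mass 5 fails and only mass 3 holds.\<close>

definition sg :: "vertex \<Rightarrow> int" where
  "sg v = (if even (count_list v True) then 1 else - 1)"

text \<open>Only the vertex set and the ends of a path are kept. Paths are then cut and joined
  without naming lists, and covering reduces to an identity between sets.\<close>

definition linked :: "vertex set \<Rightarrow> vertex \<Rightarrow> vertex \<Rightarrow> bool" where
  "linked V s t \<longleftrightarrow> (\<exists>p. hamiltonian_path V p \<and> hd p = s \<and> last p = t)"

lemma adj_sym: "adj u v \<longleftrightarrow> adj v u"
  by (auto simp: adj_def eq_commute)

lemma linked_singleton: "linked {s} s s"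
  unfolding linked_def hamiltonian_path_def is_path_def
  by (rule exI[of _ "[s]"]) simp

lemma linked_rev:
  assumes "linked V s t" shows "linked V t s"
proof -
  obtain p where p: "hamiltonian_path V p" "hd p = s" "last p = t"
    using assms by (auto simp: linked_def)
  have "successively adj (rev p) \<longleftrightarrow> successively adj p"
    by (simp add: successively_rev adj_sym)
  with p show ?thesis unfolding linked_def hamiltonian_path_def is_path_def
    by (intro exI[of _ "rev p"]) (auto simp: hd_rev last_rev)
qed

lemma linked_append:
  assumes "linked V s t" "linked W u v" "adj t u" "V \<inter> W = {}"
  shows "linked (V \<union> W) s v"
proof -
  obtain p q where p: "hamiltonian_path V p" "hd p = s" "last p = t"
    and q: "hamiltonian_path W q" "hd q = u" "last q = v"
    using assms by (auto simp: linked_def)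
  have "hamiltonian_path (V \<union> W) (p @ q)"
    using p q assms(3,4) unfolding hamiltonian_path_def is_path_def
    by (auto simp: successively_append_iff)
  moreover have "hd (p @ q) = s" "last (p @ q) = v"
    using p q by (auto simp: hamiltonian_path_def is_path_def)
  ultimately show ?thesis unfolding linked_def by blast
qed

lemma linked_Cons:
  assumes "linked V u t" "adj s u" "s \<notin> V"
  shows "linked (insert s V) s t"
  using linked_append[OF linked_singleton assms(1), of s] assms by simp

lemma linked_ends: "linked V s t \<Longrightarrow> s \<in> V \<and> t \<in> V"
  by (auto simp: linked_def hamiltonian_path_def is_path_def)

lemma linked_same:
  assumes "linked V x x" shows "V = {x}"
proof -
  obtain p where p: "hamiltonian_path V p" "hd p = x" "last p = x"
    using assms by (auto simp: linked_def)
  show ?thesis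
  proof (cases p)
    case (Cons a q)
    with p show ?thesis
      by (cases "q = []") (auto simp: hamiltonian_path_def is_path_def dest: last_in_set)
  qed (use p in \<open>auto simp: hamiltonian_path_def is_path_def\<close>)
qed

lemma linked_sublists:
  assumes "hamiltonian_path V p" "p = xs @ ys" "xs \<noteq> []" "ys \<noteq> []"
  shows "linked (set xs) (hd p) (last xs)" "linked (set ys) (hd ys) (last p)"
    "adj (last xs) (hd ys)" "V = set xs \<union> set ys" "set xs \<inter> set ys = {}"
  using assms unfolding linked_def hamiltonian_path_def is_path_def
  by (auto simp: successively_append_iff)

section \<open>Cutting a Hamiltonian path at a vertex or an edge\<close>

lemma linked_cut_after:
  assumes "linked V s t" "x \<in> V" "x \<noteq> t"
  obtains V1 V2 y where "linked V1 s x" "linked V2 y t" "adj x y" "V = V1 \<union> V2" "V1 \<inter> V2 = {}"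
proof -
  obtain p where p: "hamiltonian_path V p" "hd p = s" "last p = t"
    using assms by (auto simp: linked_def)
  obtain xs ys where "p = xs @ x # ys"
    using p assms(2) by (metis hamiltonian_path_def split_list)
  then have *: "p = (xs @ [x]) @ ys" by simp
  have "ys \<noteq> []" using * p assms(3) by auto
  from linked_sublists[OF p(1) * _ this] p that[of "set (xs @ [x])" "set ys"] show ?thesis by auto
qed

lemma linked_cut_before:
  assumes "linked V s t" "x \<in> V" "x \<noteq> s"
  obtains V1 V2 y where "linked V1 s y" "linked V2 x t" "adj y x" "V = V1 \<union> V2" "V1 \<inter> V2 = {}"
  using linked_cut_after[OF linked_rev[OF assms(1)] assms(2,3)]
  by (smt (verit) Un_commute Int_commute adj_sym linked_rev)

lemma linked_cut_around:
  assumes "linked V s t" "x \<in> V" "x \<noteq> s" "x \<noteq> t"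
  obtains V1 V2 y z where "linked V1 s y" "linked V2 z t" "adj y x" "adj x z"
    "V = insert x (V1 \<union> V2)" "V1 \<inter> V2 = {}" "x \<notin> V1" "x \<notin> V2"
proof -
  obtain V1 V2 z where 1: "linked V1 s x" "linked V2 z t" "adj x z" "V = V1 \<union> V2" "V1 \<inter> V2 = {}"
    using linked_cut_after[OF assms(1,2,4)] by metis
  have "x \<in> V1" using 1(1) linked_ends by blast
  then obtain V3 V4 y where 2: "linked V3 s y" "linked V4 x x" "adj y x" "V1 = V3 \<union> V4" "V3 \<inter> V4 = {}"
    using linked_cut_before[OF 1(1) _ assms(3)] by metis
  have "V4 = {x}" by (rule linked_same[OF 2(2)])
  with that[OF 2(1) 1(2) 2(3) 1(3)] 1 2 show ?thesis by blast
qed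

text \<open>Pigeonhole on disjoint pairs of consecutive entries: every pair that meets
  \<open>X\<close> uses up an element of \<open>X\<close>, and there are more pairs than such
  elements. Hence the induction removes two entries at a time.\<close>

lemma consecutive_avoiding:
  assumes "finite X" "distinct p" "2 * card (X \<inter> set p) + 2 \<le> length p"
  shows "\<exists>xs u v ys. p = xs @ u # v # ys \<and> u \<notin> X \<and> v \<notin> X"
  using assms(2,3)
proof (induction p rule: induct_list012)
  case (3 u v p)
  show ?case
  proof (cases "u \<in> X \<or> v \<in> X")
    case True
    then have "card (X \<inter> set p) < card (X \<inter> set (u # v # p))"
      using assms(1) 3(3) by (intro psubset_card_mono) auto
    then have "2 * card (X \<inter> set p) + 2 \<le> length p" using 3(4) by simp
    then obtain xs a b ys where "p = xs @ a # b # ys" "a \<notin> X" "b \<notin> X" using 3 by auto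
    then show ?thesis by (intro exI[of _ "u # v # xs"]) auto
  next
    case False
    then show ?thesis by (intro exI[of _ "[]"]) auto
  qed
qed auto

lemma linked_cut_avoiding:
  assumes "linked V s t" "finite X" "2 * card X + 2 \<le> card V"
  obtains V1 V2 u v where "linked V1 s u" "linked V2 v t" "adj u v" "V = V1 \<union> V2" "V1 \<inter> V2 = {}"
    "u \<notin> X" "v \<notin> X"
proof -
  obtain p where p: "hamiltonian_path V p" "hd p = s" "last p = t"
    using assms by (auto simp: linked_def)
  then have "distinct p" "length p = card V"
    by (auto simp: hamiltonian_path_def is_path_def distinct_card)
  moreover have "card (X \<inter> set p) \<le> card X" using assms(2) by (simp add: card_mono)
  ultimately obtain xs u v ys where "p = xs @ u # v # ys" and X: "u \<notin> X" "v \<notin> X"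
    using consecutive_avoiding[of X p] assms(2,3) by auto
  then have "p = (xs @ [u]) @ (v # ys)" by simp
  from linked_sublists[OF p(1) this] p X that[of "set (xs @ [u])" u "set (v # ys)" v] show ?thesis
    by auto
qed

text \<open>
  The equation on signs is the balance condition: it holds whenever \<open>V\<close> has as many even as odd
  vertices and \<open>V - set F\<close> has a Hamiltonian path from \<open>s\<close> to \<open>t\<close>.
\<close>

definition linkable :: "vertex set \<Rightarrow> nat \<Rightarrow> bool" where
  "linkable V k \<longleftrightarrow> (\<forall>F s t. set F \<subseteq> V \<and> distinct F \<and> length F \<le> k \<and> s \<in> V - set F \<and> t \<in> V - set F \<and> s \<noteq> t \<and>
     2 * sum_list (map sg F) + sg s + sg t = 0 \<longrightarrow> linked (V - set F) s t)"

lemma linkableD: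
  assumes "linkable V k" "distinct F" "length F \<le> k" "set F \<subseteq> V" "s \<in> V" "t \<in> V" "s \<notin> set F" "t \<notin> set F" "s \<noteq> t"
    "2 * sum_list (map sg F) + sg s + sg t = 0"
  shows "linked (V - set F) s t"
  using assms unfolding linkable_def by blast

lemma linkable_mono: "linkable V k \<Longrightarrow> j \<le> k \<Longrightarrow> linkable V j"
  unfolding linkable_def by (meson le_trans)

lemma sg_cases: "sg v = 1 \<or> sg v = - 1"
  by (simp add: sg_def)

section \<open>Joining paths of two halves\<close>

definition flip :: "nat \<Rightarrow> vertex \<Rightarrow> vertex" where
  "flip i v = v[i := \<not> v ! i]"

lemma length_flip [simp]: "length (flip i v) = length v"
  by (simp add: flip_def)

lemma nth_flip: "j < length v \<Longrightarrow> flip i v ! j = (v ! j \<noteq> (i = j))"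
  by (auto simp: flip_def nth_list_update)

lemma flip_flip [simp]: "flip i (flip i v) = v"
  by (rule nth_equalityI) (auto simp: nth_flip)

lemma adj_flip: "i < length v \<Longrightarrow> adj v (flip i v)"
proof -
  assume "i < length v"
  then have "{j. j < length v \<and> v ! j \<noteq> flip i v ! j} = {i}" by (auto simp: nth_flip)
  then show ?thesis by (simp add: adj_def)
qed

lemma adj_iff_flip: "adj u v \<longleftrightarrow> (\<exists>i<length u. v = flip i u)"
proof
  assume *: "adj u v"
  then obtain i where i: "{i. i < length u \<and> u ! i \<noteq> v ! i} = {i}"
    unfolding adj_def by (meson card_1_singletonE)
  have "v = flip i u"
  proof (rule nth_equalityI)
    show "length v = length (flip i u)" using * by (simp add: adj_def)
    show "v ! j = flip i u ! j" if "j < length v" for j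
    proof -
      have "j < length u" using that * by (simp add: adj_def)
      moreover from this have "u ! j \<noteq> v ! j \<longleftrightarrow> j = i" using i by blast
      ultimately show ?thesis using nth_flip[of j u i] by auto
    qed
  qed
  moreover have "i < length u" using i by blast
  ultimately show "\<exists>i<length u. v = flip i u" by blast
qed (auto simp: adj_flip)

lemma sg_Cons: "sg (b # v) = (if b then - sg v else sg v)"
  by (simp add: sg_def)

lemma sg_flip: "i < length v \<Longrightarrow> sg (flip i v) = - sg v"
proof (induction v arbitrary: i)
  case (Cons b v)
  then show ?case by (cases i) (auto simp: flip_def sg_Cons)
qed simp

lemma adj_sg: "adj u v \<Longrightarrow> sg v = - sg u"
  by (auto simp: adj_iff_flip sg_flip)

lemma flip_inj: "i < length v \<Longrightarrow> j < length v \<Longrightarrow> flip i v = flip j v \<Longrightarrow> i = j"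
  by (metis nth_flip)

text \<open>If flipping \<open>i\<close> in \<open>x\<close> and \<open>j\<close> in
  \<open>y\<close> gives the same vertex and \<open>i \<noteq> j\<close>, then \<open>x\<close> and
  \<open>y\<close> differ in exactly these two coordinates, so a common neighbour arises from
  \<open>x\<close> by flipping one of them.\<close>

lemma common_neighbours:
  assumes "x \<noteq> y"
  shows "\<exists>a b. \<forall>z. adj x z \<and> adj y z \<longrightarrow> z = a \<or> z = b"
proof (cases "\<exists>z. adj x z \<and> adj y z")
  case True
  then obtain i j where ij: "i < length x" "j < length y" "flip i x = flip j y"
    by (auto simp: adj_iff_flip)
  have len: "length x = length y" using ij(3) by (metis length_flip)
  have diff: "x ! m = y ! m \<longleftrightarrow> (k = m) = (l = m)"
    if "flip k x = flip l y" "m < length x" for k l m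
    using nth_flip[of m x k] nth_flip[of m y l] that len by auto
  have "i \<noteq> j" using ij(3) assms by (metis flip_flip)
  have "z = flip i x \<or> z = flip j x" if z: "adj x z" "adj y z" for z
  proof -
    obtain k l where kl: "z = flip k x" "flip k x = flip l y"
      using z by (auto simp: adj_iff_flip)
    have "k = i \<or> l = i" "k = j \<or> l = j"
      using diff[OF ij(3), of i] diff[OF ij(3), of j] diff[OF kl(2), of i] diff[OF kl(2), of j]
        ij len \<open>i \<noteq> j\<close> by auto
    then show ?thesis using kl \<open>i \<noteq> j\<close> by auto
  qed
  then show ?thesis by blast
qed blast

lemma exists_outside_list:
  assumes "length xs < card S"
  shows "\<exists>x\<in>S. x \<notin> set xs"
proof (rule ccontr)
  assume "\<not> ?thesis"
  then have "card S \<le> card (set xs)" by (intro card_mono) auto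
  then show False using assms card_length[of xs] by simp
qed

text \<open>The halves enter only through the matching \<open>\<phi>\<close> and a lower bound
  \<open>d\<close> on the degree inside each half. The assumptions are symmetric, so by
  \<open>swap\<close> each construction has to be given for one side only.\<close>

locale cube_halves =
  fixes A B :: "vertex set" and \<phi> :: "vertex \<Rightarrow> vertex" and d :: nat
  assumes disj: "A \<inter> B = {}"
    and phi_A: "x \<in> A \<Longrightarrow> \<phi> x \<in> B" and phi_B: "x \<in> B \<Longrightarrow> \<phi> x \<in> A"
    and phi_phi [simp]: "\<phi> (\<phi> x) = x"
    and adj_phi': "x \<in> A \<union> B \<Longrightarrow> adj x (\<phi> x)"
    and phi_adj: "x \<in> A \<union> B \<Longrightarrow> adj x y \<Longrightarrow> adj (\<phi> x) (\<phi> y)"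
    and degree_A: "x \<in> A \<Longrightarrow> d \<le> card {u \<in> A. adj x u}"
    and degree_B: "x \<in> B \<Longrightarrow> d \<le> card {u \<in> B. adj x u}"
begin

lemma swap: "cube_halves B A \<phi> d"
proof
  show "B \<inter> A = {}" using disj by blast
qed (use phi_A phi_B phi_phi adj_phi' phi_adj degree_A degree_B in \<open>blast+\<close>)

lemma adj_phi: "x \<in> A \<Longrightarrow> adj x (\<phi> x)" "x \<in> A \<Longrightarrow> adj (\<phi> x) x"
    "x \<in> B \<Longrightarrow> adj x (\<phi> x)" "x \<in> B \<Longrightarrow> adj (\<phi> x) x"
  using adj_phi' adj_sym by blast+

lemma sg_phi: "x \<in> A \<Longrightarrow> sg (\<phi> x) = - sg x" "x \<in> B \<Longrightarrow> sg (\<phi> x) = - sg x"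
  using adj_phi adj_sg by metis+

lemma phi_eq: "\<phi> x = \<phi> y \<longleftrightarrow> x = y" "\<phi> x = y \<longleftrightarrow> x = \<phi> y"
  by (metis phi_phi)+

text \<open>All auxiliary vertices are chosen greedily in this way: the neighbours of a known vertex
  have a known sign, and fewer than \<open>d\<close> forbidden vertices cannot exhaust them.\<close>

lemma neighbour_A:
  assumes "x \<in> A" "length xs < d"
  obtains u where "u \<in> A" "adj x u" "adj u x" "sg u = - sg x" "u \<notin> set xs"
proof -
  have "length xs < card {u \<in> A. adj x u}" using degree_A assms by (meson le_trans not_le)
  then obtain u where "u \<in> A" "adj x u" "u \<notin> set xs" using exists_outside_list by blast
  then show ?thesis using that adj_sg adj_sym by metis
qed

lemma neighbour_B:
  assumes "x \<in> B" "length xs < d"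
  obtains u where "u \<in> B" "adj x u" "adj u x" "sg u = - sg x" "u \<notin> set xs"
  using cube_halves.neighbour_A[OF swap assms] by metis

text \<open>An edge of the path in \<open>A\<close> is replaced by an excursion that covers the rest
  of \<open>B\<close>. The ends of the edge have opposite signs, hence so have their partners, as
  the balanced list \<open>ys\<close> requires; the bound on \<open>card V\<close> leaves an edge
  with both partners undeleted.\<close>

lemma detour:
  assumes VA: "linked V s t" "V \<subseteq> A" and Y: "set ys \<subseteq> B" "distinct ys" "2 * length ys + 2 \<le> card V"
    and B: "linkable B (length ys)" and bal: "sum_list (map sg ys) = 0"
  shows "linked (V \<union> (B - set ys)) s t"
proof -
  have "card (\<phi> ` set ys) \<le> length ys"
    by (metis List.finite_set Y(2) card_image_le distinct_card)
  then have cd: "2 * card (\<phi> ` set ys) + 2 \<le> card V" using Y(3) by simp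
  obtain V1 V2 u v where V: "linked V1 s u" "linked V2 v t" "adj u v" "V = V1 \<union> V2" "V1 \<inter> V2 = {}"
      and uv: "u \<notin> \<phi> ` set ys" "v \<notin> \<phi> ` set ys"
    using linked_cut_avoiding[OF VA(1), of "\<phi> ` set ys"] Y(3) by (metis cd List.finite_set finite_imageI)
  have "u \<in> V1" "v \<in> V2" using linked_ends V(1,2) by auto
  then have uvA: "u \<in> A" "v \<in> A" "u \<noteq> v" using V(4,5) VA(2) by auto
  have "linked (B - set ys) (\<phi> u) (\<phi> v)"
  proof (rule linkableD[OF B])
    show "\<phi> u \<notin> set ys" "\<phi> v \<notin> set ys" using uv by (metis imageI phi_phi)+
    show "2 * sum_list (map sg ys) + sg (\<phi> u) + sg (\<phi> v) = 0"
      using bal uvA sg_phi adj_sg[OF V(3)] by simp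
  qed (use Y uvA phi_A phi_eq(1) in simp_all)
  moreover have sub: "V1 \<inter> (B - set ys) = {}" "(V1 \<union> (B - set ys)) \<inter> V2 = {}"
    using V(4,5) VA(2) disj by blast+
  ultimately have "linked (V1 \<union> (B - set ys)) s (\<phi> v)"
    using linked_append[OF V(1)] adj_phi(1)[OF uvA(1)] by simp
  then have "linked (V1 \<union> (B - set ys) \<union> V2) s t"
    using linked_append[OF _ V(2)] adj_phi(2)[OF uvA(2)] sub(2) by simp
  moreover have "V1 \<union> (B - set ys) \<union> V2 = V \<union> (B - set ys)" using V(4) by blast
  ultimately show ?thesis by simp
qed

lemma crossing:
  assumes "linked V s u" "linked W (\<phi> u) t" "V \<subseteq> A" "W \<subseteq> B"
  shows "linked (V \<union> W) s t"
proof (rule linked_append[OF assms(1,2)])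
  show "adj u (\<phi> u)" using adj_phi(1) linked_ends[OF assms(1)] assms(3) by blast
  show "V \<inter> W = {}" using assms(3,4) disj by blast
qed

text \<open>
  Additionally deleting a neighbour \<open>r\<close> of \<open>s\<close> makes \<open>A\<close> balanced for a path from \<open>s\<close> to \<open>t\<close>.
  To put \<open>r\<close> back, this path is cut next to a neighbour \<open>u\<close> of \<open>r\<close>, and the two pieces are
  joined by a path in \<open>B\<close> that ends in \<open>\<phi> r\<close>, followed by \<open>r\<close> and \<open>u\<close>.
\<close>

lemma insertion:
  assumes A: "linkable A (Suc (length xs))" and B: "linkable B (length ys)"
    and xs: "set xs \<subseteq> A" "distinct xs" "sum_list (map sg xs) = 0"
    and ys: "set ys \<subseteq> B" "distinct ys" "sum_list (map sg ys) = 1"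
    and one: "\<And>x y. x \<in> set ys \<Longrightarrow> y \<in> set ys \<Longrightarrow> sg x = - 1 \<Longrightarrow> sg y = - 1 \<Longrightarrow> x = y"
    and st: "s \<in> A" "t \<in> A" "s \<notin> set xs" "t \<notin> set xs" "s \<noteq> t" "sg s = - 1" "sg t = - 1"
    and r_avoid: "length (filter (\<lambda>v. sg v = 1) xs @ map \<phi> (filter (\<lambda>v. sg v = - 1) ys)) < d"
    and u_avoid: "length (s # t # filter (\<lambda>v. sg v = - 1) xs) < d"
  shows "linked ((A - set xs) \<union> (B - set ys)) s t"
proof -
  \<comment> \<open>Only deleted vertices of the matching sign can collide with \<open>r\<close>,
    \<open>\<phi> r\<close> or \<open>u\<close>, so the lists to avoid are filtered by sign and stay
    shorter than \<open>d\<close>.\<close>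
  obtain r where r: "r \<in> A" "adj r s" "sg r = 1"
      "r \<notin> set (filter (\<lambda>v. sg v = 1) xs @ map \<phi> (filter (\<lambda>v. sg v = - 1) ys))"
    using neighbour_A[OF st(1) r_avoid] st(6) by auto
  then have rxs: "r \<notin> set xs" by simp
  have phir: "\<phi> r \<in> B" "sg (\<phi> r) = - 1" "\<phi> r \<notin> set ys" using r phi_A sg_phi by (force simp: image_iff)+
  obtain u where u: "u \<in> A" "adj r u" "adj u r" "sg u = - 1" "u \<notin> set (s # t # filter (\<lambda>v. sg v = - 1) xs)"
    using neighbour_A[OF r(1) u_avoid] r(3) by auto
  have "linked (A - set (r # xs)) s t"
    by (rule linkableD[OF A]) (use xs st r rxs in auto)
  moreover have "u \<in> A - set (r # xs)" using u r by auto
  ultimately obtain V1 V2 p q where V: "linked V1 s p" "linked V2 q t" "adj p u" "adj u q"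
      "A - set (r # xs) = insert u (V1 \<union> V2)" "V1 \<inter> V2 = {}" "u \<notin> V1" "u \<notin> V2"
    using linked_cut_around u(5) by (metis list.set_intros)
  have pq: "p \<in> V1" "q \<in> V2" using linked_ends V(1,2) by auto
  have sub: "V1 \<subseteq> A - set (r # xs)" "V2 \<subseteq> A - set (r # xs)" using V(5) by auto
  have pqA: "p \<in> A" "q \<in> A" "p \<noteq> q" "p \<noteq> r" "q \<noteq> r" using pq sub V(6) by auto
  have sgpq: "sg p = 1" "sg q = 1" using V(3,4) u(4) adj_sg by force+
  have bottom: "linked (B - set ys) (\<phi> w) (\<phi> r)" if w: "w \<in> A" "sg w = 1" "w \<noteq> r" "\<phi> w \<notin> set ys" for w
    by (rule linkableD[OF B]) (use w phir ys phi_A sg_phi phi_eq in auto)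
  have disjs: "V1 \<inter> (B - set ys) = {}" "V2 \<inter> (B - set ys) = {}" "u \<notin> B" "r \<notin> B" "u \<noteq> r" "r \<notin> V1" "r \<notin> V2" "V1 \<subseteq> A" "V2 \<subseteq> A"
    using sub disj u(1,2,4) r(1,3) by auto
  have eq: "A - set xs = {r, u} \<union> V1 \<union> V2"
  proof -
    have "insert r (A - set (r # xs)) = A - set xs" using r(1) rxs by auto
    then show ?thesis unfolding V(5) by auto
  qed
  \<comment> \<open>Both \<open>\<phi> p\<close> and \<open>\<phi> q\<close> have sign
    \<open>- 1\<close>, and by \<open>one\<close> at most one vertex of this sign is deleted from
    \<open>B\<close>, so at least one of the two pieces can continue into \<open>B\<close>. If it is
    the second, the path is built backwards from \<open>t\<close>.\<close>
  show ?thesis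
  proof (cases "\<phi> p \<in> set ys")
    case False
    have 1: "linked (V1 \<union> (B - set ys)) s (\<phi> r)"
      by (rule crossing[OF V(1) bottom]) (use False pqA sgpq disjs in auto)
    have 2: "linked (insert r (insert u V2)) r t"
      by (rule linked_Cons[OF linked_Cons[OF V(2)]]) (use V(4,8) u(2) disjs in auto)
    have "linked (V1 \<union> (B - set ys) \<union> insert r (insert u V2)) s t"
      by (rule linked_append[OF 1 2]) (use adj_phi(2)[OF r(1)] disjs V(6-8) in auto)
    moreover have "V1 \<union> (B - set ys) \<union> insert r (insert u V2) = (A - set xs) \<union> (B - set ys)" unfolding eq by blast
    ultimately show ?thesis by simp
  next
    case True
    then have "\<phi> q \<notin> set ys" using one[of "\<phi> p" "\<phi> q"] sg_phi pqA sgpq phi_eq by auto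
    then have 1: "linked (V2 \<union> (B - set ys)) t (\<phi> r)"
      by (intro crossing[OF linked_rev[OF V(2)] bottom]) (use pqA sgpq disjs in auto)
    have 2: "linked (insert r (insert u V1)) r s"
      by (rule linked_Cons[OF linked_Cons[OF linked_rev[OF V(1)]]]) (use V(3,7) u(2) disjs adj_sym in auto)
    have "linked (V2 \<union> (B - set ys) \<union> insert r (insert u V1)) t s"
      by (rule linked_append[OF 1 2]) (use adj_phi(2)[OF r(1)] disjs V(6-8) in auto)
    moreover have "V2 \<union> (B - set ys) \<union> insert r (insert u V1) = (A - set xs) \<union> (B - set ys)" unfolding eq by blast
    ultimately show ?thesis using linked_rev by metis
  qed
qed

section \<open>Gluing for each split of the deleted vertices over the halves\<close>

text \<open>
  In the following names the digits count the vertices of sign \<open>1\<close> and of sign \<open>- 1\<close> that are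
  deleted from \<open>A\<close> and from \<open>B\<close>.
\<close>

lemma linked_11_21:
  assumes d: "4 \<le> d" and L: "linkable A 3" "linkable B 3" and c: "16 \<le> card B"
    and A: "r1 \<in> A" "g1 \<in> A" and B: "r2 \<in> B" "r3 \<in> B" "g2 \<in> B" and st: "s \<in> A \<union> B" "t \<in> A \<union> B"
    and sg: "sg r1 = 1" "sg r2 = 1" "sg r3 = 1" "sg g1 = - 1" "sg g2 = - 1" "sg s = - 1" "sg t = - 1"
    and dist: "r2 \<noteq> r3" "distinct [g1, g2, s, t]"
  shows "linked (A \<union> B - {r1, r2, r3, g1, g2}) s t"
proof -
  have AB: "x \<noteq> y" if "x \<in> A" "y \<in> B" for x y using that disj by blast
  have eq: "A \<union> B - {r1, r2, r3, g1, g2} = (A - set [r1, g1]) \<union> (B - set [r2, r3, g2])"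
    using A B AB by auto
  have mixed: "linked (A \<union> B - {r1, r2, r3, g1, g2}) s t"
    if st: "s \<in> A" "t \<in> B" "sg s = - 1" "sg t = - 1" "distinct [g1, g2, s, t]" for s t
  proof -
    \<comment> \<open>The crossing needs a vertex of sign \<open>1\<close>, which any neighbour of
      \<open>s\<close> is. The list keeps \<open>u\<close> off the deleted \<open>r1\<close> and
      \<open>\<phi> u\<close> off the deleted \<open>g2\<close> and the end
      \<open>t\<close>.\<close>
    obtain u where u: "u \<in> A" "adj s u" "sg u = 1" "u \<notin> set [r1, \<phi> g2, \<phi> t]"
      using neighbour_A[OF st(1), of "[r1, \<phi> g2, \<phi> t]"] d st(3) by auto
    have "linked (A - set [r1, g1]) s u"
      by (rule linkableD[OF L(1)]) (use A st u sg in auto)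
    moreover have "linked (B - set [r2, r3, g2]) (\<phi> u) t"
      by (rule linkableD[OF L(2)]) (use B st u sg dist phi_A sg_phi phi_eq in auto)
    ultimately show ?thesis unfolding eq by (rule crossing) auto
  qed
  \<comment> \<open>\<open>A\<close> without \<open>r1\<close>, \<open>g1\<close> is balanced: ends
    in \<open>B\<close> make a detour through \<open>A\<close>, ends in \<open>A\<close> need an
    insertion, and ends in different halves a single crossing. Even the insertion deletes only three
    vertices from a half, so this split is available when the halves have dimension 4.\<close>
  consider "s \<in> A" "t \<in> A" | "s \<in> B" "t \<in> B" | "s \<in> A" "t \<in> B" | "s \<in> B" "t \<in> A" using st by blast
  then show ?thesis
  proof cases
    case 1
    show ?thesis unfolding eq
      by (rule insertion) (use L d A B sg dist 1 in \<open>auto simp: numeral_3_eq_3\<close>)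
  next
    case 2
    interpret sw: cube_halves B A \<phi> d by (rule swap)
    have "linked (B - set [r2, r3, g2]) s t"
      by (rule linkableD[OF L(2)]) (use B 2 sg dist in auto)
    moreover have "16 - 3 \<le> card (B - set [r2, r3, g2])"
      using c diff_card_le_card_Diff[of "set [r2, r3, g2]" B] card_length[of "[r2, r3, g2]"] by simp
    moreover have "linkable A (length [r1, g1])" using linkable_mono[OF L(1)] by simp
    ultimately have "linked ((B - set [r2, r3, g2]) \<union> (A - set [r1, g1])) s t"
      by (intro sw.detour) (use A sg in auto)
    then show ?thesis unfolding eq by (simp only: Un_commute)
  next
    case 3
    with mixed sg dist show ?thesis by blast
  next
    case 4
    with mixed[of t s] sg dist show ?thesis by (auto intro: linked_rev)
  qed
qed

text \<open>Here \<open>B\<close> without its four deleted vertices is the balanced half, so ends in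
  \<open>A\<close> make a detour through \<open>B\<close>, while ends in \<open>B\<close> need an
  insertion, which temporarily deletes a fifth vertex from \<open>B\<close>.\<close>

lemma linked_10_22:
  assumes d: "5 \<le> d" and L: "linkable A 5" "linkable B 5" and c: "16 \<le> card A"
    and A: "r1 \<in> A" and B: "g1 \<in> B" "r2 \<in> B" "r3 \<in> B" "g2 \<in> B" and st: "s \<in> A \<union> B" "t \<in> A \<union> B"
    and sg: "sg r1 = 1" "sg r2 = 1" "sg r3 = 1" "sg g1 = - 1" "sg g2 = - 1" "sg s = - 1" "sg t = - 1"
    and dist: "r2 \<noteq> r3" "distinct [g1, g2, s, t]"
  shows "linked (A \<union> B - {r1, r2, r3, g1, g2}) s t"
proof -
  interpret sw: cube_halves B A \<phi> d by (rule swap)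
  have AB: "x \<noteq> y" if "x \<in> A" "y \<in> B" for x y using that disj by blast
  have eq: "A \<union> B - {r1, r2, r3, g1, g2} = (A - set [r1]) \<union> (B - set [r2, r3, g1, g2])"
    using A B AB by auto
  have mixed: "linked (A \<union> B - {r1, r2, r3, g1, g2}) s t"
    if st: "s \<in> A" "t \<in> B" "sg s = - 1" "sg t = - 1" "distinct [g1, g2, s, t]" for s t
  proof -
    obtain u where u: "u \<in> B" "adj t u" "sg u = 1" "u \<notin> set [r2, r3, \<phi> s]"
      using neighbour_B[OF st(2), of "[r2, r3, \<phi> s]"] d st(4) by auto
    have "linked (A - set [r1]) (\<phi> u) s"
      by (rule linkableD[OF L(1)]) (use A st u sg phi_B sg_phi phi_eq in auto)
    moreover have "linked (B - set [r2, r3, g1, g2]) t u"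
      by (rule linkableD[OF L(2)]) (use B st u sg dist in auto)
    ultimately have "linked ((B - set [r2, r3, g1, g2]) \<union> (A - set [r1])) t s"
      by (intro sw.crossing) auto
    then show ?thesis unfolding eq by (simp only: Un_commute linked_rev)
  qed
  consider "s \<in> A" "t \<in> A" | "s \<in> B" "t \<in> B" | "s \<in> A" "t \<in> B" | "s \<in> B" "t \<in> A" using st by blast
  then show ?thesis
  proof cases
    case 1
    have "linked (A - set [r1]) s t"
      by (rule linkableD[OF L(1)]) (use A 1 sg dist in auto)
    moreover have "16 - 1 \<le> card (A - set [r1])"
      using c diff_card_le_card_Diff[of "set [r1]" A] card_length[of "[r1]"] by simp
    moreover have "linkable B (length [r2, r3, g1, g2])" using linkable_mono[OF L(2)] by simp
    ultimately show ?thesis unfolding eq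
      by (intro detour) (use B sg dist in auto)
  next
    case 2
    have "linkable A (length [r1])" using linkable_mono[OF L(1)] by simp
    moreover have "linkable B (Suc (length [r2, r3, g1, g2]))" using L(2) by (simp add: eval_nat_numeral)
    ultimately have "linked ((B - set [r2, r3, g1, g2]) \<union> (A - set [r1])) s t"
      by (intro sw.insertion) (use d A B sg dist 2 in auto)
    then show ?thesis unfolding eq by (simp only: Un_commute)
  next
    case 3
    with mixed sg dist show ?thesis by blast
  next
    case 4
    with mixed[of t s] sg dist show ?thesis by (auto intro: linked_rev)
  qed
qed

text \<open>
  The path runs from \<open>s\<close> to \<open>x\<close> in \<open>B\<close>, from \<open>\<phi> x\<close> to \<open>\<phi> y\<close> in \<open>A\<close>, and ends with
  \<open>y\<close>, \<open>r\<close>, \<open>u\<close>, \<open>u'\<close>, \<open>t\<close>; the last five vertices are chosen beforehand and deleted.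
\<close>

lemma linked_12_20_apart:
  assumes d: "5 \<le> d" and L: "linkable A 5" "linkable B 5"
    and A: "r1 \<in> A" "g1 \<in> A" "g2 \<in> A" "t \<in> A" and B: "r2 \<in> B" "r3 \<in> B" "s \<in> B"
    and sg: "sg r1 = 1" "sg r2 = 1" "sg r3 = 1" "sg g1 = - 1" "sg g2 = - 1" "sg s = - 1" "sg t = - 1"
    and dist: "r2 \<noteq> r3" "distinct [g1, g2, s, t]"
  shows "linked (A \<union> B - {r1, r2, r3, g1, g2}) s t"
proof -
  interpret sw: cube_halves B A \<phi> d by (rule swap)
  have AB: "x \<noteq> y" if "x \<in> A" "y \<in> B" for x y using that disj by blast
  obtain u' where u': "u' \<in> A" "adj u' t" "sg u' = 1" "u' \<notin> set [r1, \<phi> s]"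
    using neighbour_A[OF A(4), of "[r1, \<phi> s]"] d sg by auto
  define u where "u = \<phi> u'"
  have u: "u \<in> B" "adj u u'" "sg u = - 1" "u \<noteq> s" "u' = \<phi> u"
    unfolding u_def using u' phi_A adj_phi sg_phi phi_eq by auto
  obtain r where r: "r \<in> B" "adj r u" "sg r = 1" "r \<notin> set [r2, r3]"
    using neighbour_B[OF u(1), of "[r2, r3]"] d u(3) by auto
  obtain y where y: "y \<in> B" "adj y r" "sg y = - 1" "y \<notin> set [u, s, \<phi> r1]"
    using neighbour_B[OF r(1), of "[u, s, \<phi> r1]"] d r(3) by auto
  obtain x where x: "x \<in> B" "sg x = - 1" "x \<notin> set [u, y, s, \<phi> r1]"
    using neighbour_B[OF r(1), of "[u, y, s, \<phi> r1]"] d r(3) by auto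
  \<comment> \<open>Both halves now miss exactly five vertices. The signs missing from
    \<open>B\<close> add up to \<open>1\<close> and those missing from \<open>A\<close> to
    \<open>- 1\<close>, which fits ends of sign \<open>- 1\<close> in \<open>B\<close> and of sign
    \<open>1\<close> in \<open>A\<close>.\<close>
  have 1: "linked (B - set [r2, r3, r, u, y]) s x"
    by (rule linkableD[OF L(2)]) (use B sg dist u r y x in auto)
  have 2: "linked (A - set [r1, u', g1, g2, t]) (\<phi> x) (\<phi> y)"
    by (rule linkableD[OF L(1)]) (use A sg dist u u' x y phi_B sg_phi phi_eq in auto)
  have 3: "linked ((B - set [r2, r3, r, u, y]) \<union> (A - set [r1, u', g1, g2, t])) s (\<phi> y)"
    by (rule sw.crossing[OF 1 2]) auto
  have ne: "y \<noteq> r" "y \<noteq> u" "r \<noteq> u" "y \<noteq> u'" "y \<noteq> t" "r \<noteq> u'" "r \<noteq> t" "u \<noteq> u'" "u \<noteq> t" "u' \<noteq> t"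
    using AB A(4) u'(1) u(1) r(1) y(1,4) u'(3) r(3) y(3) u(3) sg(7) by auto
  have 4: "linked {y, r, u, u', t} y t"
    by (rule linked_Cons[OF linked_Cons[OF linked_Cons[OF linked_Cons[OF linked_singleton]]]]) (use y(2) r(2) u(2) u'(2) ne in auto)
  have "linked ((B - set [r2, r3, r, u, y]) \<union> (A - set [r1, u', g1, g2, t]) \<union> {y, r, u, u', t}) s t"
    by (rule linked_append[OF 3 4]) (use adj_phi(4)[OF y(1)] AB A(4) u'(1) u(1) r(1) y(1) in auto)
  moreover have "(B - set [r2, r3, r, u, y]) \<union> (A - set [r1, u', g1, g2, t]) \<union> {y, r, u, u', t}
      = A \<union> B - {r1, r2, r3, g1, g2}"
  proof -
    have "{y, r, u, u', t} \<inter> {r1, r2, r3, g1, g2} = {}"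
      using y r u u' A B sg dist AB by auto
    moreover have "{y, r, u} \<subseteq> B" "{u', t} \<subseteq> A" using y r u u' A by auto
    moreover have "A \<inter> {r2, r3, r, u, y} = {}" "B \<inter> {r1, u', g1, g2, t} = {}"
      using y r u u' A B AB by auto
    ultimately show ?thesis by auto
  qed
  ultimately show ?thesis by simp
qed

text \<open>\<open>B\<close> without \<open>r2\<close>, \<open>r3\<close> has a surplus of two
  vertices of sign \<open>- 1\<close>, so the path needs two pieces there. One of them can be the
  single vertex \<open>s\<close>: the path crosses to \<open>A\<close> at once and returns at
  \<open>v\<close> for the rest of \<open>B\<close>.\<close>

lemma linked_12_20_together:
  assumes d: "4 \<le> d" and L: "linkable A 3" "linkable B 3"
    and A: "r1 \<in> A" "g1 \<in> A" "g2 \<in> A" and B: "r2 \<in> B" "r3 \<in> B" "s \<in> B" "t \<in> B"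
    and sg: "sg r1 = 1" "sg r2 = 1" "sg r3 = 1" "sg g1 = - 1" "sg g2 = - 1" "sg s = - 1" "sg t = - 1"
    and dist: "r2 \<noteq> r3" "distinct [g1, g2, s, t]"
  shows "linked (A \<union> B - {r1, r2, r3, g1, g2}) s t"
proof -
  interpret sw: cube_halves B A \<phi> d by (rule swap)
  have AB: "x \<noteq> y" if "x \<in> A" "y \<in> B" for x y using that disj by blast
  have *: "linked (A \<union> B - {r1, r2, r3, g1, g2}) s t"
    if st: "s \<in> B" "t \<in> B" "sg s = - 1" "sg t = - 1" "s \<noteq> t" "\<phi> s \<noteq> r1" for s t
  proof -
    obtain w where w: "w \<in> B" "sg w = 1" using neighbour_B[OF st(1), of "[]"] d st(3) by auto
    obtain v where v: "v \<in> B" "sg v = - 1" "v \<notin> set [s, t, \<phi> r1]"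
      using neighbour_B[OF w(1), of "[s, t, \<phi> r1]"] d w(2) by auto
    have 1: "linked (B - set [r2, r3, s]) v t"
      by (rule linkableD[OF L(2)]) (use B sg dist st v in auto)
    have 2: "linked (A - set [r1, g1, g2]) (\<phi> s) (\<phi> v)"
      by (rule linkableD[OF L(1)]) (use A sg dist st v phi_B sg_phi phi_eq in auto)
    have "linked ((A - set [r1, g1, g2]) \<union> (B - set [r2, r3, s])) (\<phi> s) t"
      by (rule crossing[OF 2]) (use 1 in auto)
    then have "linked (insert s ((A - set [r1, g1, g2]) \<union> (B - set [r2, r3, s]))) s t"
      by (rule linked_Cons) (use adj_phi(3) AB st in auto)
    moreover have "insert s ((A - set [r1, g1, g2]) \<union> (B - set [r2, r3, s])) = A \<union> B - {r1, r2, r3, g1, g2}"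
      using A B AB st(1,3) sg(1-3) by auto
    ultimately show ?thesis by simp
  qed
  \<comment> \<open>The first crossing must not hit the deleted \<open>r1\<close>. Only one end can
    be matched to \<open>r1\<close>, so otherwise the path is started at \<open>t\<close>.\<close>
  show ?thesis
  proof (cases "\<phi> s = r1")
    case True
    then have "\<phi> t \<noteq> r1" using dist phi_eq by auto
    with *[of t s] B sg dist show ?thesis by (auto intro: linked_rev)
  qed (use * B sg dist in auto)
qed

text \<open>
  The path starts with \<open>s\<close>, \<open>a\<close>, \<open>\<phi> a\<close>, \<open>\<phi> z\<close>, \<open>\<phi> c\<close>, \<open>c\<close>. A path in \<open>A\<close> from \<open>c\<close> to \<open>t\<close> that
  treats \<open>g2\<close> as not deleted is then cut around \<open>g2\<close> and repaired in \<open>B\<close>. This needs \<open>c\<close> not to be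
  a neighbour of \<open>g2\<close>.
\<close>

lemma linked_12_20_opposite:
  assumes d: "5 \<le> d" and L: "linkable A 5" "linkable B 5"
    and A: "r1 \<in> A" "g1 \<in> A" "g2 \<in> A" "s \<in> A" "t \<in> A" and B: "r2 \<in> B" "r3 \<in> B"
    and sg: "sg r1 = 1" "sg r2 = 1" "sg r3 = 1" "sg g1 = - 1" "sg g2 = - 1" "sg s = - 1" "sg t = - 1"
    and dist: "r2 \<noteq> r3" "distinct [g1, g2, s, t]"
  shows "linked (A \<union> B - {r1, r2, r3, g1, g2}) s t"
proof -
  interpret sw: cube_halves B A \<phi> d by (rule swap)
  have AB: "x \<noteq> y" if "x \<in> A" "y \<in> B" for x y using that disj by blast
  obtain a where a: "a \<in> A" "adj s a" "sg a = 1" "a \<notin> set [r1]"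
    using neighbour_A[OF A(4), of "[r1]"] d sg by auto
  \<comment> \<open>Only \<open>\<phi> z\<close> lies on the initial segment, so \<open>z\<close>
    itself may be \<open>s\<close> or \<open>g1\<close>. It must differ from \<open>g2\<close> for
    the bound on common neighbours, and \<open>\<phi> z\<close> must not be deleted.\<close>
  obtain z where z: "z \<in> A" "adj a z" "sg z = - 1" "z \<notin> set [\<phi> r2, \<phi> r3, g2]"
    using neighbour_A[OF a(1), of "[\<phi> r2, \<phi> r3, g2]"] d a(3) by auto
  obtain e f where ef: "\<And>w. adj z w \<Longrightarrow> adj g2 w \<Longrightarrow> w = e \<or> w = f"
    using common_neighbours[of z g2] z(4) by auto
  obtain c where c: "c \<in> A" "adj z c" "sg c = 1" "c \<notin> set [a, r1, e, f]"
    using neighbour_A[OF z(1), of "[a, r1, e, f]"] d z(3) by auto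
  have cg2: "\<not> adj c g2" using ef[OF c(2)] c(4) adj_sym by auto
  have x: "\<phi> z \<in> B" "sg (\<phi> z) = 1" "\<phi> z \<noteq> r2" "\<phi> z \<noteq> r3"
    using z phi_A sg_phi phi_eq by auto
  have "linked (A - set [r1, a, g1, s]) c t"
    by (rule linkableD[OF L(1)]) (use A sg dist a c in auto)
  moreover have "g2 \<in> A - set [r1, a, g1, s]" using A sg dist a by auto
  moreover have "g2 \<noteq> c" "g2 \<noteq> t" using sg c dist by auto
  ultimately obtain V1 V2 p q where V: "linked V1 c p" "linked V2 q t" "adj p g2" "adj g2 q"
      "A - set [r1, a, g1, s] = insert g2 (V1 \<union> V2)" "V1 \<inter> V2 = {}" "g2 \<notin> V1" "g2 \<notin> V2"
    using linked_cut_around by metis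
  have sub: "V1 \<subseteq> A - set [r1, a, g1, s]" "V2 \<subseteq> A - set [r1, a, g1, s]" using V(5) by auto
  have mem: "c \<in> V1" "p \<in> V1" "q \<in> V2" using linked_ends V(1,2) by auto
  \<comment> \<open>Since \<open>c\<close> is not adjacent to \<open>g2\<close>, the vertex
    \<open>p\<close> before \<open>g2\<close> is not \<open>c\<close>. Otherwise the crossing at
    \<open>p\<close> would lead to \<open>\<phi> c\<close>, which the initial segment has already
    used.\<close>
  have pq: "p \<in> A" "q \<in> A" "p \<noteq> q" "p \<noteq> a" "q \<noteq> a" "q \<noteq> c" "p \<noteq> c"
    using sub mem V(3,6) cg2 by auto
  have sgpq: "sg p = 1" "sg q = 1" using V(3,4) sg adj_sg by force+
  let ?W = "B - set [r2, r3, \<phi> z, \<phi> a, \<phi> c]"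
  have 1: "linked ?W (\<phi> p) (\<phi> q)"
    by (rule linkableD[OF L(2)]) (use B sg dist x pq sgpq a z c phi_A sg_phi phi_eq in auto)
  have 2: "linked (?W \<union> V2) (\<phi> p) t"
    by (rule sw.crossing[OF 1]) (use V(2) sub in auto)
  have 3: "linked (V1 \<union> (?W \<union> V2)) c t"
    by (rule linked_append[OF V(1) 2]) (use adj_phi(1)[OF pq(1)] V(6) sub disj in auto)
  have adjs: "adj s a" "adj a (\<phi> a)" "adj (\<phi> a) (\<phi> z)" "adj (\<phi> z) (\<phi> c)" "adj (\<phi> c) c"
    using adj_phi phi_adj a z c by auto
  have inB: "\<phi> a \<in> B" "\<phi> z \<in> B" "\<phi> c \<in> B" using phi_A a z c by auto
  have ne: "\<phi> z \<noteq> \<phi> c" "\<phi> a \<noteq> \<phi> c" "\<phi> a \<noteq> \<phi> z" "a \<noteq> s" using phi_eq a z c sg by auto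
  have nin: "\<phi> c \<notin> V1" "\<phi> c \<notin> V2" "\<phi> z \<notin> V1" "\<phi> z \<notin> V2" "\<phi> a \<notin> V1" "\<phi> a \<notin> V2" "a \<notin> V1" "a \<notin> V2" "s \<notin> V1" "s \<notin> V2"
     "a \<notin> B" "s \<notin> B"
    using inB sub disj a(1) A(4) by auto
  have "linked (insert s (insert a (insert (\<phi> a) (insert (\<phi> z) (insert (\<phi> c) (V1 \<union> (?W \<union> V2))))))) s t"
    by (rule linked_Cons[OF linked_Cons[OF linked_Cons[OF linked_Cons[OF linked_Cons[OF 3]]]]]) (use adjs nin ne inB in auto)
  moreover have "insert s (insert a (insert (\<phi> a) (insert (\<phi> z) (insert (\<phi> c) (V1 \<union> (?W \<union> V2))))))
      = A \<union> B - {r1, r2, r3, g1, g2}"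
  proof -
    have V12: "V1 \<union> V2 = A - {r1, a, g1, s, g2}" using V(5,7,8) by auto
    have "{s, a, \<phi> a, \<phi> z, \<phi> c} \<inter> {r1, r2, r3, g1, g2} = {}"
      using a c x inB A B sg dist AB sg_phi by auto
    moreover have "A \<inter> {r2, r3} = {}" "B \<inter> {r1, g1, g2, a, s} = {}" using A B AB a by auto
    ultimately have "{s, a} \<union> (A - {r1, a, g1, s, g2}) \<union> ({\<phi> a, \<phi> z, \<phi> c} \<union> ?W) = A \<union> B - {r1, r2, r3, g1, g2}"
      using inB A(4) a(1) by auto
    then show ?thesis unfolding V12[symmetric] by (simp only: insert_is_Un[of _ "insert _ _"] insert_is_Un[of _ "_ \<union> _"]) blast
  qed
  ultimately show ?thesis by simp
qed

text \<open>The hard split has \<open>g1\<close> and \<open>g2\<close> both in \<open>A\<close>: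
  \<open>B\<close> then misses two vertices of sign \<open>1\<close> only, and each position of the
  ends needs its own construction.\<close>

lemma linked_if_separated:
  assumes d: "5 \<le> d" and L: "linkable A 5" "linkable B 5" and c: "16 \<le> card A" "16 \<le> card B"
    and A: "r1 \<in> A" and B: "r2 \<in> B" "r3 \<in> B" and g: "{g1, g2, s, t} \<subseteq> A \<union> B"
    and sg: "sg r1 = 1" "sg r2 = 1" "sg r3 = 1" "sg g1 = - 1" "sg g2 = - 1" "sg s = - 1" "sg t = - 1"
    and dist: "r2 \<noteq> r3" "distinct [g1, g2, s, t]"
  shows "linked (A \<union> B - {r1, r2, r3, g1, g2}) s t"
proof -
  have L3: "linkable A 3" "linkable B 3" and d4: "4 \<le> d" using L linkable_mono d by auto
  have st: "s \<in> A \<union> B" "t \<in> A \<union> B" using g by auto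
  consider "g1 \<in> A" "g2 \<in> B" | "g1 \<in> B" "g2 \<in> A" | "g1 \<in> B" "g2 \<in> B" | "g1 \<in> A" "g2 \<in> A" using g by blast
  then show ?thesis
  proof cases
    case 1
    show ?thesis by (rule linked_11_21[OF d4 L3 c(2) A 1(1) B 1(2) st sg dist])
  next
    case 2
    have "linked (A \<union> B - {r1, r2, r3, g2, g1}) s t"
      by (rule linked_11_21[OF d4 L3 c(2) A 2(2) B 2(1) st]) (use sg dist in auto)
    then show ?thesis by (simp add: insert_commute)
  next
    case 3
    show ?thesis by (rule linked_10_22[OF d L c(1) A 3(1) B 3(2) st sg dist])
  next
    case 4
    consider "s \<in> A" "t \<in> A" | "s \<in> B" "t \<in> B" | "t \<in> A" "s \<in> B" | "s \<in> A" "t \<in> B" using st by blast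
    then show ?thesis
    proof cases
      case 1
      show ?thesis by (rule linked_12_20_opposite[OF d L A 4 1 B sg dist])
    next
      case 2
      show ?thesis by (rule linked_12_20_together[OF d4 L3 A 4 B 2 sg dist])
    next
      case 3
      show ?thesis by (rule linked_12_20_apart[OF d L A 4 3(1) B 3(2) sg dist])
    next
      case mx: 4
      show ?thesis
        by (rule linked_rev, rule linked_12_20_apart[OF d L A 4 mx(1) B mx(2)]) (use sg dist in auto)
    qed
  qed
qed

end

section \<open>The hypercube and its symmetries\<close>

lemma linked_image:
  assumes "linked V s t" "inj_on f V" "\<And>x y. x \<in> V \<Longrightarrow> y \<in> V \<Longrightarrow> adj x y \<Longrightarrow> adj (f x) (f y)"
  shows "linked (f ` V) (f s) (f t)"
proof -
  obtain p where p: "hamiltonian_path V p" "hd p = s" "last p = t"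
    using assms by (auto simp: linked_def)
  have "successively (\<lambda>x y. adj (f x) (f y)) p"
    using p(1) assms(3) unfolding hamiltonian_path_def is_path_def
    by (auto elim!: successively_mono)
  then have "hamiltonian_path (f ` V) (map f p)"
    using p(1) assms(2) unfolding hamiltonian_path_def is_path_def
    by (auto simp: distinct_map successively_map)
  moreover have "hd (map f p) = f s" "last (map f p) = f t"
    using p by (auto simp: hamiltonian_path_def is_path_def hd_map last_map)
  ultimately show ?thesis unfolding linked_def by blast
qed

text \<open>The factor on signs is constant on the whole set, so transport multiplies the balance
  equation by \<open>1\<close> or \<open>- 1\<close> and keeps it valid.\<close>

definition cube_map :: "(vertex \<Rightarrow> vertex) \<Rightarrow> vertex set \<Rightarrow> vertex set \<Rightarrow> bool" where
  "cube_map f V W \<longleftrightarrow> bij_betw f V W \<and> (\<forall>x\<in>V. \<forall>y\<in>V. adj (f x) (f y) = adj x y) \<and>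
     (\<exists>e\<in>{1, - 1}. \<forall>x\<in>V. sg (f x) = e * sg x)"

lemma cube_map_linked:
  assumes f: "cube_map f V W" and F: "F \<subseteq> V" and st: "s \<in> V" "t \<in> V"
    and l: "linked (W - f ` F) (f s) (f t)"
  shows "linked (V - F) s t"
proof -
  have b: "bij_betw f V W" and a: "\<And>x y. x \<in> V \<Longrightarrow> y \<in> V \<Longrightarrow> adj (f x) (f y) = adj x y"
    using f by (auto simp: cube_map_def)
  have WF: "W - f ` F = f ` (V - F)"
    using b F inj_on_image_set_diff[of f V V F] by (auto simp: bij_betw_def)
  have inj: "inj_on f V" using b by (simp add: bij_betw_def)
  let ?g = "inv_into V f"
  have gf: "?g (f x) = x" if "x \<in> V" for x using inj that by simp
  have "linked (?g ` (f ` (V - F))) (?g (f s)) (?g (f t))"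
  proof (rule linked_image)
    show "linked (f ` (V - F)) (f s) (f t)" using l WF by simp
    show "inj_on ?g (f ` (V - F))" using gf by (auto simp: inj_on_def)
    show "adj (?g x) (?g y)" if "x \<in> f ` (V - F)" "y \<in> f ` (V - F)" "adj x y" for x y
      using that gf a by auto
  qed
  moreover have "?g ` (f ` (V - F)) = V - F" using gf by (force simp: image_iff)
  ultimately show ?thesis using gf st by simp
qed

lemma cube_map_sum:
  assumes "\<forall>x\<in>V. sg (f x) = e * sg x" "set F \<subseteq> V"
  shows "sum_list (map sg (map f F)) = e * sum_list (map sg F)"
  using assms(2) by (induction F) (use assms(1) in \<open>auto simp: algebra_simps\<close>)

lemma cube_map_linkable:
  assumes f: "cube_map f V W" and W: "linkable W k"
  shows "linkable V k"
  unfolding linkable_def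
proof (intro allI impI)
  fix F s t
  assume *: "set F \<subseteq> V \<and> distinct F \<and> length F \<le> k \<and> s \<in> V - set F \<and> t \<in> V - set F \<and> s \<noteq> t \<and>
     2 * sum_list (map sg F) + sg s + sg t = 0"
  have b: "f ` V = W" "inj_on f V" using f by (auto simp: cube_map_def bij_betw_def)
  obtain e where e: "\<forall>x\<in>V. sg (f x) = e * sg x" using f unfolding cube_map_def by blast
  have s: "sum_list (map sg (map f F)) = e * sum_list (map sg F)"
    using * e by (intro cube_map_sum) auto
  have "linked (W - set (map f F)) (f s) (f t)"
  proof (rule linkableD[OF W])
    show "distinct (map f F)" using * b(2) by (auto simp: distinct_map inj_on_subset)
    show "2 * sum_list (map sg (map f F)) + sg (f s) + sg (f t) = 0"
    proof -
      have "sg (f s) = e * sg s" "sg (f t) = e * sg t" using e * by auto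
      then have "2 * sum_list (map sg (map f F)) + sg (f s) + sg (f t) = e * (2 * sum_list (map sg F) + sg s + sg t)"
        unfolding s by (simp only: distrib_left mult.left_commute)
      then show ?thesis using * by simp
    qed
  qed (use * b in \<open>auto dest: inj_onD\<close>)
  then show "linked (V - set F) s t"
    using * by (intro cube_map_linked[OF f]) auto
qed

lemma finite_hypercube: "finite (hypercube n)"
  and card_hypercube: "card (hypercube n) = 2 ^ n"
  using finite_lists_length_eq[of "UNIV :: bool set" n] card_lists_length_eq[of "UNIV :: bool set" n]
  by (simp_all add: hypercube_def)

section \<open>Halves of a cube as cubes of smaller dimension\<close>

definition half :: "nat \<Rightarrow> nat \<Rightarrow> bool \<Rightarrow> vertex set" where
  "half n i b = {v \<in> hypercube n. v ! i = b}"

definition drop_coord :: "nat \<Rightarrow> vertex \<Rightarrow> vertex" where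
  "drop_coord i v = take i v @ drop (Suc i) v"

lemma flip_commute: "flip i (flip j v) = flip j (flip i v)"
  by (rule nth_equalityI) (auto simp: nth_flip)

lemma adj_flip_iff: "adj (flip i x) (flip i y) = adj x y"
proof -
  have "adj (flip i x) (flip i y)" if "adj x y" for x y
    using that by (auto simp: adj_iff_flip flip_commute[of i])
  from this[of x y] this[of "flip i x" "flip i y"] show ?thesis by auto
qed

lemma length_drop_coord: "i < length v \<Longrightarrow> length (drop_coord i v) = length v - 1"
  by (auto simp: drop_coord_def)

lemma nth_drop_coord:
  "i < length v \<Longrightarrow> j < length v - 1 \<Longrightarrow> drop_coord i v ! j = v ! (if j < i then j else Suc j)"
  by (auto simp: drop_coord_def nth_append min_def)

lemma count_list_drop_coord:
  "i < length v \<Longrightarrow> count_list v True = count_list (drop_coord i v) True + (if v ! i then 1 else 0)"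
  by (subst id_take_nth_drop[of i v]) (auto simp: drop_coord_def)

text \<open>Both halves are copies of the smaller cube; \<open>b\<close> only decides whether signs
  are preserved or reversed.\<close>

lemma cube_map_drop_coord:
  assumes "i \<le> n"
  shows "cube_map (drop_coord i) (half (Suc n) i b) (hypercube n)"
  unfolding cube_map_def
proof (intro conjI ballI)
  have len: "length v = Suc n" "v ! i = b" if "v \<in> half (Suc n) i b" for v
    using that by (auto simp: half_def hypercube_def)
  have ins: "drop_coord i v ! (if j < i then j else j - 1) = v ! j"
    if "v \<in> half (Suc n) i b" "j < Suc n" "j \<noteq> i" for v j
    using that len[of v] assms by (cases j) (auto simp: nth_drop_coord)
  have inj: "inj_on (drop_coord i) (half (Suc n) i b)"
  proof (rule inj_onI, rule nth_equalityI)
    fix x y j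
    assume *: "x \<in> half (Suc n) i b" "y \<in> half (Suc n) i b" "drop_coord i x = drop_coord i y"
    show "length x = length y" using len * by simp
    assume "j < length x"
    then show "x ! j = y ! j"
      using ins[of x j] ins[of y j] len[of x] len[of y] * by (cases "j = i") auto
  qed
  have surj: "w \<in> drop_coord i ` half (Suc n) i b" if "w \<in> hypercube n" for w
  proof
    let ?v = "take i w @ b # drop i w"
    show "w = drop_coord i ?v" using that assms by (simp add: drop_coord_def hypercube_def)
    show "?v \<in> half (Suc n) i b" using that assms by (simp add: half_def hypercube_def nth_append)
  qed
  show "bij_betw (drop_coord i) (half (Suc n) i b) (hypercube n)"
    unfolding bij_betw_def using inj surj assms
    by (auto simp: len length_drop_coord hypercube_def)
  show "\<exists>e\<in>{1, - 1}. \<forall>x\<in>half (Suc n) i b. sg (drop_coord i x) = e * sg x"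
    using assms len count_list_drop_coord[of i]
    by (intro bexI[of _ "if b then - 1 else 1"]) (auto simp: sg_def)
  fix x y assume xy: "x \<in> half (Suc n) i b" "y \<in> half (Suc n) i b"
  \<comment> \<open>\<open>?h\<close> skips \<open>i\<close>, so it sends positions of the shortened
    list to those of the full one. Vertices of one half agree at \<open>i\<close>, hence no
    differing position is lost.\<close>
  let ?h = "\<lambda>j. if j < i then j else Suc j"
  have h: "inj ?h" by (auto simp: inj_def split: if_splits)
  have "{j. j < Suc n \<and> x ! j \<noteq> y ! j} = ?h ` {j. j < n \<and> drop_coord i x ! j \<noteq> drop_coord i y ! j}"
  proof (intro equalityI subsetI)
    fix j assume j: "j \<in> {j. j < Suc n \<and> x ! j \<noteq> y ! j}"
    then have "j \<noteq> i" using len xy by auto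
    then have "j = ?h (if j < i then j else j - 1)" "(if j < i then j else j - 1) < n" using j assms by auto
    then show "j \<in> ?h ` {j. j < n \<and> drop_coord i x ! j \<noteq> drop_coord i y ! j}"
      using ins[of x j] ins[of y j] j \<open>j \<noteq> i\<close> xy by blast
  qed (use assms len xy in \<open>auto simp: nth_drop_coord split: if_splits\<close>)
  then have "card {j. j < Suc n \<and> x ! j \<noteq> y ! j} = card {j. j < n \<and> drop_coord i x ! j \<noteq> drop_coord i y ! j}"
    by (simp only: card_image[OF inj_on_subset[OF h subset_UNIV]])
  then show "adj (drop_coord i x) (drop_coord i y) = adj x y"
    using len xy assms by (simp add: adj_def length_drop_coord)
qed

lemma inj_on_flip: "inj_on (\<lambda>j. flip j x) {..<length x}"
  by (auto simp: inj_on_def dest: flip_inj)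

lemma card_neighbours_hypercube:
  assumes "x \<in> hypercube n"
  shows "card {u \<in> hypercube n. adj x u} = n"
proof -
  have "{u \<in> hypercube n. adj x u} = (\<lambda>j. flip j x) ` {..<n}"
    using assms by (auto simp: adj_iff_flip hypercube_def)
  moreover have "inj_on (\<lambda>j. flip j x) {..<n}"
    using assms inj_on_flip[of x] by (simp add: hypercube_def)
  ultimately show ?thesis by (simp add: card_image)
qed

lemma card_neighbours_half:
  assumes "x \<in> half (Suc n) i b" "i \<le> n"
  shows "card {u \<in> half (Suc n) i b. adj x u} = n"
proof -
  have "{u \<in> half (Suc n) i b. adj x u} = (\<lambda>j. flip j x) ` ({..<Suc n} - {i})"
    using assms by (auto simp: adj_iff_flip half_def hypercube_def nth_flip)
  moreover have "inj_on (\<lambda>j. flip j x) ({..<Suc n} - {i})"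
    using assms inj_on_flip[of x] by (auto simp: half_def hypercube_def intro: inj_on_subset)
  ultimately show ?thesis using assms(2) by (simp add: card_image)
qed

lemma halves:
  assumes "i \<le> n"
  shows "cube_halves (half (Suc n) i b) (half (Suc n) i (\<not> b)) (flip i) n"
proof
  show "half (Suc n) i b \<inter> half (Suc n) i (\<not> b) = {}" by (auto simp: half_def)
  show "flip i x \<in> half (Suc n) i (\<not> b)" if "x \<in> half (Suc n) i b" for x
    using that assms by (simp add: half_def hypercube_def nth_flip)
  show "flip i x \<in> half (Suc n) i b" if "x \<in> half (Suc n) i (\<not> b)" for x
    using that assms by (simp add: half_def hypercube_def nth_flip)
  show "adj x (flip i x)" if "x \<in> half (Suc n) i b \<union> half (Suc n) i (\<not> b)" for x
    using that assms by (auto simp: half_def hypercube_def adj_flip)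
qed (simp_all add: assms card_neighbours_half adj_flip_iff)

lemma half_Un: "half n i b \<union> half n i (\<not> b) = hypercube n"
  by (auto simp: half_def)

lemma card_half: "i \<le> n \<Longrightarrow> card (half (Suc n) i b) = 2 ^ n"
  using bij_betw_same_card cube_map_drop_coord card_hypercube unfolding cube_map_def by metis

section \<open>Reduction to one mass and one distribution of signs\<close>

lemma sum_list_sg:
  "e \<in> {1, - 1} \<Longrightarrow> sum_list (map sg F) =
     e * (int (length (filter (\<lambda>v. sg v = e) F)) - int (length (filter (\<lambda>v. sg v = - e) F)))"
proof (induction F)
  case (Cons v F)
  then show ?case using sg_cases[of v] by (auto simp: algebra_simps)
qed simp

lemma length_filter_sg:
  assumes "e \<in> {1, - 1}"
  shows "length (filter (\<lambda>v. sg v = e) F) + length (filter (\<lambda>v. sg v = - e) F) = length F"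
proof (induction F)
  case (Cons v F)
  then show ?case using sg_cases[of v] assms by auto
qed simp

definition linkable_exactly :: "vertex set \<Rightarrow> nat \<Rightarrow> bool" where
  "linkable_exactly V k \<longleftrightarrow> (\<forall>F s t. set F \<subseteq> V \<and> distinct F \<and> length F = k \<and> s \<in> V - set F \<and> t \<in> V - set F \<and> s \<noteq> t \<and>
     2 * sum_list (map sg F) + sg s + sg t = 0 \<longrightarrow> linked (V - set F) s t)"

text \<open>The end \<open>t\<close> joins the fault and is replaced as an end by a neighbour
  \<open>x\<close>. Balance survives because \<open>sg t = 2 * sg t + sg x\<close>. The vertices
  that \<open>x\<close> must avoid have the sign opposite to \<open>t\<close>, and balance bounds
  their number.\<close>

lemma linkable_exactly_Suc:
  assumes ex: "linkable_exactly V (Suc k)" and d: "\<And>x. x \<in> V \<Longrightarrow> k div 2 + 1 < card {u \<in> V. adj x u}"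
  shows "linkable_exactly V k"
  unfolding linkable_exactly_def
proof (intro allI impI)
  fix F s t
  assume *: "set F \<subseteq> V \<and> distinct F \<and> length F = k \<and> s \<in> V - set F \<and> t \<in> V - set F \<and> s \<noteq> t \<and>
     2 * sum_list (map sg F) + sg s + sg t = 0"
  let ?opp = "filter (\<lambda>v. sg v = - sg t) (s # F)"
  have "length ?opp \<le> k div 2 + 1"
  proof -
    define a where "a = length (filter (\<lambda>v. sg v = sg t) F)"
    define b where "b = length (filter (\<lambda>v. sg v = - sg t) F)"
    have t: "sg t \<in> {1, - 1}" using sg_cases by auto
    have ab: "a + b = k" using length_filter_sg[OF t, of F] * by (simp add: a_def b_def)
    have bal: "2 * (sg t * (int a - int b)) + sg s + sg t = 0"
      using sum_list_sg[OF t, of F] * by (simp add: a_def b_def)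
    have len: "length ?opp = b + (if sg s = - sg t then 1 else 0)" by (simp add: b_def)
    \<comment> \<open>For ends of equal sign, the opposite sign occurs once more often in the fault;
      for ends of opposite sign, \<open>s\<close> itself is the additional vertex to avoid. Either
      way the count is \<open>k div 2 + 1\<close>.\<close>
    have "b = a + 1 \<and> sg s = sg t \<or> b = a \<and> sg s = - sg t"
      using bal sg_cases[of s] sg_cases[of t] by (elim disjE) simp_all
    then show ?thesis unfolding len using ab sg_cases[of t] by auto
  qed
  then have "length ?opp < card {u \<in> V. adj t u}" using d[of t] * by fastforce
  then obtain x where x: "x \<in> V" "adj t x" "x \<notin> set ?opp"
    using exists_outside_list[of ?opp] by blast
  have sgx: "sg x = - sg t" using x adj_sg by simp
  have "sg x \<noteq> sg t" using sgx sg_cases[of t] by auto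
  then have xx: "x \<notin> set F" "x \<noteq> s" "x \<noteq> t" using x(3) sgx unfolding set_filter by auto
  have "linked (V - set (t # F)) s x"
    using ex[unfolded linkable_exactly_def, rule_format, of "t # F" s x] * x xx sgx by auto
  then have "linked (insert t (V - set (t # F))) t s"
    by (rule linked_Cons[OF linked_rev]) (use x(2) in simp_all)
  moreover have "insert t (V - set (t # F)) = V - set F" using * by auto
  ultimately show "linked (V - set F) s t" by (simp only: linked_rev)
qed

text \<open>Descent in the mass. The degree bound is the one for passing from \<open>k\<close> to
  \<open>k - 1\<close>, the most demanding step.\<close>

lemma linkable_if_exactly:
  assumes ex: "linkable_exactly V k" and d: "\<And>x. x \<in> V \<Longrightarrow> (k - 1) div 2 + 1 < card {u \<in> V. adj x u}"
  shows "linkable V k"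
proof -
  have "linkable_exactly V j" if "j \<le> k" for j
    using that
  proof (induction rule: inc_induct)
    case (step j)
    have "j div 2 + 1 < card {u \<in> V. adj x u}" if "x \<in> V" for x
    proof -
      have "j div 2 \<le> (k - 1) div 2" using step by (intro div_le_mono) auto
      then show ?thesis using d[OF that] by linarith
    qed
    then show ?case by (rule linkable_exactly_Suc[OF step(3)])
  qed (rule ex)
  then show ?thesis unfolding linkable_def linkable_exactly_def by blast
qed

lemma cube_map_flip:
  assumes "i < n" shows "cube_map (flip i) (hypercube n) (hypercube n)"
  unfolding cube_map_def
proof (intro conjI ballI)
  show "bij_betw (flip i) (hypercube n) (hypercube n)"
    by (rule bij_betw_byWitness[of _ "flip i"]) (auto simp: hypercube_def)
  show "\<exists>e\<in>{1, - 1}. \<forall>x\<in>hypercube n. sg (flip i x) = e * sg x"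
    using assms by (intro bexI[of _ "- 1"]) (auto simp: sg_flip hypercube_def)
qed (simp add: adj_flip_iff)

text \<open>Flipping one coordinate negates all signs, so it suffices to treat one sign of
  \<open>t\<close>.\<close>

lemma linkable_exactly_hypercubeI:
  assumes n: "0 < n"
    and pos: "\<And>F s t. set F \<subseteq> hypercube n \<Longrightarrow> distinct F \<Longrightarrow> length F = k \<Longrightarrow> s \<in> hypercube n - set F \<Longrightarrow>
      t \<in> hypercube n - set F \<Longrightarrow> s \<noteq> t \<Longrightarrow> sg t = - 1 \<Longrightarrow>
      2 * sum_list (map sg F) + sg s + sg t = 0 \<Longrightarrow> linked (hypercube n - set F) s t"
  shows "linkable_exactly (hypercube n) k"
  unfolding linkable_exactly_def
proof (intro allI impI)
  fix F s t
  assume *: "set F \<subseteq> hypercube n \<and> distinct F \<and> length F = k \<and> s \<in> hypercube n - set F \<and> t \<in> hypercube n - set F \<and> s \<noteq> t \<and>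
     2 * sum_list (map sg F) + sg s + sg t = 0"
  show "linked (hypercube n - set F) s t"
  proof (cases "sg t = - 1")
    case False
    let ?f = "flip 0"
    have inj: "inj ?f" by (metis injI flip_flip)
    have sgf: "sg (?f x) = - 1 * sg x" if "x \<in> hypercube n" for x
      using that n by (simp add: hypercube_def sg_flip)
    have "linked (hypercube n - set (map ?f F)) (?f s) (?f t)"
    proof (rule pos)
      have "sum_list (map sg (map ?f F)) = - 1 * sum_list (map sg F)"
        using * sgf by (intro cube_map_sum[of "hypercube n"]) auto
      then show "2 * sum_list (map sg (map ?f F)) + sg (?f s) + sg (?f t) = 0"
        using * sgf[of s] sgf[of t] by (simp del: map_map)
      show "sg (?f t) = - 1" using False sg_cases[of t] sgf[of t] * by auto
    qed (use * inj in \<open>auto simp: distinct_map inj_def inj_on_def hypercube_def\<close>)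
    then have "linked (hypercube n - ?f ` set F) (?f s) (?f t)" by (simp only: set_map)
    moreover have "set F \<subseteq> hypercube n" "s \<in> hypercube n" "t \<in> hypercube n" using * by auto
    ultimately show ?thesis using cube_map_linked[OF cube_map_flip[OF n]] by blast
  next
    case True
    with pos[of F s t] * show ?thesis by blast
  qed
qed

text \<open>An odd mass rules out ends of opposite sign. With \<open>sg t = - 1\<close>, balance
  then leaves three deleted vertices of sign \<open>1\<close> and two of sign
  \<open>- 1\<close>.\<close>

lemma linkable_5I:
  assumes n: "5 \<le> n"
    and pos: "\<And>r1 r2 r3 g1 g2 s t. {r1, r2, r3, g1, g2, s, t} \<subseteq> hypercube n \<Longrightarrow> sg r1 = 1 \<Longrightarrow> sg r2 = 1 \<Longrightarrow> sg r3 = 1 \<Longrightarrow>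
      sg g1 = - 1 \<Longrightarrow> sg g2 = - 1 \<Longrightarrow> sg s = - 1 \<Longrightarrow> sg t = - 1 \<Longrightarrow> distinct [r1, r2, r3] \<Longrightarrow>
      distinct [g1, g2, s, t] \<Longrightarrow> linked (hypercube n - {r1, r2, r3, g1, g2}) s t"
  shows "linkable (hypercube n) 5"
proof (rule linkable_if_exactly)
  show "linkable_exactly (hypercube n) 5"
  proof (rule linkable_exactly_hypercubeI)
    fix F s t
    assume *: "set F \<subseteq> hypercube n" "distinct F" "length F = 5" "s \<in> hypercube n - set F"
      "t \<in> hypercube n - set F" "s \<noteq> t" "sg t = - 1" "2 * sum_list (map sg F) + sg s + sg t = 0"
    let ?R = "filter (\<lambda>v. sg v = 1) F" and ?G = "filter (\<lambda>v. sg v = - 1) F"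
    have "length ?R = 3" "length ?G = 2" and s: "sg s = - 1"
    proof -
      have "length ?R + length ?G = 5" "2 * (int (length ?R) - int (length ?G)) + sg s - 1 = 0"
        using *(3,7,8) sum_list_sg[of 1 F] length_filter_sg[of 1 F] by simp_all
      then show "length ?R = 3" "length ?G = 2" "sg s = - 1" using sg_cases[of s] by presburger+
    qed
    then obtain r1 r2 r3 g1 g2 where R: "?R = [r1, r2, r3]" and G: "?G = [g1, g2]"
      by (auto simp: eval_nat_numeral length_Suc_conv)
    have rs: "set [r1, r2, r3] = {v \<in> set F. sg v = 1}" and gs: "set [g1, g2] = {v \<in> set F. sg v = - 1}"
      unfolding R[symmetric] G[symmetric] by auto
    have F: "set F = {r1, r2, r3, g1, g2}" using rs gs sg_cases by auto
    have d: "distinct [r1, r2, r3]" "distinct [g1, g2]"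
      unfolding R[symmetric] G[symmetric] using *(2) by simp_all
    have "linked (hypercube n - {r1, r2, r3, g1, g2}) s t"
    proof (rule pos)
      show "{r1, r2, r3, g1, g2, s, t} \<subseteq> hypercube n" using *(1,4,5) F by auto
      show "distinct [g1, g2, s, t]" using d *(4,5,6) F by auto
    qed (use rs gs s * d in auto)
    then show "linked (hypercube n - set F) s t" unfolding F .
  qed (use n in simp)
qed (use n card_neighbours_hypercube in auto)

lemma linkable_half: "linkable (hypercube n) k \<Longrightarrow> i \<le> n \<Longrightarrow> linkable (half (Suc n) i b) k"
  using cube_map_linkable cube_map_drop_coord by blast

lemma linkable_5_step:
  assumes n: "5 \<le> n" and L: "linkable (hypercube n) 5"
  shows "linkable (hypercube (Suc n)) 5"
proof (rule linkable_5I)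
  fix r1 r2 r3 g1 g2 s t
  assume sub: "{r1, r2, r3, g1, g2, s, t} \<subseteq> hypercube (Suc n)"
    and sg: "sg r1 = 1" "sg r2 = 1" "sg r3 = 1" "sg g1 = - 1" "sg g2 = - 1" "sg s = - 1" "sg t = - 1"
    and d: "distinct [r1, r2, r3]" "distinct [g1, g2, s, t]"
  have "\<exists>i<Suc n. r1 ! i \<noteq> r2 ! i"
    using sub d(1) by (auto simp: hypercube_def list_eq_iff_nth_eq)
  then obtain i where i: "i \<le> n" "r1 ! i \<noteq> r2 ! i" using less_Suc_eq_le by blast
  \<comment> \<open>\<open>x\<close> is whichever of \<open>r1\<close>, \<open>r2\<close> lies on
    the other side from \<open>r3\<close>, and \<open>b\<close> selects the half that contains
    it.\<close>
  have *: "linked (hypercube (Suc n) - {x, y, r3, g1, g2}) s t"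
    if x: "x \<in> half (Suc n) i b" and y: "y \<in> half (Suc n) i (\<not> b)" "r3 \<in> half (Suc n) i (\<not> b)"
      and sxy: "sg x = 1" "sg y = 1" "y \<noteq> r3" for x y b
  proof -
    interpret cube_halves "half (Suc n) i b" "half (Suc n) i (\<not> b)" "flip i" n
      by (rule halves[OF i(1)])
    have "16 \<le> (2::nat) ^ n" using power_increasing[of 4 n "2::nat"] n by simp
    then have "linked (half (Suc n) i b \<union> half (Suc n) i (\<not> b) - {x, y, r3, g1, g2}) s t"
      by (intro linked_if_separated) (use n L linkable_half i(1) x y sxy sg sub d half_Un card_half in auto)
    then show ?thesis unfolding half_Un .
  qed
  show "linked (hypercube (Suc n) - {r1, r2, r3, g1, g2}) s t"
  proof (cases "r3 ! i = r1 ! i")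
    case True
    with *[of r2 "r2 ! i" r1] sub sg d i show ?thesis by (auto simp: half_def insert_commute)
  next
    case False
    with *[of r1 "r1 ! i" r2] sub sg d i show ?thesis by (auto simp: half_def)
  qed
qed (use n in simp)

section \<open>Explicit paths in dimensions 4 and 5\<close>

datatype axis = X | Y | Z | V | W

text \<open>The last clause makes \<open>move\<close> total on vertices with too few coordinates. A
  step without effect would repeat a vertex, so it cannot occur in a distinct walk.\<close>

fun move :: "axis \<Rightarrow> vertex \<Rightarrow> vertex" where
  "move X (a # v) = (\<not> a) # v"
| "move Y (a # b # v) = a # (\<not> b) # v"
| "move Z (a # b # c # v) = a # b # (\<not> c) # v"
| "move V (a # b # c # d # v) = a # b # c # (\<not> d) # v"
| "move W (a # b # c # d # e # v) = a # b # c # d # (\<not> e) # v"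
| "move _ v = v"

fun walk :: "vertex \<Rightarrow> axis list \<Rightarrow> vertex list" where
  "walk v [] = [v]"
| "walk v (d # ds) = v # walk (move d v) ds"

fun pairs :: "'a list \<Rightarrow> ('a \<times> 'a) list" where
  "pairs [] = []"
| "pairs (x # xs) = map (Pair x) xs @ pairs xs"

definition cube_list :: "nat \<Rightarrow> vertex list" where
  "cube_list n = List.n_lists n [False, True]"

text \<open>Covering is tested by counting: a fault and a walk without repetitions that have
  \<open>2 ^ n\<close> vertices together exhaust the cube. Adjacency need not be tested, as each
  step flips a coordinate.\<close>

definition is_route :: "nat \<Rightarrow> vertex list \<Rightarrow> vertex \<times> vertex \<Rightarrow> axis list \<Rightarrow> bool" where
  "is_route n F e ds \<longleftrightarrow> (let p = walk (fst e) ds in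
     last p = snd e \<and> length ds + length F + 1 = 2 ^ n \<and> distinct (F @ p))"

text \<open>Each unordered pair of possible ends occurs once; reversing the path gives the other
  order.\<close>

definition odd_pairs :: "nat \<Rightarrow> vertex list \<Rightarrow> (vertex \<times> vertex) list" where
  "odd_pairs n F = pairs (filter (\<lambda>v. odd (count_list v True) \<and> v \<notin> set F) (cube_list n))"

definition routes_ok :: "nat \<Rightarrow> vertex list \<Rightarrow> axis list list \<Rightarrow> bool" where
  "routes_ok n F dss \<longleftrightarrow> list_all2 (is_route n F) (odd_pairs n F) dss"

text \<open>Representatives up to symmetry: one even vertex is moved to zero by a translation, and
  the other, of weight two or four, to a fixed position by a permutation of coordinates. The odd
  vertex remains arbitrary.\<close>

definition faults4 :: "vertex list list" where
  "faults4 = [[[False,False,False,False], r, g]. r \<leftarrow> [[True,True,False,False],[True,True,True,True]],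
     g \<leftarrow> filter (\<lambda>v. odd (count_list v True)) (cube_list 4)]"

text \<open>The even vertices are the nonzero ones in the subcube of the first three coordinates.
  The odd ones share the prefix \<open>w\<close>, whose parity forces \<open>a\<close>; one
  \<open>w\<close> of each weight represents its class under rotation.\<close>

definition faults5 :: "vertex list list" where
  "faults5 = [[[True,True,False,False,False], [True,False,True,False,False], [False,True,True,False,False],
      w @ [a, False], w @ [\<not> a, True]]. (w, a) \<leftarrow>
      [([True,False,False],False), ([True,True,True],False),
       ([False,False,False],True), ([True,True,False],True)]]"

text \<open>
  Paths found by computer search: an entry lists the directions of the steps of the path for the fault
  in the same row of \<open>faults4\<close> or \<open>faults5\<close> and for the ends in the same position of \<open>odd_pairs\<close>.
\<close>

definition routes4 :: "axis list list list" where "routes4 =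
  [[[Z,X,Y,V,Y,X,Z,X,Y,X,Z,V],[Z,Y,X,V,X,Y,Z,Y,X,Y,Z,V],[Z,X,Y,X,V,X,Y,X,Z,X,Y,X],[Z,X,Y,X,V,X,Y,X,Z,Y,X,Y],
   [Z,X,Y,X,V,Y,X,Z,X,Y,X,Z],[Z,X,Y,X,V,X,Y,Z,Y,X,Y,Z],[X,V,X,Z,X,Y,X,V,Z,V,X,V],[X,Y,X,Z,V,X,Y,Z,Y,X,Y,Z],
   [X,Y,X,Z,V,Y,X,Z,X,Y,X,Z],[X,Y,X,Z,V,X,Y,X,Z,Y,X,Y],[X,Y,X,Z,V,X,Y,X,Z,X,Y,X],[Y,X,Y,Z,V,X,Y,Z,Y,X,Y,Z],
   [Y,X,Y,Z,V,Y,X,Z,X,Y,X,Z],[Y,X,Y,Z,V,X,Y,X,Z,Y,X,Y],[Y,X,Y,Z,V,X,Y,X,Z,X,Y,X],[X,Z,X,V,X,Y,X,Z,V,Z,X,Z],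
   [X,Y,X,V,Z,X,Y,X,V,Y,X,Y],[X,Y,X,V,Z,X,Y,X,V,X,Y,X],[Y,X,Y,V,Z,X,Y,X,V,Y,X,Y],[Y,X,Y,V,Z,X,Y,X,V,X,Y,X],
   [Z,X,Z,V,X,Y,X,Z,V,X,Z,X]],
  [[Z,Y,X,V,X,Y,Z,Y,X,Y,Z,V],[Z,X,Y,V,Y,X,Z,X,Y,X,Z,V],[Z,X,Y,X,V,X,Y,X,Z,Y,X,Y],[Z,X,Y,X,V,X,Y,X,Z,X,Y,X],
   [Z,X,Y,X,V,X,Y,Z,Y,X,Y,Z],[Z,X,Y,X,V,Y,X,Z,X,Y,X,Z],[Y,V,Y,Z,Y,X,Y,V,Z,V,Y,V],[Y,X,Y,Z,V,Y,X,Z,X,Y,X,Z],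
   [Y,X,Y,Z,V,X,Y,Z,Y,X,Y,Z],[Y,X,Y,Z,V,X,Y,X,Z,X,Y,X],[Y,X,Y,Z,V,X,Y,X,Z,Y,X,Y],[X,Y,X,Z,V,Y,X,Z,X,Y,X,Z],
   [X,Y,X,Z,V,X,Y,Z,Y,X,Y,Z],[X,Y,X,Z,V,X,Y,X,Z,X,Y,X],[X,Y,X,Z,V,X,Y,X,Z,Y,X,Y],[Y,Z,Y,V,Y,X,Y,Z,V,Z,Y,Z],
   [Y,X,Y,V,Z,X,Y,X,V,X,Y,X],[Y,X,Y,V,Z,X,Y,X,V,Y,X,Y],[X,Y,X,V,Z,X,Y,X,V,X,Y,X],[X,Y,X,V,Z,X,Y,X,V,Y,X,Y],
   [X,Z,X,V,Z,X,Y,X,V,Z,X,Z]],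
  [[Z,Y,X,V,X,Y,X,Z,X,Y,X,V],[Z,V,X,Z,X,Y,X,V,Z,V,X,V],[Z,Y,X,Z,V,X,Y,Z,Y,X,Y,Z],[Z,Y,X,Z,V,Y,X,Z,X,Y,X,Z],
   [Z,Y,X,Z,V,X,Y,X,Z,Y,X,Y],[Z,Y,X,Z,V,X,Y,X,Z,X,Y,X],[Z,V,Y,Z,Y,X,Y,V,Z,V,Y,V],[Z,X,Y,Z,V,Y,X,Z,X,Y,X,Z],
   [Z,X,Y,Z,V,X,Y,Z,Y,X,Y,Z],[Z,X,Y,Z,V,X,Y,X,Z,X,Y,X],[Z,X,Y,Z,V,X,Y,X,Z,Y,X,Y],[X,Z,V,X,Z,X,Y,X,V,Z,V,X],
   [X,Z,V,Y,Z,Y,X,Y,V,Z,V,Y],[X,Z,V,X,Z,X,Y,Z,X,V,Z,V],[X,Z,V,X,Z,Y,V,Z,V,X,Z,Y],[Z,X,Z,V,Z,Y,X,Z,V,Z,X,Z],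
   [Z,Y,Z,V,Z,X,Y,Z,V,Y,Z,Y],[Z,X,Z,V,Z,Y,X,Z,V,X,Z,X],[X,V,Z,X,Y,Z,V,X,Z,Y,X,Y],[X,V,Z,X,Y,Z,V,X,Z,X,Y,X],
   [X,Z,X,V,Z,Y,X,Z,V,X,Z,X]],
  [[Z,X,Y,V,X,Y,X,Z,X,Y,X,V],[Z,V,Y,Z,Y,X,Y,V,Z,V,Y,V],[Z,X,Y,Z,V,X,Y,Z,Y,X,Y,Z],[Z,X,Y,Z,V,Y,X,Z,X,Y,X,Z],
   [Z,X,Y,Z,V,X,Y,X,Z,Y,X,Y],[Z,X,Y,Z,V,X,Y,X,Z,X,Y,X],[Z,V,X,Z,X,Y,X,V,Z,V,X,V],[Z,Y,X,Z,V,Y,X,Z,X,Y,X,Z],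
   [Z,Y,X,Z,V,X,Y,Z,Y,X,Y,Z],[Z,Y,X,Z,V,X,Y,X,Z,X,Y,X],[Z,Y,X,Z,V,X,Y,X,Z,Y,X,Y],[X,Z,V,Y,Z,Y,X,Y,V,Z,V,Y],
   [X,Z,V,X,Z,X,Y,X,V,Z,V,X],[X,Z,V,X,Z,Y,V,Z,V,X,Z,Y],[X,Z,V,X,Z,X,Y,Z,X,V,Z,V],[X,V,Z,X,Y,Z,V,Z,Y,X,Y,Z],
   [X,V,Z,X,Y,Z,V,X,Z,X,Y,X],[X,V,Z,X,Y,Z,V,X,Z,Y,X,Y],[Z,X,Z,V,Z,Y,X,Z,V,X,Z,X],[Z,Y,Z,V,Z,X,Y,Z,V,Y,Z,Y],
   [Y,Z,Y,V,Z,X,Y,Z,V,Y,Z,Y]],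
  [[V,Y,X,Z,X,Y,X,V,X,Y,X,Z],[V,Y,X,V,Z,X,Y,V,Y,X,Y,V],[V,Y,X,V,Z,Y,X,V,X,Y,X,V],[V,Z,X,V,X,Y,X,Z,V,Z,X,Z],
   [V,Y,X,V,Z,X,Y,X,V,Y,X,Y],[V,Y,X,V,Z,X,Y,X,V,X,Y,X],[V,X,Y,V,Z,Y,X,V,X,Y,X,V],[V,X,Y,V,Z,X,Y,V,Y,X,Y,V],
   [V,Z,Y,V,Y,X,Y,Z,V,Z,Y,Z],[V,X,Y,V,Z,X,Y,X,V,X,Y,X],[V,X,Y,V,Z,X,Y,X,V,Y,X,Y],[V,X,V,Z,V,Y,X,V,Z,V,X,V],
   [V,X,Z,V,Z,Y,X,Z,V,Z,X,Z],[V,Y,Z,V,Z,X,Y,Z,V,Y,Z,Y],[V,X,Z,V,Z,Y,X,Z,V,X,Z,X],[X,Z,V,Z,X,Y,X,V,X,Z,V,Y],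
   [X,Z,V,X,Y,V,Z,X,V,Y,X,Y],[X,Z,V,X,Y,V,Z,X,V,X,Y,X],[X,V,Z,X,V,X,Y,V,X,Z,V,Z],[X,V,Z,X,V,Y,Z,V,Z,X,V,Y],
   [X,V,X,Z,V,Y,X,V,Z,X,V,X]],
  [[V,X,Y,Z,X,Y,X,V,X,Y,X,Z],[V,X,Y,V,Z,X,Y,V,Y,X,Y,V],[V,X,Y,V,Z,Y,X,V,X,Y,X,V],[V,Z,Y,V,Y,X,Y,Z,V,Z,Y,Z],
   [V,X,Y,V,Z,X,Y,X,V,Y,X,Y],[V,X,Y,V,Z,X,Y,X,V,X,Y,X],[V,Y,X,V,Z,Y,X,V,X,Y,X,V],[V,Y,X,V,Z,X,Y,V,Y,X,Y,V],
   [V,Z,X,V,X,Y,X,Z,V,Z,X,Z],[V,Y,X,V,Z,X,Y,X,V,X,Y,X],[V,Y,X,V,Z,X,Y,X,V,Y,X,Y],[X,Z,V,X,Y,V,Z,V,Y,X,Y,V],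
   [X,Z,V,Z,X,Y,X,V,X,Z,V,Y],[X,Z,V,X,Y,V,Z,X,V,X,Y,X],[X,Z,V,X,Y,V,Z,X,V,Y,X,Y],[V,X,Z,V,Z,Y,X,Z,V,Z,X,Z],
   [V,X,Z,V,Z,Y,X,Z,V,X,Z,X],[V,Y,Z,V,Z,X,Y,Z,V,Y,Z,Y],[X,V,Z,X,V,Y,Z,V,Z,X,V,Y],[X,V,Z,X,V,X,Y,V,X,Z,V,Z],
   [Y,V,Y,Z,V,X,Y,V,Z,Y,V,Y]],
  [[Z,X,V,Z,X,Y,X,Z,X,V,X,Z],[Z,Y,V,Z,Y,X,Y,V,Z,V,Y,V],[Z,X,V,Z,X,Y,X,V,Z,V,X,V],[Z,X,V,Y,X,V,X,Z,V,X,Y,X],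
   [Z,X,V,Y,X,V,X,Z,V,Y,X,Y],[Z,X,V,Z,X,Y,X,V,Z,X,V,X],[Z,X,Y,Z,V,X,Y,X,Z,X,Y,V],[Z,Y,X,Z,V,X,Z,Y,Z,X,Z,V],
   [Z,X,V,X,Y,V,X,Z,V,Y,X,Y],[Z,X,V,X,Y,V,X,Z,V,X,Y,X],[Z,X,V,Z,X,Y,X,V,Z,X,V,Y],[X,Z,V,X,Z,Y,X,Z,X,V,Z,X],
   [X,Z,V,Y,Z,V,X,Z,V,Z,Y,Z],[X,Z,V,X,Z,Y,X,V,X,Z,V,X],[X,Z,V,Y,Z,V,X,Z,V,Y,Z,Y],[Y,Z,V,Y,Z,X,Y,V,Y,Z,V,Y],
   [Y,Z,V,X,Z,V,Y,Z,V,Z,X,Z],[Y,Z,V,X,Z,V,Y,Z,V,X,Z,X],[X,V,Z,X,V,Y,X,V,X,Z,V,X],[X,V,Z,Y,V,Z,X,V,Z,Y,V,Y],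
   [Y,V,Z,X,V,Z,Y,V,Z,X,V,X]],
  [[Z,X,Y,X,V,Y,X,Z,X,Y,X,V],[Z,Y,X,Z,V,X,Z,Y,Z,X,Z,V],[Z,X,Y,Z,V,X,Y,X,Z,X,Y,V],[Z,X,V,X,Y,V,X,Z,V,X,Y,X],
   [Z,X,V,X,Y,V,X,Z,V,Y,X,Y],[Z,X,V,Z,X,Y,X,V,Z,X,V,Y],[Z,X,V,Z,X,Y,X,V,Z,V,X,V],[Z,Y,V,Z,Y,X,Y,V,Z,V,Y,V],
   [Z,X,V,Y,X,V,X,Z,V,Y,X,Y],[Z,X,V,Y,X,V,X,Z,V,X,Y,X],[Z,X,V,Z,X,Y,X,V,Z,X,V,X],[Y,Z,V,X,Z,Y,X,Z,X,V,Z,Y],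
   [Y,Z,V,X,Z,V,Y,Z,V,Z,X,Z],[Y,Z,V,Y,Z,X,Y,V,Y,Z,V,Y],[Y,Z,V,X,Z,V,Y,Z,V,X,Z,X],[X,Z,V,X,Z,Y,X,V,X,Z,V,X],
   [X,Z,V,Y,Z,V,X,Z,V,Z,Y,Z],[X,Z,V,Y,Z,V,X,Z,V,Y,Z,Y],[Y,V,Z,X,V,Y,X,V,X,Z,V,Y],[Y,V,Z,X,V,Z,Y,V,Z,X,V,X],
   [X,V,Z,Y,V,Z,X,V,Z,Y,V,Y]],
  [[X,Z,X,V,Z,X,Y,X,Z,X,V,X],[X,V,X,Y,X,Z,X,Y,V,Y,X,Y],[X,Z,X,Y,X,V,X,Y,Z,X,Y,X],[X,Z,X,Y,X,V,X,Y,Z,Y,X,Y],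
   [X,Z,X,V,Z,X,Y,X,Z,V,X,V],[X,Z,X,Y,X,V,X,Z,X,Y,X,Z],[X,V,X,Y,V,Z,V,Y,X,Y,V,Z],[X,Y,X,Z,X,V,X,Z,Y,X,Z,X],
   [X,Y,X,V,Y,X,Z,X,Y,V,X,V],[X,Y,X,Z,X,V,X,Z,Y,Z,X,Z],[X,Y,X,Z,X,V,X,Y,X,Z,X,Y],[Y,X,Y,Z,X,V,X,Z,Y,X,Z,X],
   [Y,X,Y,V,Y,X,Z,X,Y,V,X,V],[Y,X,Y,Z,X,V,X,Z,Y,Z,X,Z],[Y,X,Y,Z,X,V,X,Y,X,Z,X,Y],[X,Z,X,Y,Z,V,Z,Y,X,Y,Z,V],
   [X,Y,X,Z,Y,V,Y,Z,X,Z,Y,V],[X,Y,X,V,X,Z,X,Y,X,V,X,Y],[Y,X,Y,Z,Y,V,Y,Z,X,Z,Y,V],[Y,X,Y,V,X,Z,X,Y,X,V,X,Y],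
   [Z,X,Z,V,X,Y,X,Z,X,V,X,Z]],
  [[Y,Z,X,V,Z,X,Y,X,Z,X,V,X],[Y,V,X,Y,X,Z,X,Y,V,Y,X,Y],[Y,Z,X,Y,X,V,X,Y,Z,X,Y,X],[Y,Z,X,Y,X,V,X,Y,Z,Y,X,Y],
   [Y,Z,X,V,Z,X,Y,X,Z,V,X,V],[Y,Z,X,Y,X,V,X,Z,X,Y,X,Z],[Y,V,Y,X,V,Z,V,X,Y,X,V,Z],[Y,X,Y,Z,Y,V,X,Z,Y,X,Z,X],
   [Y,X,Y,V,X,Y,Z,Y,X,V,Y,V],[Y,X,Y,Z,Y,V,X,Z,Y,Z,X,Z],[Y,X,Y,Z,Y,V,X,Y,X,Z,X,Y],[X,Y,X,Z,Y,V,X,Z,Y,X,Z,X],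
   [X,Y,X,V,X,Y,Z,Y,X,V,Y,V],[X,Y,X,Z,Y,V,X,Z,Y,Z,X,Z],[X,Y,X,Z,Y,V,X,Y,X,Z,X,Y],[Y,Z,Y,X,Z,V,Z,X,Y,X,Z,V],
   [Y,X,Y,V,Y,Z,X,V,Y,V,X,V],[Y,X,Y,Z,X,V,X,Z,Y,Z,X,V],[X,Y,X,V,Y,Z,X,V,Y,V,X,V],[X,Y,X,Z,X,V,X,Z,Y,Z,X,V],
   [X,Z,X,V,Z,X,Y,X,Z,V,X,Z]],
  [[Z,Y,X,V,Y,X,Z,X,Y,X,V,X],[Z,V,X,Y,V,Z,V,Y,X,Y,V,Z],[Z,Y,X,Z,X,V,X,Z,Y,X,Z,X],[Z,Y,X,V,Y,X,Z,X,Y,V,X,V],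
   [Z,Y,X,Z,X,V,X,Z,Y,Z,X,Z],[Z,Y,X,Z,X,V,X,Y,X,Z,X,Y],[Z,V,Y,X,V,Z,V,X,Y,X,V,Z],[Z,X,Y,Z,Y,V,X,Z,Y,X,Z,X],
   [Z,X,Y,V,X,Y,Z,Y,X,V,Y,V],[Z,X,Y,Z,Y,V,X,Z,Y,Z,X,Z],[Z,X,Y,Z,Y,V,X,Y,X,Z,X,Y],[X,Z,X,Y,Z,V,X,Y,Z,X,Y,X],
   [X,Z,X,Y,Z,V,X,Y,Z,Y,X,Y],[X,Z,X,V,X,Z,Y,Z,X,V,Z,V],[X,Z,X,Y,Z,V,X,Z,X,Y,X,Z],[Z,X,Z,V,Z,Y,X,V,Z,V,X,V],
   [Z,Y,Z,X,Y,V,Y,X,Z,X,Y,V],[Z,X,Z,Y,X,V,X,Y,Z,Y,X,V],[X,Y,X,V,Z,Y,Z,X,Z,V,Y,X],[X,Y,X,V,Y,X,Z,X,Y,V,X,Y],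
   [X,Z,X,Y,X,V,X,Y,Z,Y,X,V]],
  [[Y,V,Y,X,Y,Z,Y,X,V,X,Y,Z],[Y,X,Z,V,Z,X,Y,X,Z,X,V,X],[Y,X,Z,Y,X,V,X,Y,Z,X,Y,X],[Y,X,Z,Y,X,V,X,Y,Z,Y,X,Y],
   [Y,X,Z,V,Z,X,Y,X,Z,V,X,V],[Y,X,Z,Y,X,V,X,Z,X,Y,X,Z],[X,Y,Z,V,Z,Y,X,Y,Z,Y,V,Y],[X,Y,Z,X,Y,V,Y,X,Z,Y,X,Y],
   [X,Y,Z,X,Y,V,Y,X,Z,X,Y,X],[X,Y,Z,X,Y,V,Y,Z,Y,X,Y,Z],[X,Y,Z,V,Z,Y,X,Y,Z,V,Y,V],[X,Z,Y,X,Z,V,Y,X,Z,Y,X,Y],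
   [X,Z,Y,X,Z,V,Y,X,Z,X,Y,X],[X,Z,Y,X,Z,V,Y,Z,Y,X,Y,Z],[X,Z,Y,V,Y,Z,X,Z,Y,V,Z,V],[X,Z,X,Y,Z,V,Z,Y,X,Z,Y,V],
   [X,Y,X,Z,Y,V,Y,Z,X,Y,Z,V],[X,Y,X,V,X,Y,Z,V,X,V,Y,V],[V,X,Z,Y,X,Z,V,X,Y,Z,Y,X],[V,X,Z,Y,X,Z,V,Z,X,Z,Y,Z],
   [V,X,Y,Z,X,Y,V,Y,X,Y,Z,Y]],
  [[V,Y,X,Z,Y,X,V,X,Y,X,Z,X],[V,Y,X,Z,Y,X,V,Y,Z,X,Z,Y],[V,Y,X,Z,Y,X,V,X,Y,Z,X,Z],[V,Z,X,Y,Z,V,Z,Y,X,Y,Z,V],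
   [V,Y,X,Z,Y,V,Y,Z,X,Z,Y,V],[V,Y,X,V,X,Z,X,Y,X,V,X,Y],[V,X,Y,Z,X,Y,V,X,Z,Y,Z,X],[V,X,Y,Z,X,Y,V,Y,X,Z,Y,Z],
   [V,Z,Y,X,Z,V,Z,X,Y,X,Z,V],[V,X,Y,V,Y,Z,X,V,Y,V,X,V],[V,X,Y,Z,X,V,X,Z,Y,Z,X,V],[V,X,Z,Y,X,Z,V,Z,X,Y,Z,Y],
   [V,X,Z,V,Z,Y,X,V,Z,V,X,V],[V,Y,Z,X,Y,V,Y,X,Z,X,Y,V],[V,X,Z,Y,X,V,X,Y,Z,Y,X,V],[X,Y,X,Z,Y,X,V,Z,Y,X,Z,Y],
   [X,Y,X,Z,V,Y,V,X,V,Z,Y,X],[X,Y,X,Z,Y,X,V,X,Y,Z,X,Y],[X,Z,Y,V,Y,Z,X,Z,Y,Z,V,Z],[X,V,X,Y,V,Z,X,V,X,Y,X,V],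
   [X,V,X,Y,X,Z,X,Y,V,Y,X,Z]],
  [[Y,Z,Y,X,Y,V,Y,X,Z,X,Y,V],[Y,X,V,Y,X,Z,X,Y,V,X,Y,X],[Y,X,V,Y,X,Z,X,Y,V,Y,X,Y],[Y,X,V,Z,V,X,Y,X,V,X,Z,X],
   [Y,X,V,Z,V,X,Y,X,V,Z,X,Z],[Y,X,V,Y,X,Z,X,V,X,Y,X,V],[X,Y,V,X,Y,Z,Y,X,V,Y,X,Y],[X,Y,V,X,Y,Z,Y,X,V,X,Y,X],
   [X,Y,V,Z,V,Y,X,Y,V,Y,Z,Y],[X,Y,V,X,Y,Z,Y,V,Y,X,Y,V],[X,Y,V,Z,V,Y,X,Y,V,Z,Y,Z],[X,Z,Y,X,V,Y,X,Z,X,Y,V,X],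
   [X,Y,X,Z,X,Y,V,Z,X,Y,Z,Y],[X,Y,X,Z,X,Y,V,X,Y,Z,Y,X],[X,Y,X,Z,X,Y,V,Z,X,Z,Y,Z],[Z,X,Z,Y,X,Z,V,Z,X,Y,Z,Y],
   [Z,X,Z,Y,X,Z,V,X,Y,Z,Y,X],[Z,X,Z,Y,X,Z,V,Z,X,Z,Y,Z],[X,V,Y,X,V,Z,Y,V,Y,X,Y,V],[X,Z,X,V,X,Z,Y,Z,X,Z,V,Z],
   [Z,X,Y,V,X,Y,Z,Y,X,Y,V,Y]],
  [[Z,X,V,Y,V,X,Z,V,Y,X,Y,V],[Z,Y,Z,X,Z,V,Z,X,Y,X,Z,V],[Z,X,V,Y,V,Z,V,Y,X,Y,V,Z],[Z,X,V,Y,V,X,Z,X,V,X,Y,X],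
   [Z,X,V,Y,V,X,Z,X,V,Y,X,Y],[Z,X,V,Z,X,Y,X,V,X,Z,X,V],[X,Y,Z,Y,X,V,Z,X,Y,X,Z,V],[X,Y,Z,X,V,Z,X,Y,X,Z,V,X],
   [X,Y,Z,Y,X,Y,V,Y,Z,X,Y,X],[X,Y,Z,Y,X,Y,V,Y,Z,Y,X,Y],[X,Y,Z,Y,X,Y,V,Z,X,Y,X,Z],[X,Z,V,X,Z,Y,Z,X,V,X,Z,X],
   [X,Y,X,Z,X,Y,V,Y,X,Z,Y,Z],[X,Y,X,Z,X,Y,V,X,Z,Y,Z,X],[X,Y,X,Z,X,Y,V,Y,X,Y,Z,Y],[Y,X,Y,Z,X,Y,V,Y,X,Z,Y,Z],
   [Y,X,Y,Z,X,Y,V,X,Z,Y,Z,X],[Y,X,Y,Z,X,Y,V,Y,X,Y,Z,Y],[X,V,Z,X,V,Y,Z,V,Z,X,Z,V],[X,Y,X,V,X,Y,Z,Y,X,Y,V,Y],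
   [Y,X,Y,V,X,Y,Z,Y,X,Y,V,Y]],
  [[Y,Z,X,Y,X,V,X,Z,X,Y,X,V],[Y,X,Z,X,Y,V,Z,Y,X,Y,Z,V],[Y,X,Z,Y,V,Z,Y,X,Y,Z,V,Y],[Y,X,Z,X,Y,X,V,X,Z,Y,X,Y],
   [Y,X,Z,X,Y,X,V,X,Z,X,Y,X],[Y,X,Z,X,Y,X,V,Z,Y,X,Y,Z],[Z,X,Z,Y,Z,V,Z,Y,X,Y,Z,V],[Z,Y,V,X,V,Z,V,X,Y,X,V,Z],
   [Z,X,Z,Y,Z,X,V,X,Z,Y,X,Y],[Z,X,Z,Y,Z,X,V,X,Z,X,Y,X],[Z,X,Z,Y,Z,X,V,Z,Y,X,Y,Z],[Y,Z,V,X,V,Y,V,X,Z,X,V,Y],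
   [Y,X,Y,Z,Y,X,V,X,Y,Z,X,Z],[Y,X,Y,Z,Y,X,V,Y,Z,X,Z,Y],[Y,X,Y,Z,Y,X,V,X,Y,X,Z,X],[X,Y,X,Z,Y,X,V,X,Y,Z,X,Z],
   [X,Y,X,Z,Y,X,V,Y,Z,X,Z,Y],[X,Y,X,Z,Y,X,V,X,Y,X,Z,X],[Y,V,Z,X,Z,Y,Z,X,V,X,Z,Y],[Y,X,Y,V,Y,X,Z,X,Y,X,V,X],
   [X,Y,X,V,Y,X,Z,X,Y,X,V,X]]]"

definition routes5 :: "axis list list list" where "routes5 =
  [[[Y,V,X,Y,X,Z,X,V,W,X,Z,X,Y,X,V,Y,X,Z,X,Y,V,X,V,W,X,V],
   [Y,Z,V,X,Z,X,Y,X,Z,X,W,X,Y,X,Z,Y,X,V,X,Y,X,Z,X,Y,X,W],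
   [Y,Z,V,X,Z,Y,X,Z,X,V,W,X,Y,X,Z,X,Y,X,V,X,Z,X,Y,X,Z,W],
   [Y,Z,V,X,Z,X,Y,Z,X,V,W,X,Y,X,Z,X,V,Z,X,Y,X,Z,V,X,V,W],
   [Y,Z,V,Y,Z,Y,X,Y,Z,V,W,X,Y,X,Z,X,Y,X,V,X,Y,Z,Y,X,Y,W],
   [Y,Z,V,X,Z,X,Y,X,Z,V,W,X,Y,X,Z,X,Y,X,V,X,Y,Z,X,Y,X,W],
   [Y,Z,V,X,Z,X,Y,X,W,X,Y,Z,X,Y,X,W,X,V,W,X,Y,X,Z,Y,X,Y],
   [Y,Z,V,X,Z,X,Y,X,W,X,Y,Z,X,Y,X,W,X,V,W,X,Y,X,Z,X,Y,X],
   [Y,Z,V,X,Z,X,Y,X,W,X,Y,Z,X,Y,X,W,X,V,W,X,Y,Z,Y,X,Y,Z],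
   [Y,Z,V,X,Z,X,Y,X,W,X,Y,Z,X,Y,X,W,X,V,W,Y,X,Z,X,Y,X,Z],
   [Y,Z,V,X,Z,X,Y,X,W,V,Y,X,Y,Z,Y,X,Y,W,V,X,W,X,Y,X,Z,Y],
   [Y,Z,V,X,Z,X,Y,X,W,X,Y,V,X,Y,X,Z,Y,X,Y,W,V,X,W,X,Y,X],
   [Y,Z,V,X,Z,X,Y,X,W,X,Y,Z,X,V,X,Z,X,Y,X,Z,X,W,V,X,W,X],
   [Z,Y,V,X,Y,X,Z,X,Y,X,W,X,Y,X,Z,Y,X,V,X,Y,X,Z,X,Y,X,W],
   [Z,Y,V,X,Y,Z,X,Y,X,V,W,X,Y,X,Z,X,Y,X,V,X,Z,X,Y,X,Z,W],
   [Z,Y,V,Y,X,Z,X,Y,X,V,W,X,Y,X,Z,X,V,Z,X,Y,X,Z,V,X,V,W],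
   [Z,Y,V,X,Y,X,Z,Y,X,V,W,X,Y,X,Z,X,Y,X,V,X,Y,Z,Y,X,Y,W],
   [Z,Y,V,X,Y,X,Z,X,Y,V,W,X,Y,X,Z,X,Y,X,V,X,Y,Z,X,Y,X,W],
   [Z,Y,V,X,Y,X,Z,X,W,X,Z,Y,X,Z,X,W,X,V,W,X,Y,X,Z,Y,X,Y],
   [Z,Y,V,X,Y,X,Z,X,W,X,Z,Y,X,Z,X,W,X,V,W,X,Y,X,Z,X,Y,X],
   [Z,Y,V,X,Y,X,Z,X,W,X,Z,Y,X,Z,X,W,X,V,W,X,Y,Z,Y,X,Y,Z],
   [Z,Y,V,X,Y,X,Z,X,W,X,Z,Y,X,Z,X,W,X,V,W,Y,X,Z,X,Y,X,Z],
   [Z,Y,V,X,Y,X,Z,X,W,X,Z,V,X,Z,X,Y,Z,X,Z,W,V,X,W,X,Z,X],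
   [Z,Y,V,X,Y,X,Z,X,W,V,Z,X,Z,Y,Z,X,Z,W,V,X,W,X,Z,X,Y,Z],
   [Z,Y,V,X,Y,X,Z,X,W,X,Z,Y,X,V,X,Y,X,Z,X,Y,X,W,V,X,W,X],
   [V,X,Y,X,Z,Y,X,V,Y,Z,W,X,Z,X,Y,X,Z,X,V,Y,X,Y,Z,X,Y,W],
   [V,X,Y,X,Z,X,Y,V,Y,Z,W,X,Z,X,V,Z,X,Y,X,Z,V,Z,X,Z,V,W],
   [V,X,Y,V,Z,Y,V,X,Y,X,W,Y,X,Z,X,Y,V,Y,X,Z,X,Y,X,Z,V,W],
   [V,Y,Z,Y,W,Z,Y,V,Y,Z,Y,X,Y,Z,Y,W,Z,Y,V,Y,Z,W,Z,Y,Z,W],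
   [V,X,Y,X,Z,Y,X,Y,W,Y,X,Z,X,Y,X,V,Y,X,Y,W,Z,Y,W,X,Y,X],
   [V,X,Y,X,Z,Y,X,Y,W,Y,X,Z,X,Y,X,V,Y,X,Y,W,Z,Y,W,Y,X,Y],
   [V,X,Y,X,Z,Y,X,Y,W,Y,X,Z,X,V,X,Z,Y,X,Y,W,Y,Z,W,V,X,V],
   [V,X,Y,X,Z,Y,X,Y,W,Y,X,Z,X,Y,X,V,Y,Z,Y,X,Y,W,Y,Z,W,Y],
   [V,X,Y,X,Z,Y,X,Y,W,Z,X,Y,X,V,X,Y,X,W,Z,Y,W,Y,X,Y,V,X],
   [V,X,Y,X,Z,Y,X,Y,W,Y,X,Z,X,V,X,Z,X,W,Y,Z,W,Z,X,Z,V,X],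
   [V,X,Y,X,Z,Y,X,Y,W,Y,X,V,Y,X,Y,W,Y,Z,W,X,Y,X,V,Y,X,Y],
   [X,Z,X,V,Z,Y,V,Z,X,V,W,X,Y,X,Z,X,V,Z,X,Y,X,Z,V,X,V,W],
   [X,Y,X,V,Y,Z,V,Y,X,V,W,X,Y,X,Z,X,Y,X,V,X,Y,Z,Y,X,Y,W],
   [X,Y,X,V,Y,Z,V,X,Y,V,W,X,Y,X,Z,X,Y,X,V,X,Y,Z,X,Y,X,W],
   [X,Y,X,V,Y,Z,V,X,W,X,Z,Y,X,Z,X,W,X,V,W,X,Y,X,Z,Y,X,Y],
   [X,Y,X,V,Y,Z,V,X,W,X,Z,Y,X,Z,X,W,X,V,W,X,Y,X,Z,X,Y,X],
   [X,Y,X,V,Y,Z,V,X,W,X,Z,Y,X,Z,X,W,X,V,W,X,Y,Z,Y,X,Y,Z],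
   [X,Y,X,V,Y,Z,V,X,W,X,Z,Y,X,Z,X,W,X,V,W,Y,X,Z,X,Y,X,Z],
   [X,Y,X,V,Y,Z,V,X,W,X,Z,V,X,Z,X,Y,Z,X,Z,W,V,X,W,X,Z,X],
   [X,Y,X,V,Y,Z,V,X,W,V,Z,X,Z,Y,Z,X,Z,W,V,X,W,X,Z,X,Y,Z],
   [X,Y,X,V,Y,Z,V,X,W,X,Z,Y,X,V,X,Y,X,Z,X,Y,X,W,V,X,W,X],
   [Y,X,Y,V,Y,Z,V,Y,X,V,W,X,Y,X,Z,X,Y,X,V,X,Y,Z,Y,X,Y,W],
   [Y,Z,Y,V,W,X,Y,X,Z,Y,V,Z,Y,X,Y,Z,Y,V,Y,W,Y,Z,V,Z,Y,Z],
   [Y,Z,Y,V,W,X,Y,X,Z,Y,V,Z,Y,X,Y,W,Y,V,Z,Y,V,Y,W,Y,V,Y],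
   [Y,Z,Y,V,W,X,Y,X,Z,X,Y,W,Y,Z,V,Y,Z,Y,W,Y,Z,Y,X,Y,Z,V],
   [Y,Z,Y,V,W,X,Y,W,Z,Y,V,Y,Z,Y,W,X,Y,X,Z,Y,X,V,X,Y,X,Z],
   [Y,Z,Y,V,W,Y,Z,Y,V,Z,Y,X,Y,W,Y,V,W,Z,V,Y,W,Y,V,Y,W,Z],
   [Y,Z,Y,V,W,X,Y,X,Z,Y,V,Z,Y,X,Y,W,Y,V,Z,Y,V,Y,W,V,Y,V],
   [Y,Z,Y,V,W,X,Y,X,Z,Y,V,X,V,Y,V,W,Y,V,Y,Z,V,Y,W,X,Y,X],
   [Y,Z,Y,V,W,X,Y,X,Z,Y,V,X,V,Y,V,W,Y,V,Y,Z,V,Y,W,Y,X,Y],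
   [Z,Y,Z,V,W,X,Y,X,Z,Y,V,Z,Y,X,Y,Z,Y,V,Y,W,Y,Z,V,Z,Y,Z],
   [Z,Y,Z,V,W,X,Y,X,Z,Y,V,Z,Y,X,Y,W,Y,V,Z,Y,V,Y,W,Y,V,Y],
   [Z,Y,Z,V,W,X,Y,X,Z,X,Y,W,Y,Z,V,Y,Z,Y,W,Y,Z,Y,X,Y,Z,V],
   [Z,Y,Z,V,W,X,Y,W,Z,Y,V,Y,Z,Y,W,X,Y,X,Z,Y,X,V,X,Y,X,Z],
   [Z,Y,Z,V,W,Y,Z,Y,V,Z,Y,X,Y,W,Y,V,W,Z,V,Y,W,Y,V,Y,W,Z],
   [Z,Y,Z,V,W,X,Y,X,Z,Y,V,Z,Y,X,Y,W,Y,V,Z,Y,V,Y,W,V,Y,V],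
   [Z,Y,Z,V,W,X,Y,X,Z,Y,V,X,V,Y,V,W,Y,V,Y,Z,V,Y,W,X,Y,X],
   [Z,Y,Z,V,W,X,Y,X,Z,Y,V,X,V,Y,V,W,Y,V,Y,Z,V,Y,W,Y,X,Y],
   [X,V,W,X,V,X,Y,V,Z,Y,V,W,Y,Z,X,V,W,V,Z,Y,V,W,V,Y,V,W],
   [X,V,W,X,V,X,Y,V,Z,X,Z,V,Z,Y,X,W,X,Y,X,Z,X,V,Z,Y,W,X],
   [X,V,W,X,V,X,Y,W,Z,Y,W,V,Y,X,Y,V,Y,Z,W,Z,Y,V,Y,Z,W,X],
   [X,V,W,Y,Z,Y,V,Z,Y,W,Z,Y,X,V,Y,Z,V,Z,W,Y,Z,Y,V,Z,Y,Z],
   [X,V,W,X,V,X,Y,V,Z,Y,V,W,Y,Z,X,V,W,V,Z,V,Y,W,Y,V,Y,W],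
   [X,V,W,X,V,X,Y,V,Z,Y,V,W,Y,Z,X,V,W,Z,Y,V,W,V,Y,V,W,Z],
   [X,V,W,X,V,Y,X,V,X,W,V,X,Z,Y,X,Y,V,Y,W,X,Y,X,V,Y,X,Z],
   [X,Z,X,W,Z,Y,W,Z,X,W,V,X,Y,X,Z,X,W,Z,X,Y,X,Z,W,X,W,V],
   [X,Y,X,W,Y,Z,W,Y,X,W,V,X,Y,X,Z,X,Y,X,W,X,Y,Z,Y,X,Y,V],
   [X,Y,X,W,Y,Z,W,X,Y,W,V,X,Y,X,Z,X,Y,X,W,X,Y,Z,X,Y,X,V],
   [X,Y,X,W,Y,Z,W,X,V,X,Z,W,X,Z,X,Y,Z,X,Z,V,W,X,V,X,Z,X],
   [X,Y,X,W,Y,Z,W,X,V,W,Z,X,Z,Y,Z,X,Z,V,W,X,V,X,Z,X,Y,Z],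
   [X,Y,X,W,Y,Z,W,X,V,X,Z,Y,X,W,X,Y,X,Z,X,Y,X,V,W,X,V,X],
   [Y,X,Y,W,Y,Z,W,Y,X,W,V,X,Y,X,Z,X,Y,X,W,X,Y,Z,Y,X,Y,V],
   [Y,Z,Y,W,V,X,Y,X,Z,Y,W,Z,Y,X,Y,Z,Y,W,Y,V,Y,Z,W,Z,Y,Z],
   [Y,Z,Y,W,V,X,Y,X,Z,Y,W,Z,Y,X,Y,V,Y,W,Z,Y,V,Y,W,V,Y,V],
   [Y,Z,Y,W,V,X,Y,X,Z,Y,W,X,W,Y,W,V,Y,W,Y,Z,W,Y,V,X,Y,X],
   [Y,Z,Y,W,V,X,Y,X,Z,Y,W,X,W,Y,W,V,Y,W,Y,Z,W,Y,V,Y,X,Y],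
   [Z,Y,Z,W,V,X,Y,X,Z,Y,W,Z,Y,X,Y,Z,Y,W,Y,V,Y,Z,W,Z,Y,Z],
   [Z,Y,Z,W,V,X,Y,X,Z,Y,W,Z,Y,X,Y,V,Y,W,Z,Y,V,Y,W,V,Y,V],
   [Z,Y,Z,W,V,X,Y,X,Z,Y,W,X,W,Y,W,V,Y,W,Y,Z,W,Y,V,X,Y,X],
   [Z,Y,Z,W,V,X,Y,X,Z,Y,W,X,W,Y,W,V,Y,W,Y,Z,W,Y,V,Y,X,Y],
   [X,W,V,X,W,X,Y,V,Z,Y,V,W,Y,Z,X,V,W,V,Z,V,Y,W,Y,V,Y,W],
   [X,W,V,X,W,X,Y,V,Z,Y,V,W,Y,Z,X,V,W,Z,Y,V,W,V,Y,V,W,Z],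
   [X,W,V,X,W,Y,X,V,X,W,V,X,Z,Y,X,Y,V,Y,W,X,Y,X,V,Y,X,Z],
   [X,V,Y,Z,Y,W,V,Z,Y,Z,W,Y,X,V,Z,W,V,Z,Y,Z,V,Z,W,Z,V,Z],
   [X,V,Y,Z,Y,W,V,Z,Y,Z,W,X,Z,V,Y,Z,Y,W,Z,Y,V,Y,Z,Y,W,X],
   [X,V,Z,Y,Z,W,V,Y,Z,Y,W,X,Y,V,Y,Z,Y,W,Z,Y,V,Y,Z,Y,W,X]],
  [[X,Z,V,X,Y,X,W,Y,X,V,X,Y,X,Z,Y,X,Y,V,X,Y,X,W,X,Y,X,V],
   [X,Y,V,X,Z,X,W,Z,X,V,X,Z,X,Y,Z,X,Z,V,X,Z,X,W,X,Z,X,V],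
   [X,Y,V,X,Z,X,W,Z,X,V,X,Z,X,Y,Z,X,Z,W,V,X,Z,W,Z,X,Z,W],
   [X,Y,V,Y,X,Z,Y,X,Y,V,W,X,Y,X,V,Y,X,Z,X,Y,V,Y,X,Y,V,W],
   [X,Y,V,X,Z,X,W,Z,X,V,X,Z,X,Y,Z,X,Z,W,V,Z,X,W,X,Z,X,W],
   [X,Y,V,X,Z,Y,Z,X,Z,V,W,X,Y,X,Z,X,Y,X,V,Y,X,Y,Z,X,Y,W],
   [X,Y,V,X,Z,X,W,Z,X,V,X,Z,X,Y,Z,V,Z,W,Z,X,Z,V,W,V,Z,V],
   [X,Y,V,X,Z,X,W,Z,X,Y,W,X,W,Z,X,W,X,V,W,X,Y,X,Z,Y,X,Y],
   [X,Y,V,X,Z,X,W,Z,X,V,X,Y,X,V,X,W,X,Z,W,X,W,V,W,Y,X,Y],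
   [X,Y,V,X,Z,X,W,Z,X,V,X,Y,X,V,X,W,X,Z,X,V,W,V,X,V,Y,X],
   [X,Y,V,X,Z,X,W,Z,X,V,X,Z,X,Y,Z,X,Z,W,V,X,Z,X,W,Z,X,Z],
   [X,Y,V,X,Z,X,W,V,X,Y,X,W,V,X,Z,X,W,Z,X,Z,Y,V,Y,X,Y,V],
   [X,Y,V,X,Z,X,W,Z,X,V,X,Z,X,Y,Z,X,Z,W,V,X,Z,X,W,X,Z,X],
   [Y,X,V,X,Y,X,Z,X,Y,X,W,X,Y,Z,X,Y,X,V,X,Y,X,Z,X,Y,X,W],
   [Y,X,V,Y,Z,Y,W,Z,Y,V,Y,Z,Y,X,Z,Y,Z,W,V,Y,Z,W,Z,Y,Z,W],
   [Y,X,V,X,Y,Z,X,Y,X,V,W,X,Y,X,V,Y,X,Z,X,Y,V,Y,X,Y,V,W],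
   [Y,X,V,X,Y,X,Z,X,Y,V,W,X,Y,X,V,Y,Z,Y,X,V,X,Y,X,V,Z,W],
   [Y,X,V,X,Y,X,Z,Y,X,V,W,X,Y,X,Z,X,Y,X,V,Y,X,Y,Z,X,Y,W],
   [Y,X,V,X,Y,X,Z,X,W,Z,X,Y,X,Z,X,W,X,V,W,X,Y,X,Z,X,Y,X],
   [Y,X,V,X,Y,X,Z,X,W,Z,X,Y,X,Z,X,W,X,V,W,X,Y,X,Z,Y,X,Y],
   [Y,X,V,X,Y,X,Z,X,W,Z,X,Y,X,Z,X,W,X,V,W,Y,X,Z,X,Y,X,Z],
   [Y,X,V,X,Y,X,Z,X,W,Z,X,Y,X,Z,X,W,X,V,W,X,Y,Z,Y,X,Y,Z],
   [Y,X,V,X,Y,X,Z,X,W,Z,X,V,X,Z,X,Y,Z,X,Z,W,V,X,W,X,Z,X],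
   [Y,X,V,X,Y,X,Z,X,W,V,X,Y,X,W,V,X,W,X,Z,X,Y,V,Y,X,Y,V],
   [Y,X,V,X,Y,X,Z,X,W,Z,X,Y,X,V,X,Y,X,Z,X,Y,X,W,V,X,W,X],
   [Z,X,V,Y,Z,Y,X,Y,Z,V,W,X,Z,X,V,Z,X,Y,Z,X,V,X,Z,X,V,W],
   [Z,X,V,X,Z,X,Y,X,Z,V,W,X,Z,X,V,Z,Y,Z,X,V,X,Z,X,V,Y,W],
   [Z,X,V,X,Z,Y,X,Z,X,V,W,X,Z,X,V,Z,X,Y,X,Z,V,Z,X,Z,V,W],
   [Z,X,V,X,Z,X,Y,Z,X,V,W,X,Z,X,Y,X,Z,X,V,Y,X,Y,Z,X,Y,W],
   [Z,X,V,X,Z,X,Y,X,W,Y,X,Z,X,Y,X,W,X,V,W,X,Y,Z,Y,X,Y,Z],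
   [Z,X,V,X,Z,X,Y,X,W,Y,X,Z,X,Y,X,W,X,V,W,Y,X,Z,X,Y,X,Z],
   [Z,X,V,X,Z,X,Y,X,W,Y,X,Z,X,Y,X,W,X,V,W,X,Y,X,Z,Y,X,Y],
   [Z,X,V,X,Z,X,Y,X,W,Y,X,Z,X,Y,X,W,X,V,W,X,Y,X,Z,X,Y,X],
   [Z,X,V,X,Z,X,Y,X,W,Y,X,V,X,Y,X,Z,Y,X,Y,W,V,X,W,X,Y,X],
   [Z,X,V,X,Z,X,Y,X,W,Y,X,Z,X,V,X,Z,X,Y,X,Z,X,W,V,X,W,X],
   [Z,X,V,X,Z,X,Y,X,W,V,X,Y,X,Z,X,Y,X,W,V,X,W,X,Y,X,Z,X],
   [X,V,X,Y,V,Z,X,Y,X,V,W,X,Y,X,V,Y,X,Z,X,Y,V,Y,X,Y,V,W],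
   [X,V,X,Y,V,X,Z,X,Y,V,W,X,Y,X,V,Y,Z,Y,X,V,X,Y,X,V,Z,W],
   [X,V,X,Y,V,X,Z,Y,X,V,W,X,Y,X,Z,X,Y,X,V,Y,X,Y,Z,X,Y,W],
   [X,V,X,Y,V,X,Z,X,W,Z,X,Y,X,Z,X,W,X,V,W,X,Y,X,Z,X,Y,X],
   [X,V,X,Y,V,X,Z,X,W,Z,X,Y,X,Z,X,W,X,V,W,X,Y,X,Z,Y,X,Y],
   [X,V,X,Y,V,X,Z,X,W,Z,X,Y,X,Z,X,W,X,V,W,Y,X,Z,X,Y,X,Z],
   [X,V,X,Y,V,X,Z,X,W,Z,X,Y,X,Z,X,W,X,V,W,X,Y,Z,Y,X,Y,Z],
   [X,V,X,Y,V,X,Z,X,W,Z,X,V,X,Z,X,Y,Z,X,Z,W,V,X,W,X,Z,X],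
   [X,V,X,Y,V,X,Z,X,W,V,X,Y,X,W,V,X,W,X,Z,X,Y,V,Y,X,Y,V],
   [X,V,X,Y,V,X,Z,X,W,Z,X,Y,X,V,X,Y,X,Z,X,Y,X,W,V,X,W,X],
   [Z,X,Z,V,Y,X,V,X,Z,V,W,X,Y,X,V,Y,Z,Y,X,V,X,Y,X,V,Z,W],
   [Z,Y,Z,V,X,Y,V,Y,Z,V,W,X,Y,X,Z,X,Y,X,V,Y,X,Y,Z,X,Y,W],
   [Z,X,Z,V,Y,X,V,X,W,X,Y,X,Z,Y,X,W,X,V,W,X,Y,X,Z,X,Y,X],
   [Z,X,Z,V,Y,X,V,X,W,X,Y,X,Z,Y,X,W,X,V,W,X,Y,X,Z,Y,X,Y],
   [Z,X,Z,V,Y,X,V,X,W,X,Y,X,Z,Y,X,W,X,V,W,Y,X,Z,X,Y,X,Z],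
   [Z,X,Z,V,Y,X,V,X,W,X,Y,X,Z,Y,X,W,X,V,W,X,Y,Z,Y,X,Y,Z],
   [Z,X,Z,V,Y,X,V,X,W,Y,X,V,X,Y,X,Z,Y,X,V,Y,V,W,V,X,W,Z],
   [Z,X,Z,V,Y,X,V,X,W,X,Y,V,Y,X,Y,Z,X,Y,X,W,V,X,W,X,Y,Z],
   [Z,X,Z,V,Y,X,V,X,W,X,Y,X,Z,V,X,Z,X,Y,X,Z,X,W,V,X,W,X],
   [Y,Z,Y,V,X,Y,V,Y,Z,V,W,X,Y,X,Z,X,Y,X,V,Y,X,Y,Z,X,Y,W],
   [Y,X,Y,V,Z,X,V,X,W,X,Z,X,Y,Z,X,W,X,V,W,X,Y,Z,Y,X,Y,Z],
   [Y,X,Y,V,Z,X,V,X,W,X,Z,X,Y,Z,X,W,X,V,W,Y,X,Z,X,Y,X,Z],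
   [Y,X,Y,V,Z,X,V,X,W,X,Z,X,Y,Z,X,W,X,V,W,X,Y,X,Z,Y,X,Y],
   [Y,X,Y,V,Z,X,V,X,W,X,Z,X,Y,Z,X,W,X,V,W,X,Y,X,Z,X,Y,X],
   [Y,X,Y,V,Z,X,V,X,W,Z,X,V,X,Z,X,Y,Z,X,V,Z,V,W,V,X,W,Y],
   [Y,X,Y,V,Z,X,V,X,W,X,Z,X,Y,V,X,Y,X,Z,X,Y,X,W,V,X,W,X],
   [Y,X,Y,V,Z,X,V,X,W,X,Z,V,Y,X,Y,Z,X,Y,X,W,V,X,W,X,Z,Y],
   [X,Y,X,V,Z,X,V,X,W,X,Z,X,Y,Z,X,W,X,V,W,X,Y,Z,Y,X,Y,Z],
   [X,Y,X,V,Z,X,V,X,W,X,Z,X,Y,Z,X,W,X,V,W,Y,X,Z,X,Y,X,Z],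
   [X,Y,X,V,Z,X,V,X,W,X,Z,X,Y,Z,X,W,X,V,W,X,Y,X,Z,Y,X,Y],
   [X,Y,X,V,Z,X,V,X,W,X,Z,X,Y,Z,X,W,X,V,W,X,Y,X,Z,X,Y,X],
   [X,Y,X,V,Z,X,V,X,W,Z,X,V,X,Z,X,Y,Z,X,V,Z,V,W,V,X,W,Y],
   [X,Y,X,V,Z,X,V,X,W,X,Z,X,Y,V,X,Y,X,Z,X,Y,X,W,V,X,W,X],
   [X,Y,X,V,Z,X,V,X,W,X,Z,V,Y,X,Y,Z,X,Y,X,W,V,X,W,X,Z,Y],
   [X,W,X,Y,W,Z,X,Y,X,W,V,X,Y,X,W,Y,X,Z,X,Y,W,Y,X,Y,W,V],
   [X,W,X,Y,W,X,Z,X,Y,W,V,X,Y,X,W,Y,Z,Y,X,W,X,Y,X,W,Z,V],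
   [X,W,X,Y,W,X,Z,Y,X,W,V,X,Y,X,Z,X,Y,X,W,Y,X,Y,Z,X,Y,V],
   [X,W,X,Y,W,X,Z,X,V,Z,X,W,X,Z,X,Y,Z,X,Z,V,W,X,V,X,Z,X],
   [X,W,X,Y,W,X,Z,X,V,W,X,Y,X,V,W,X,V,X,Z,X,Y,W,Y,X,Y,W],
   [X,W,X,Y,W,X,Z,X,V,Z,X,Y,X,W,X,Y,X,Z,X,Y,X,V,W,X,V,X],
   [Z,X,Z,W,Y,X,W,X,Z,W,V,X,Y,X,W,Y,Z,Y,X,W,X,Y,X,W,Z,V],
   [Z,Y,Z,W,X,Y,W,Y,Z,W,V,X,Y,X,Z,X,Y,X,W,Y,X,Y,Z,X,Y,V],
   [Z,X,Z,W,Y,X,W,X,V,Y,X,W,X,Y,X,Z,Y,X,W,Y,W,V,W,X,V,Z],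
   [Z,X,Z,W,Y,X,W,X,V,X,Y,W,Y,X,Y,Z,X,Y,X,V,W,X,V,X,Y,Z],
   [Z,X,Z,W,Y,X,W,X,V,X,Y,X,Z,W,X,Z,X,Y,X,Z,X,V,W,X,V,X],
   [Y,Z,Y,W,X,Y,W,Y,Z,W,V,X,Y,X,Z,X,Y,X,W,Y,X,Y,Z,X,Y,V],
   [Y,X,Y,W,Z,X,W,X,V,Z,X,W,X,Z,X,Y,Z,X,W,Z,W,V,W,X,V,Y],
   [Y,X,Y,W,Z,X,W,X,V,X,Z,X,Y,W,X,Y,X,Z,X,Y,X,V,W,X,V,X],
   [Y,X,Y,W,Z,X,W,X,V,X,Z,W,Y,X,Y,Z,X,Y,X,V,W,X,V,X,Z,Y],
   [X,Y,X,W,Z,X,W,X,V,Z,X,W,X,Z,X,Y,Z,X,W,Z,W,V,W,X,V,Y],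
   [X,Y,X,W,Z,X,W,X,V,X,Z,X,Y,W,X,Y,X,Z,X,Y,X,V,W,X,V,X],
   [X,Y,X,W,Z,X,W,X,V,X,Z,W,Y,X,Y,Z,X,Y,X,V,W,X,V,X,Z,Y],
   [Y,V,Z,X,Z,W,Y,X,W,X,V,W,X,Y,X,Z,X,Y,X,V,W,X,V,X,Y,Z],
   [Y,V,Z,X,Z,W,Y,X,W,X,V,Y,Z,W,X,Z,X,Y,X,Z,X,V,W,X,V,X],
   [X,V,Z,X,Z,W,V,X,Z,Y,Z,V,X,Z,W,X,V,Z,V,X,V,W,Z,Y,W,Y]],
  [[X,Z,V,X,Z,Y,X,Z,X,V,W,X,Y,X,Z,Y,V,Y,X,Z,X,Y,X,Z,V,W],
   [X,Y,V,X,Y,Z,X,Y,X,V,W,X,Z,X,Y,Z,V,Y,X,Z,X,Y,X,Z,V,W],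
   [X,Y,V,X,Y,Z,X,V,W,X,Z,Y,X,Z,X,V,Y,X,Z,X,Y,X,Z,W,X,V],
   [X,Y,V,Z,Y,V,W,X,Z,Y,X,Z,X,W,V,Y,Z,W,X,Y,Z,Y,X,Y,Z,W],
   [X,Y,V,X,Y,W,X,Y,X,Z,X,W,X,V,W,X,Z,X,Y,Z,X,W,V,W,X,W],
   [X,Y,V,X,Y,Z,X,V,W,X,Z,Y,X,Z,X,W,V,W,Y,X,Z,X,Y,X,Z,W],
   [X,Y,V,X,Y,Z,X,V,W,X,Z,V,X,Z,X,Y,Z,X,Z,W,X,V,W,X,Z,X],
   [X,Y,V,X,Y,Z,X,V,W,Y,Z,X,Y,V,X,Y,X,Z,Y,X,Y,W,X,V,W,Y],
   [X,Y,V,X,Y,Z,X,V,W,X,Z,Y,X,V,X,Y,X,Z,X,Y,X,W,X,V,W,X],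
   [X,Y,V,X,Y,Z,X,V,W,X,Z,Y,X,Z,X,W,V,X,W,X,Y,X,Z,Y,X,Y],
   [X,Y,V,X,Y,Z,X,V,W,X,Z,Y,X,Z,X,W,V,X,W,X,Y,X,Z,X,Y,X],
   [X,Y,V,X,Y,Z,X,V,W,X,Z,Y,X,Z,X,W,V,X,W,X,Y,Z,Y,X,Y,Z],
   [X,Y,V,X,Y,Z,X,V,W,X,Z,Y,X,Z,X,W,V,X,W,Y,X,Z,X,Y,X,Z],
   [Y,X,V,Y,X,Z,X,V,W,X,Z,X,Y,Z,X,V,Y,X,Z,X,Y,X,Z,W,X,V],
   [Y,X,V,Y,X,Z,X,Y,X,V,W,X,Z,Y,X,Z,V,Y,X,Z,X,Y,X,Z,V,W],
   [Y,X,V,Z,X,V,W,X,Z,Y,X,Z,X,W,V,X,Z,W,Y,X,Z,X,Y,X,Z,W],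
   [Y,X,V,Y,X,Z,X,V,W,X,Z,X,Y,Z,X,W,V,W,Y,X,Z,X,Y,X,Z,W],
   [Y,X,V,Y,X,W,Y,X,Y,Z,X,Y,X,W,X,V,W,X,Z,Y,X,Z,X,W,V,X],
   [Y,X,V,Y,X,Z,X,V,W,X,Z,V,Y,X,Y,Z,X,Y,X,W,X,V,W,X,Z,Y],
   [Y,X,V,Y,X,Z,X,V,W,X,Z,X,Y,V,X,Y,X,Z,X,Y,X,W,X,V,W,X],
   [Y,X,V,Y,X,Z,X,V,W,Y,Z,Y,X,V,X,Y,X,Z,Y,X,Y,W,X,V,W,Y],
   [Y,X,V,Y,X,Z,X,V,W,X,Z,X,Y,Z,X,W,V,X,W,X,Y,X,Z,X,Y,X],
   [Y,X,V,Y,X,Z,X,V,W,X,Z,X,Y,Z,X,W,V,X,W,X,Y,X,Z,Y,X,Y],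
   [Y,X,V,Y,X,Z,X,V,W,X,Z,X,Y,Z,X,W,V,X,W,Y,X,Z,X,Y,X,Z],
   [Y,X,V,Y,X,Z,X,V,W,X,Z,X,Y,Z,X,W,V,X,W,X,Y,Z,Y,X,Y,Z],
   [Z,X,V,Y,X,V,W,X,Y,Z,X,Y,X,V,Z,X,Y,X,Z,X,Y,W,Y,X,Y,V],
   [Z,X,V,Z,X,Y,X,V,W,X,Y,X,Z,Y,X,W,V,W,Y,X,Z,X,Y,X,Z,W],
   [Z,X,V,Y,X,V,W,X,Y,Z,X,Y,X,W,V,X,Y,W,Y,X,Z,X,Y,X,Z,W],
   [Z,X,V,Y,X,V,W,X,Y,Z,X,Y,X,W,V,Y,X,W,X,Y,Z,Y,X,Y,Z,W],
   [Z,X,V,Y,X,V,W,Z,Y,X,Z,V,X,Y,X,Z,X,Y,X,W,X,Y,X,V,W,Z],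
   [Z,X,V,Y,X,V,W,X,Y,V,X,Y,X,Z,X,V,X,W,V,X,Y,X,W,X,V,X],
   [Z,X,V,Y,X,V,W,X,Y,Z,X,V,Z,X,Y,X,Z,W,Y,X,W,Y,W,V,W,X],
   [Z,X,V,Y,X,V,W,X,Y,Z,X,Y,X,W,V,X,Y,X,W,X,Y,X,Z,X,Y,X],
   [Z,X,V,Y,X,V,W,X,Y,Z,X,Y,X,W,V,X,Y,X,W,X,Y,X,Z,Y,X,Y],
   [Z,X,V,Y,X,V,W,X,Y,Z,X,Y,X,W,V,X,Y,X,W,Y,X,Z,X,Y,X,Z],
   [Z,X,V,Y,X,V,W,X,Y,Z,X,Y,X,W,V,X,Y,X,W,X,Y,Z,Y,X,Y,Z],
   [V,X,Y,X,Z,V,X,Z,W,X,Z,Y,Z,X,Z,W,V,W,Y,X,Z,X,Y,X,Z,W],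
   [V,X,Y,V,Z,X,V,Y,X,V,W,X,Y,Z,X,Y,X,V,X,Y,Z,Y,X,Y,Z,W],
   [V,Y,X,V,Z,X,V,Y,X,V,W,X,Y,Z,X,Y,X,V,Y,X,Z,X,Y,X,Z,W],
   [V,X,Y,X,Z,Y,X,V,W,Z,X,Y,X,W,Z,X,W,V,X,Y,Z,Y,X,Y,Z,V],
   [V,X,Y,X,Z,Y,X,V,W,X,Y,W,X,Z,W,Y,X,V,X,Y,Z,Y,X,Y,Z,V],
   [V,X,Y,X,Z,Y,X,V,W,X,Y,W,X,Z,W,X,Y,V,Y,X,Z,X,Y,X,Z,V],
   [V,X,Y,X,Z,Y,X,V,W,X,Y,W,X,Z,W,X,Y,X,V,X,Y,X,Z,Y,X,Y],
   [V,X,Y,X,Z,Y,X,V,W,X,Y,W,X,Z,W,X,Y,X,V,X,Y,X,Z,X,Y,X],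
   [V,X,Y,X,Z,Y,X,V,W,X,Y,W,X,Z,W,X,Y,X,V,X,Y,Z,Y,X,Y,Z],
   [V,X,Y,X,Z,Y,X,V,W,X,Y,W,X,Z,W,X,Y,X,V,Y,X,Z,X,Y,X,Z],
   [X,V,Y,X,V,W,X,Y,X,Z,X,W,X,V,W,X,Z,X,Y,Z,X,W,V,W,X,W],
   [X,V,Y,X,V,Z,X,V,W,X,Z,Y,X,Z,X,W,V,W,Y,X,Z,X,Y,X,Z,W],
   [X,V,Y,X,V,Z,X,V,W,X,Z,V,X,Z,X,Y,Z,X,Z,W,X,V,W,X,Z,X],
   [X,V,Y,X,V,Z,X,V,W,Y,Z,X,Y,V,X,Y,X,Z,Y,X,Y,W,X,V,W,Y],
   [X,V,Y,X,V,Z,X,V,W,X,Z,Y,X,V,X,Y,X,Z,X,Y,X,W,X,V,W,X],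
   [X,V,Y,X,V,Z,X,V,W,X,Z,Y,X,Z,X,W,V,X,W,X,Y,X,Z,Y,X,Y],
   [X,V,Y,X,V,Z,X,V,W,X,Z,Y,X,Z,X,W,V,X,W,X,Y,X,Z,X,Y,X],
   [X,V,Y,X,V,Z,X,V,W,X,Z,Y,X,Z,X,W,V,X,W,X,Y,Z,Y,X,Y,Z],
   [X,V,Y,X,V,Z,X,V,W,X,Z,Y,X,Z,X,W,V,X,W,Y,X,Z,X,Y,X,Z],
   [X,V,Z,X,V,Y,X,V,W,X,Y,Z,X,Y,X,W,V,W,Y,X,Z,X,Y,X,Z,W],
   [X,V,Z,X,V,Y,X,V,W,Z,Y,X,Z,V,X,Y,X,Z,Y,X,Y,W,X,V,W,Z],
   [X,V,Z,X,V,Y,X,V,W,X,Y,V,X,Y,X,Z,Y,X,Y,W,X,V,W,X,Y,X],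
   [X,V,Z,X,V,Y,X,V,W,X,Y,Z,X,V,X,Z,X,Y,X,Z,X,W,X,V,W,X],
   [X,V,Z,X,V,Y,X,V,W,X,Y,Z,X,Y,X,W,V,X,W,X,Y,X,Z,Y,X,Y],
   [X,V,Z,X,V,Y,X,V,W,X,Y,Z,X,Y,X,W,V,X,W,X,Y,X,Z,X,Y,X],
   [X,V,Z,X,V,Y,X,V,W,X,Y,Z,X,Y,X,W,V,X,W,X,Y,Z,Y,X,Y,Z],
   [X,V,Z,X,V,Y,X,V,W,X,Y,Z,X,Y,X,W,V,X,W,Y,X,Z,X,Y,X,Z],
   [Y,V,Z,X,V,Z,Y,V,W,X,Y,X,Z,V,X,Z,X,Y,X,Z,X,W,X,V,W,X],
   [Y,V,Z,X,V,Z,Y,V,W,X,Y,V,Y,X,Y,Z,X,Y,X,W,X,V,W,X,Y,Z],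
   [Y,V,Z,X,V,Z,Y,V,W,Y,X,V,X,Y,X,Z,Y,X,V,Y,V,W,X,V,W,Z],
   [Y,V,Z,X,V,Z,Y,V,W,X,Y,X,Z,Y,X,W,V,X,W,X,Y,Z,Y,X,Y,Z],
   [Y,V,Z,X,V,Z,Y,V,W,X,Y,X,Z,Y,X,W,V,X,W,Y,X,Z,X,Y,X,Z],
   [Y,V,Z,X,V,Z,Y,V,W,X,Y,X,Z,Y,X,W,V,X,W,X,Y,X,Z,Y,X,Y],
   [Y,V,Z,X,V,Z,Y,V,W,X,Y,X,Z,Y,X,W,V,X,W,X,Y,X,Z,X,Y,X],
   [X,W,Y,X,W,V,X,Y,X,Z,X,V,X,W,V,X,Z,X,Y,Z,X,V,W,V,X,V],
   [X,W,Y,X,W,Z,X,W,V,X,Z,Y,X,Z,X,V,W,V,Y,X,Z,X,Y,X,Z,V],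
   [X,W,Y,X,W,Z,X,W,V,X,Z,Y,X,Z,X,V,W,X,V,X,Y,X,Z,Y,X,Y],
   [X,W,Y,X,W,Z,X,W,V,X,Z,Y,X,Z,X,V,W,X,V,X,Y,X,Z,X,Y,X],
   [X,W,Y,X,W,Z,X,W,V,X,Z,Y,X,Z,X,V,W,X,V,X,Y,Z,Y,X,Y,Z],
   [X,W,Y,X,W,Z,X,W,V,X,Z,Y,X,Z,X,V,W,X,V,Y,X,Z,X,Y,X,Z],
   [X,W,Z,X,W,Y,X,W,V,X,Y,Z,X,Y,X,V,W,V,Y,X,Z,X,Y,X,Z,V],
   [X,W,Z,X,W,Y,X,W,V,X,Y,Z,X,Y,X,V,W,X,V,X,Y,X,Z,Y,X,Y],
   [X,W,Z,X,W,Y,X,W,V,X,Y,Z,X,Y,X,V,W,X,V,X,Y,X,Z,X,Y,X],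
   [X,W,Z,X,W,Y,X,W,V,X,Y,Z,X,Y,X,V,W,X,V,X,Y,Z,Y,X,Y,Z],
   [X,W,Z,X,W,Y,X,W,V,X,Y,Z,X,Y,X,V,W,X,V,Y,X,Z,X,Y,X,Z],
   [Y,W,Z,X,V,Y,X,V,W,X,Y,Z,Y,W,V,X,Y,X,W,X,Y,X,Z,X,Y,X],
   [Y,W,Z,X,V,Y,X,V,W,X,Y,Z,Y,W,V,X,Y,X,W,X,Y,X,Z,Y,X,Y],
   [Y,W,Z,X,V,Y,X,V,W,X,Y,Z,Y,W,V,X,Y,X,W,Y,X,Z,X,Y,X,Z],
   [Y,W,Z,X,V,Y,X,V,W,X,Y,Z,Y,W,V,X,Y,X,W,X,Y,Z,Y,X,Y,Z],
   [X,Z,X,V,X,W,Z,X,W,Y,X,W,V,X,Y,Z,X,Y,X,V,W,X,V,X,Z,X],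
   [X,Y,X,V,X,W,Y,X,W,Z,X,W,V,X,Z,Y,X,Z,X,V,W,X,V,X,Y,X],
   [X,Y,X,V,X,W,Y,X,W,Z,X,W,V,W,X,W,Z,Y,X,Z,X,V,W,X,V,X],
   [Y,X,Y,V,X,W,Y,X,W,Z,X,W,V,X,Z,Y,X,Z,X,V,W,X,V,X,Y,X],
   [Y,X,Y,V,X,W,Y,X,W,Z,X,W,V,W,X,W,Z,Y,X,Z,X,V,W,X,V,X],
   [Z,X,Z,V,X,W,Z,X,W,Y,X,W,V,W,X,W,Y,Z,X,Y,X,V,W,X,V,X]],
  [[V,Z,Y,V,W,X,Z,Y,X,Z,X,W,Z,V,Z,Y,W,X,Y,X,Z,X,Y,X,W,V],
   [V,Z,Y,V,W,X,Z,W,Y,V,Y,Z,Y,W,Y,X,Y,V,Z,V,Y,X,Y,V,Z,W],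
   [V,Z,Y,X,Y,V,Z,Y,V,Y,W,X,Y,X,V,Y,X,Z,X,Y,V,Y,X,Y,V,W],
   [V,Z,Y,V,W,X,Z,W,Y,Z,V,Y,Z,W,X,Z,X,Y,X,Z,V,Z,X,Z,V,W],
   [V,X,Y,V,Y,Z,V,Y,X,V,W,X,Z,Y,X,Z,X,V,Y,X,Z,X,Y,X,Z,W],
   [V,Z,Y,V,W,X,Z,W,Y,Z,V,Z,Y,W,X,Z,Y,Z,X,V,X,Z,X,V,Y,W],
   [V,Z,Y,V,W,X,Z,W,Y,Z,V,Y,Z,Y,W,Y,X,Y,V,Z,V,Y,X,Y,V,Z],
   [V,Z,Y,V,W,X,Z,W,Y,Z,V,Y,Z,Y,W,Y,X,Y,V,X,Z,V,Y,X,Y,V],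
   [V,Z,Y,V,W,Y,Z,V,Y,Z,Y,X,Y,W,Y,V,W,Z,V,Y,W,Y,V,Y,W,Z],
   [V,Z,Y,V,W,X,Z,W,Y,Z,V,Y,Z,Y,W,Y,X,Z,X,Y,X,V,X,Z,X,V],
   [V,Z,Y,V,W,X,Z,W,Y,Z,V,Y,Z,Y,W,V,X,Z,X,V,X,Z,Y,Z,X,Z],
   [V,Z,Y,V,W,X,Z,W,Y,Z,V,Y,Z,Y,W,Y,X,Y,V,X,Z,X,V,Y,X,Y],
   [V,Z,Y,V,W,X,Z,W,Y,Z,V,Y,Z,Y,W,Y,X,Y,V,X,Z,X,V,X,Y,X],
   [V,Z,X,V,W,X,Z,V,X,Z,X,Y,X,V,X,Z,X,V,X,W,Z,X,Z,V,X,Z],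
   [V,Z,X,Y,X,V,Z,X,V,X,W,X,Y,X,V,Y,X,Z,X,Y,V,Y,X,Y,V,W],
   [V,Z,X,V,W,X,Z,V,X,Z,X,Y,X,V,X,W,V,X,Z,V,X,W,X,V,X,W],
   [V,Z,X,V,W,X,Z,V,X,Z,X,Y,X,V,X,W,V,Z,V,X,W,X,V,X,W,Z],
   [V,Y,X,V,X,Z,V,X,Y,V,W,X,Z,Y,X,Z,X,V,X,Y,Z,Y,X,Y,Z,W],
   [V,Z,X,V,W,X,Z,V,X,Z,X,Y,X,V,X,W,V,X,Z,X,V,X,W,V,X,V],
   [V,Z,X,V,W,X,Z,V,X,Z,X,Y,X,W,X,V,W,Z,V,X,W,X,V,X,W,Z],
   [V,Z,X,V,W,Y,Z,W,X,Z,V,X,Z,X,W,X,Y,X,V,Y,Z,V,X,Y,X,V],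
   [V,Z,X,V,W,X,Z,V,X,Z,X,Y,X,V,X,W,V,X,Z,X,V,X,W,X,V,X],
   [V,Z,X,V,W,X,Z,Y,X,Z,X,W,Z,X,V,X,Z,X,W,X,Y,X,Z,Y,X,Y],
   [V,Z,X,V,W,X,Z,V,X,Y,X,V,X,Z,X,W,Z,X,V,X,Z,X,W,Y,X,Y],
   [V,Z,X,V,W,X,Z,V,X,Y,X,V,X,Z,X,W,Z,X,V,X,Z,X,W,X,Y,X],
   [Z,X,V,X,Y,V,W,Y,X,Z,X,Y,X,V,Z,X,Y,X,Z,X,Y,W,Y,X,Y,V],
   [Z,X,V,Z,X,Y,X,V,W,X,Y,X,Z,X,Y,W,V,W,X,Y,Z,Y,X,Y,Z,W],
   [Z,X,V,X,Y,V,W,Y,X,Z,X,Y,X,W,V,X,Y,W,Y,X,Z,X,Y,X,Z,W],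
   [Z,X,V,X,Y,V,W,Y,X,Z,X,Y,X,W,V,Y,X,W,X,Y,Z,Y,X,Y,Z,W],
   [Z,X,V,X,Y,V,W,Z,X,W,V,X,Y,X,W,Y,X,Y,V,X,Z,V,Y,X,Y,V],
   [Z,X,V,X,Y,V,W,Y,X,V,X,Y,X,Z,X,V,X,W,V,X,Y,X,W,X,V,X],
   [Z,X,V,X,Y,V,W,Y,X,Z,X,V,Z,X,Y,X,Z,W,Y,X,W,Y,W,V,W,X],
   [Z,X,V,X,Y,V,W,Y,X,Z,X,Y,X,W,V,X,Y,X,W,X,Y,X,Z,X,Y,X],
   [Z,X,V,X,Y,V,W,Y,X,Z,X,Y,X,W,V,X,Y,X,W,X,Y,X,Z,Y,X,Y],
   [Z,X,V,X,Y,V,W,Y,X,Z,X,Y,X,W,V,X,Y,X,W,Y,X,Z,X,Y,X,Z],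
   [Z,X,V,X,Y,V,W,Y,X,Z,X,Y,X,W,V,X,Y,X,W,X,Y,Z,Y,X,Y,Z],
   [V,X,Z,V,W,Z,X,Y,X,W,Z,X,W,X,V,Y,X,Y,W,Z,W,Y,X,Y,W,Z],
   [V,X,Z,V,W,Z,X,Y,X,W,Z,X,W,X,V,Y,X,Y,W,X,Z,W,Y,X,Y,W],
   [V,Y,Z,V,W,Z,Y,X,Y,W,Z,Y,W,Y,V,X,Y,X,W,Y,Z,W,X,Y,X,W],
   [V,X,Z,V,W,Z,X,Y,X,W,Z,X,W,V,Y,X,Z,X,Y,X,W,X,Z,X,W,V],
   [V,X,Z,V,W,Z,X,V,X,Z,X,Y,X,Z,X,W,X,Z,X,V,X,Z,W,Z,X,Z],
   [V,X,Z,V,W,V,X,Z,X,Y,X,W,X,V,Z,X,V,X,W,X,V,X,Z,X,Y,X],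
   [V,X,Z,V,W,Z,X,Y,X,W,Z,X,W,X,V,Y,X,Z,X,Y,X,W,X,Z,X,W],
   [V,X,Z,V,W,Z,X,Y,X,W,Z,X,W,X,V,W,X,Z,X,W,X,Z,Y,Z,X,Z],
   [V,X,Z,V,W,Z,X,Y,X,W,Z,X,W,X,V,Y,X,Y,W,X,Z,X,W,Y,X,Y],
   [V,X,Z,V,W,Z,X,Y,X,W,Z,X,W,X,V,Y,X,Y,W,X,Z,X,W,X,Y,X],
   [X,V,X,Y,V,Z,X,V,W,X,Z,Y,X,Z,X,W,V,W,Y,X,Z,X,Y,X,Z,W],
   [X,V,X,Y,V,W,X,Y,X,Z,X,W,X,V,W,X,Z,X,Y,Z,X,W,V,W,X,W],
   [X,V,X,Y,V,Z,X,V,W,X,Z,V,X,Z,X,Y,Z,X,Z,W,X,V,W,X,Z,X],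
   [X,V,X,Y,V,Z,X,V,W,X,Z,Y,X,V,X,Y,X,Z,X,Y,X,W,X,V,W,X],
   [X,V,X,Y,V,Z,X,V,W,Y,Z,X,Y,V,X,Y,X,Z,Y,X,Y,W,X,V,W,Y],
   [X,V,X,Y,V,Z,X,V,W,X,Z,Y,X,Z,X,W,V,X,W,X,Y,X,Z,X,Y,X],
   [X,V,X,Y,V,Z,X,V,W,X,Z,Y,X,Z,X,W,V,X,W,X,Y,X,Z,Y,X,Y],
   [X,V,X,Y,V,Z,X,V,W,X,Z,Y,X,Z,X,W,V,X,W,Y,X,Z,X,Y,X,Z],
   [X,V,X,Y,V,Z,X,V,W,X,Z,Y,X,Z,X,W,V,X,W,X,Y,Z,Y,X,Y,Z],
   [Y,V,W,X,Z,W,V,W,X,Z,X,Y,X,V,X,W,Z,X,V,W,V,X,V,W,Z,Y],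
   [Y,V,W,X,Z,W,V,Z,Y,V,Z,X,V,X,W,Y,X,Y,V,Z,V,Y,X,Y,V,Z],
   [Y,V,W,X,Z,W,V,Z,Y,V,Z,X,V,X,W,Y,X,Y,V,X,Z,V,Y,X,Y,V],
   [Y,V,W,Y,Z,W,V,W,Y,Z,Y,X,Y,W,Y,V,W,Z,V,Y,W,Y,V,Y,W,Z],
   [Y,V,W,X,Z,W,V,Z,Y,V,Z,X,V,X,W,Y,X,Z,X,Y,X,V,X,Z,X,V],
   [Y,V,W,X,Z,W,V,Z,Y,V,Z,X,V,X,W,V,X,Z,X,V,X,Z,Y,Z,X,Z],
   [Y,V,W,X,Z,W,V,Z,Y,V,Z,X,V,X,W,Y,X,Y,V,X,Z,X,V,Y,X,Y],
   [Y,V,W,X,Z,W,V,Z,Y,V,Z,X,V,X,W,Y,X,Y,V,X,Z,X,V,X,Y,X],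
   [X,V,W,X,Z,W,V,W,X,Z,X,Y,X,V,X,W,V,X,Z,X,V,X,W,V,X,V],
   [X,V,W,X,Z,W,V,W,X,Z,X,Y,X,W,X,V,W,Z,V,X,W,X,V,X,W,Z],
   [X,V,W,Y,Z,W,V,Z,X,V,Z,Y,V,Y,W,X,Y,X,V,Y,Z,V,X,Y,X,V],
   [X,V,W,X,Z,W,V,W,X,Z,X,Y,X,V,X,W,V,X,Z,X,V,X,W,X,V,X],
   [X,V,W,X,Z,W,V,Y,X,Z,X,V,Z,X,W,X,Z,X,V,X,Y,X,Z,Y,X,Y],
   [X,V,W,X,Z,W,V,W,X,Y,X,V,X,Z,X,W,Z,X,V,X,Z,X,W,Y,X,Y],
   [X,V,W,X,Z,W,V,W,X,Y,X,V,X,Z,X,W,Z,X,V,X,Z,X,W,X,Y,X],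
   [X,W,X,Y,W,Z,X,W,V,X,Z,Y,X,Z,X,V,W,V,Y,X,Z,X,Y,X,Z,V],
   [X,W,X,Y,W,V,X,Y,X,Z,X,V,X,W,V,X,Z,X,Y,Z,X,V,W,V,X,V],
   [X,W,X,Y,W,Z,X,W,V,X,Z,Y,X,Z,X,V,W,X,V,X,Y,X,Z,X,Y,X],
   [X,W,X,Y,W,Z,X,W,V,X,Z,Y,X,Z,X,V,W,X,V,X,Y,X,Z,Y,X,Y],
   [X,W,X,Y,W,Z,X,W,V,X,Z,Y,X,Z,X,V,W,X,V,Y,X,Z,X,Y,X,Z],
   [X,W,X,Y,W,Z,X,W,V,X,Z,Y,X,Z,X,V,W,X,V,X,Y,Z,Y,X,Y,Z],
   [Y,W,V,X,Z,V,W,V,X,Z,X,Y,X,W,X,V,Z,X,V,X,W,X,V,X,Z,Y],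
   [Y,W,V,X,Z,V,W,Z,Y,W,Z,X,W,X,V,Y,X,Z,X,Y,X,W,X,Z,X,W],
   [Y,W,V,X,Z,V,W,Z,Y,W,Z,X,W,X,V,W,X,Z,X,W,X,Z,Y,Z,X,Z],
   [Y,W,V,X,Z,V,W,Z,Y,W,Z,X,W,X,V,Y,X,Y,W,X,Z,X,W,Y,X,Y],
   [Y,W,V,X,Z,V,W,Z,Y,W,Z,X,W,X,V,Y,X,Y,W,X,Z,X,W,X,Y,X],
   [X,W,V,X,Z,V,W,V,X,Z,X,Y,X,V,X,W,V,X,Z,X,V,X,W,X,V,X],
   [X,W,V,X,Z,V,W,Y,X,Z,X,W,Z,X,V,X,Z,X,W,X,Y,X,Z,Y,X,Y],
   [X,W,V,X,Z,V,W,V,X,Y,X,V,X,Z,X,W,Z,X,V,X,Z,X,W,Y,X,Y],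
   [X,W,V,X,Z,V,W,V,X,Y,X,V,X,Z,X,W,Z,X,V,X,Z,X,W,X,Y,X],
   [Y,Z,Y,V,Y,W,V,Y,Z,V,W,X,Y,Z,Y,W,Z,Y,V,Y,Z,Y,W,Y,Z,Y],
   [Y,X,Y,V,X,W,V,X,Y,Z,X,V,W,Y,X,Y,Z,W,Y,Z,V,X,W,Y,X,Y],
   [Y,X,Y,Z,X,V,Z,W,V,Z,X,Z,Y,V,Y,Z,W,Z,Y,Z,X,W,V,X,W,X],
   [X,Y,X,V,X,W,V,X,Y,Z,X,V,W,Y,X,Y,Z,W,Y,Z,V,X,W,Y,X,Y],
   [X,Y,X,Z,X,V,Z,W,V,Z,X,Z,Y,V,Y,Z,W,Z,Y,Z,X,W,V,X,W,X],
   [X,V,X,W,V,X,Y,V,W,X,Z,W,Y,X,V,X,Y,Z,W,Z,Y,V,X,V,Y,Z]]]"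

lemma routes4_ok: "list_all2 (routes_ok 4) faults4 routes4"
  by code_simp

lemma routes5_ok: "list_all2 (routes_ok 5) faults5 routes5"
  by code_simp

section \<open>Soundness of the listed paths\<close>

lemma move_cases: "move d v = v \<or> (\<exists>i<length v. move d v = flip i v)"
proof (cases "(d, v)" rule: move.cases)
  case (1 a v)
  then show ?thesis by (intro disjI2 exI[of _ 0]) (simp add: flip_def)
next
  case (2 a b v)
  then show ?thesis by (intro disjI2 exI[of _ 1]) (simp add: flip_def)
next
  case (3 a b c v)
  then show ?thesis by (intro disjI2 exI[of _ 2]) (simp add: flip_def numeral_2_eq_2)
next
  case (4 a b c d v)
  then show ?thesis by (intro disjI2 exI[of _ 3]) (simp add: flip_def numeral_3_eq_3)
next
  case (5 a b c d e v)
  then show ?thesis by (intro disjI2 exI[of _ 4]) (simp add: flip_def eval_nat_numeral)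
qed auto

lemma length_move [simp]: "length (move d v) = length v"
  using move_cases[of d v] by auto

lemma hd_walk [simp]: "hd (walk v ds) = v"
  by (cases ds) auto

lemma walk_ne [simp]: "walk v ds \<noteq> []"
  by (cases ds) auto

lemma length_walk [simp]: "length (walk v ds) = length ds + 1"
  by (induction ds arbitrary: v) auto

lemma set_walk: "w \<in> set (walk v ds) \<Longrightarrow> length w = length v"
  by (induction ds arbitrary: v) auto

lemma walk_adj: "distinct (walk v ds) \<Longrightarrow> successively adj (walk v ds)"
proof (induction ds arbitrary: v)
  case (Cons d ds)
  have "move d v \<in> set (walk (move d v) ds)" by (metis hd_in_set hd_walk walk_ne)
  then have "move d v \<noteq> v" using Cons(2) by auto
  then have "adj v (move d v)" using move_cases[of d v] adj_flip by metis
  then show ?case using Cons by (simp add: successively_Cons)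
qed simp

lemma is_route_linked:
  assumes r: "is_route n F (s, t) ds" and F: "set F \<subseteq> hypercube n" and s: "s \<in> hypercube n"
  shows "linked (hypercube n - set F) s t"
proof -
  let ?p = "walk s ds"
  have *: "last ?p = t" "length (F @ ?p) = 2 ^ n" "distinct (F @ ?p)"
    using r by (auto simp: is_route_def Let_def)
  have sub: "set ?p \<subseteq> hypercube n" using set_walk s by (auto simp: hypercube_def)
  have "set (F @ ?p) = hypercube n"
  proof (rule card_subset_eq[OF finite_hypercube])
    show "card (set (F @ ?p)) = card (hypercube n)"
      using distinct_card[OF *(3)] *(2) card_hypercube by simp
  qed (use F sub in simp)
  then have "set ?p = hypercube n - set F" using *(3) by auto
  then have "hamiltonian_path (hypercube n - set F) ?p"
    using *(3) walk_adj by (auto simp: hamiltonian_path_def is_path_def)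
  then show ?thesis using *(1) unfolding linked_def by auto
qed

lemma in_pairs: "x \<in> set xs \<Longrightarrow> y \<in> set xs \<Longrightarrow> x \<noteq> y \<Longrightarrow> (x, y) \<in> set (pairs xs) \<or> (y, x) \<in> set (pairs xs)"
  by (induction xs) auto

lemma set_cube_list: "set (cube_list n) = hypercube n"
  by (auto simp: cube_list_def set_n_lists hypercube_def)

lemma list_all2_setD: "list_all2 P xs ys \<Longrightarrow> x \<in> set xs \<Longrightarrow> \<exists>y. P x y"
  by (induction rule: list_all2_induct) auto

lemma routes_linked:
  assumes ok: "list_all2 (routes_ok n) Fs dsss" and F: "F \<in> set Fs" "set F \<subseteq> hypercube n"
    and st: "s \<in> hypercube n" "t \<in> hypercube n" "s \<notin> set F" "t \<notin> set F" "sg s = - 1" "sg t = - 1" "s \<noteq> t"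
  shows "linked (hypercube n - set F) s t"
proof -
  obtain dss where dss: "list_all2 (is_route n F) (odd_pairs n F) dss"
    using list_all2_setD[OF ok F(1)] by (auto simp: routes_ok_def)
  have "(s, t) \<in> set (odd_pairs n F) \<or> (t, s) \<in> set (odd_pairs n F)"
    unfolding odd_pairs_def using st by (intro in_pairs) (auto simp: set_cube_list sg_def split: if_splits)
  then show ?thesis
    using list_all2_setD[OF dss] is_route_linked[OF _ F(2)] st(1,2) linked_rev by blast
qed

section \<open>Translations and coordinate permutations\<close>

definition vxor :: "vertex \<Rightarrow> vertex \<Rightarrow> vertex" where
  "vxor u v = map2 (\<noteq>) u v"

lemma length_vxor [simp]: "length (vxor u v) = min (length u) (length v)"
  by (simp add: vxor_def)

lemma nth_vxor: "i < length u \<Longrightarrow> i < length v \<Longrightarrow> vxor u v ! i \<longleftrightarrow> u ! i \<noteq> v ! i"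
  by (simp add: vxor_def)

lemma sg_vxor: "length u = length v \<Longrightarrow> sg (vxor u v) = sg u * sg v"
proof (induction u v rule: list_induct2)
  case Nil
  then show ?case by (simp add: vxor_def sg_def)
next
  case (Cons x xs y ys)
  then show ?case by (simp add: vxor_def sg_Cons)
qed

lemma cube_map_vxor:
  assumes w: "w \<in> hypercube n"
  shows "cube_map (vxor w) (hypercube n) (hypercube n)"
  unfolding cube_map_def
proof (intro conjI ballI)
  have "vxor w (vxor w v) = v" if "v \<in> hypercube n" for v
    using that w by (intro nth_equalityI) (auto simp: nth_vxor hypercube_def)
  moreover have "vxor w v \<in> hypercube n" if "v \<in> hypercube n" for v
    using that w by (simp add: hypercube_def)
  ultimately show "bij_betw (vxor w) (hypercube n) (hypercube n)"
    by (intro bij_betw_byWitness[of _ "vxor w"]) auto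
  show "\<exists>e\<in>{1, - 1}. \<forall>x\<in>hypercube n. sg (vxor w x) = e * sg x"
    using w sg_cases[of w] by (intro bexI[of _ "sg w"]) (auto simp: hypercube_def sg_vxor)
  fix x y assume xy: "x \<in> hypercube n" "y \<in> hypercube n"
  then have "{i. i < n \<and> vxor w x ! i \<noteq> vxor w y ! i} = {i. i < n \<and> x ! i \<noteq> y ! i}"
    using w by (auto simp: nth_vxor hypercube_def)
  then show "adj (vxor w x) (vxor w y) = adj x y"
    using w xy by (simp add: adj_def hypercube_def)
qed

lemma cube_map_permute:
  assumes p: "p permutes {..<n}"
  shows "cube_map (permute_list p) (hypercube n) (hypercube n)"
  unfolding cube_map_def
proof (intro conjI ballI)
  have inv: "inv p permutes {..<n}" using p by (rule permutes_inv)
  have "permute_list (inv p) (permute_list p v) = v" "permute_list p (permute_list (inv p) v) = v"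
    if "v \<in> hypercube n" for v
    using that p inv permute_list_compose[of p v "inv p"] permute_list_compose[of "inv p" v p]
    by (auto simp: hypercube_def permutes_inv_o)
  then show "bij_betw (permute_list p) (hypercube n) (hypercube n)"
    by (intro bij_betw_byWitness[of _ "permute_list (inv p)"]) (auto simp: hypercube_def)
  show "\<exists>e\<in>{1, - 1}. \<forall>x\<in>hypercube n. sg (permute_list p x) = e * sg x"
  proof (intro bexI[of _ 1] ballI)
    fix x :: vertex assume "x \<in> hypercube n"
    then have "mset (permute_list p x) = mset x" using p by (simp add: hypercube_def)
    then have "count_list (permute_list p x) True = count_list x True" by (metis count_mset)
    then show "sg (permute_list p x) = 1 * sg x" by (simp add: sg_def)
  qed simp
  fix x y assume xy: "x \<in> hypercube n" "y \<in> hypercube n"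
  have n: "permute_list p x ! i = x ! p i" "permute_list p y ! i = y ! p i" if "i < n" for i
    using that xy p by (auto simp: hypercube_def permute_list_nth)
  have "{j. j < n \<and> x ! j \<noteq> y ! j} = p ` {i. i < n \<and> permute_list p x ! i \<noteq> permute_list p y ! i}"
  proof (intro equalityI subsetI)
    fix j assume j: "j \<in> {j. j < n \<and> x ! j \<noteq> y ! j}"
    then have "inv p j < n" using inv by (metis lessThan_iff mem_Collect_eq permutes_in_image)
    moreover have "p (inv p j) = j" using p by (simp add: permutes_inverses)
    ultimately show "j \<in> p ` {i. i < n \<and> permute_list p x ! i \<noteq> permute_list p y ! i}"
      using j n by (intro image_eqI[of _ _ "inv p j"]) auto
  next
    fix j assume "j \<in> p ` {i. i < n \<and> permute_list p x ! i \<noteq> permute_list p y ! i}"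
    then obtain i where "i < n" "j = p i" "x ! p i \<noteq> y ! p i" using n by auto
    moreover have "p i < n" using p \<open>i < n\<close> by (metis lessThan_iff permutes_in_image)
    ultimately show "j \<in> {j. j < n \<and> x ! j \<noteq> y ! j}" by simp
  qed
  moreover have "inj_on p S" for S using p permutes_inj_on by blast
  ultimately have "card {j. j < n \<and> x ! j \<noteq> y ! j} = card {i. i < n \<and> permute_list p x ! i \<noteq> permute_list p y ! i}"
    by (simp add: card_image)
  then show "adj (permute_list p x) (permute_list p y) = adj x y"
    using xy by (simp add: adj_def hypercube_def)
qed

lemma permute_list_replicate:
  assumes "p permutes {..<n}" shows "permute_list p (replicate n x) = replicate n x"
proof (rule nth_equalityI)
  fix i assume "i < length (permute_list p (replicate n x))"
  moreover from this have "p i < n" using assms permutes_in_image[of p "{..<n}" i] by simp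
  ultimately show "permute_list p (replicate n x) ! i = replicate n x ! i"
    using assms by (simp add: permute_list_nth)
qed simp

lemma hypercube_4_cases:
  assumes "v \<in> hypercube 4" obtains a b c d where "v = [a, b, c, d]"
  using assms by (auto simp: hypercube_def eval_nat_numeral length_Suc_conv)

lemma hypercube_5_cases:
  assumes "v \<in> hypercube 5" obtains a b c d e where "v = [a, b, c, d, e]"
  using assms by (auto simp: hypercube_def eval_nat_numeral length_Suc_conv)

lemma cube_map_transport:
  assumes f: "cube_map f (hypercube n) (hypercube n)" and F: "set F \<subseteq> hypercube n"
    and st: "s \<in> hypercube n" "t \<in> hypercube n"
    and l: "linked (hypercube n - set (map f F)) (f s) (f t)"
  shows "linked (hypercube n - set F) s t"
  using cube_map_linked[OF f F st] l by simp

lemma cube_map_facts: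
  assumes f: "cube_map f (hypercube n) (hypercube n)"
  shows "x \<in> hypercube n \<Longrightarrow> f x \<in> hypercube n"
    and "x \<in> hypercube n \<Longrightarrow> y \<in> hypercube n \<Longrightarrow> f x = f y \<longleftrightarrow> x = y"
  using f by (auto simp: cube_map_def bij_betw_def inj_on_def)

section \<open>Faults of mass 3 in dimension 4\<close>

lemma linked_4_permuted:
  assumes r: "r \<in> {[True,True,False,False], [True,True,True,True]}"
    and sub: "{g, s, t} \<subseteq> hypercube 4" and sg: "sg g = - 1" "sg s = - 1" "sg t = - 1" "distinct [g, s, t]"
  shows "linked (hypercube 4 - set [[False,False,False,False], r, g]) s t"
proof (rule routes_linked[OF routes4_ok])
  show "[[False,False,False,False], r, g] \<in> set faults4"
    using r sub sg(1) by (auto simp: faults4_def set_cube_list sg_def split: if_splits)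
  have sr: "sg r = 1" "sg [False,False,False,False] = 1" using r by (auto simp: sg_def)
  show "s \<notin> set [[False,False,False,False], r, g]" "t \<notin> set [[False,False,False,False], r, g]"
    using sg sr by auto
qed (use r sub sg in \<open>auto simp: hypercube_def\<close>)

text \<open>A nonzero even vertex has weight two or four. Equality of multisets is the form from
  which a coordinate permutation can be extracted.\<close>

lemma even_4_mset:
  assumes "r \<in> hypercube 4" "sg r = 1" "r \<noteq> [False,False,False,False]"
  shows "\<exists>c\<in>{[True,True,False,False], [True,True,True,True]}. mset c = mset r"
proof -
  obtain x y z w where r: "r = [x, y, z, w]" using hypercube_4_cases[OF assms(1)] .
  show ?thesis using assms(2,3) unfolding r
    by (cases x; cases y; cases z; cases w) (simp_all add: sg_def multiset_eq_iff all_bool_eq)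
qed

lemma linkable_4: "linkable (hypercube 4) 3"
proof (rule linkable_if_exactly)
  show "linkable_exactly (hypercube 4) 3"
  proof (rule linkable_exactly_hypercubeI)
    fix F s t
    assume *: "set F \<subseteq> hypercube 4" "distinct F" "length F = 3" "s \<in> hypercube 4 - set F"
      "t \<in> hypercube 4 - set F" "s \<noteq> t" "sg t = - 1" "2 * sum_list (map sg F) + sg s + sg t = 0"
    let ?R = "filter (\<lambda>v. sg v = 1) F" and ?G = "filter (\<lambda>v. sg v = - 1) F"
    have "length ?R = 2" "length ?G = 1" and s: "sg s = - 1"
    proof -
      have "length ?R + length ?G = 3" "2 * (int (length ?R) - int (length ?G)) + sg s - 1 = 0"
        using *(3,7,8) sum_list_sg[of 1 F] length_filter_sg[of 1 F] by simp_all
      then show "length ?R = 2" "length ?G = 1" "sg s = - 1" using sg_cases[of s] by presburger+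
    qed
    then obtain r1 r2 g where R: "?R = [r1, r2]" and G: "?G = [g]"
      by (auto simp: eval_nat_numeral length_Suc_conv)
    have rs: "set [r1, r2] = {v \<in> set F. sg v = 1}" and gs: "set [g] = {v \<in> set F. sg v = - 1}"
      unfolding R[symmetric] G[symmetric] by auto
    have F: "set F = set [r1, r2, g]" using rs gs sg_cases by auto
    have "distinct [r1, r2]" unfolding R[symmetric] using *(2) by simp
    then have d: "r1 \<noteq> r2" by simp
    have mem: "r1 \<in> hypercube 4" "r2 \<in> hypercube 4" "g \<in> hypercube 4" "s \<in> hypercube 4" "t \<in> hypercube 4"
      using *(1,4,5) F by auto
    have sgn: "sg r1 = 1" "sg r2 = 1" "sg g = - 1" using rs gs by auto
    have gst: "distinct [g, s, t]" using *(4,5,6) F by auto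
    \<comment> \<open>Translation by \<open>r1\<close> moves \<open>r1\<close> to zero and, as
      \<open>r1\<close> has sign \<open>1\<close>, preserves every sign.\<close>
    let ?f = "vxor r1"
    note f = cube_map_vxor[OF mem(1)]
    have sgf: "sg (?f v) = sg v" if "v \<in> hypercube 4" for v
      using that mem(1) sgn(1) by (simp add: sg_vxor hypercube_def)
    obtain q where q: "q permutes {..<4}"
        "permute_list q (?f r2) \<in> {[True,True,False,False], [True,True,True,True]}"
    proof -
      have "?f r2 \<in> hypercube 4" "sg (?f r2) = 1" "?f r2 \<noteq> ?f r1"
        using cube_map_facts[OF f] mem sgf sgn d by auto
      moreover have "?f r1 = [False,False,False,False]"
        using mem(1) by (elim hypercube_4_cases) (simp add: vxor_def)
      ultimately obtain c where c: "c \<in> {[True,True,False,False], [True,True,True,True]}" "mset c = mset (?f r2)"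
        using even_4_mset by metis
      obtain q where "q permutes {..<length (?f r2)}" "permute_list q (?f r2) = c"
        using mset_eq_permutation[OF c(2)] .
      moreover have "length (?f r2) = 4" using mem by (simp add: hypercube_def)
      ultimately show ?thesis using that c(1) by metis
    qed
    let ?q = "permute_list q"
    note fq = cube_map_permute[OF q(1)]
    have sgq: "sg (?q v) = sg v" if "v \<in> hypercube 4" for v
      using that q(1) by (simp add: sg_def hypercube_def flip: count_mset)
    \<comment> \<open>Coordinate permutations fix zero, so normalising the second even vertex does
      not disturb the first.\<close>
    have "?q (?f r1) = [False,False,False,False]"
    proof -
      have "?f r1 = replicate 4 False" using mem(1) by (elim hypercube_4_cases) (simp add: vxor_def eval_nat_numeral)
      then have "?q (?f r1) = replicate 4 False" using permute_list_replicate[OF q(1)] by simp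
      then show ?thesis by (simp add: eval_nat_numeral)
    qed
    then have A: "linked (hypercube 4 - set [?q (?f r1), ?q (?f r2), ?q (?f g)]) (?q (?f s)) (?q (?f t))"
      using linked_4_permuted[OF q(2), of "?q (?f g)" "?q (?f s)" "?q (?f t)"]
        cube_map_facts[OF f] cube_map_facts[OF fq] mem sgf sgq sgn s *(7) gst by simp
    have B: "linked (hypercube 4 - set [?f r1, ?f r2, ?f g]) (?f s) (?f t)"
      by (rule cube_map_transport[OF fq, of "[?f r1, ?f r2, ?f g]"]) (use A cube_map_facts(1)[OF f] mem in simp_all)
    show "linked (hypercube 4 - set F) s t"
      unfolding F by (rule cube_map_transport[OF f, of "[r1, r2, g]"]) (use B mem in simp_all)
  qed simp
qed (simp add: card_neighbours_hypercube)

section \<open>The residual faults in dimension 5\<close>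

definition reds5 :: "vertex list" where
  "reds5 = [[True,True,False,False,False], [True,False,True,False,False], [False,True,True,False,False]]"

text \<open>
  The faults in dimension 5 that no coordinate splits into two reds and a green against a red and a
  green: up to symmetry the reds are \<open>reds5\<close>, and the greens differ in the last two coordinates only.
\<close>

definition residual :: "vertex \<Rightarrow> vertex \<Rightarrow> bool" where
  "residual g1 g2 \<longleftrightarrow> (\<forall>s t. s \<in> hypercube 5 \<and> t \<in> hypercube 5 \<and> sg s = - 1 \<and> sg t = - 1 \<and>
     distinct [g1, g2, s, t] \<longrightarrow> linked (hypercube 5 - set (reds5 @ [g1, g2])) s t)"

lemma residual_routes:
  assumes "(w, a) \<in> {([True,False,False],False), ([True,True,True],False), ([False,False,False],True), ([True,True,False],True)}"
  shows "residual (w @ [a, False]) (w @ [\<not> a, True])"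
  unfolding residual_def
proof (intro allI impI)
  fix s t
  let ?g1 = "w @ [a, False]" and ?g2 = "w @ [\<not> a, True]"
  assume *: "s \<in> hypercube 5 \<and> t \<in> hypercube 5 \<and> sg s = - 1 \<and> sg t = - 1 \<and> distinct [?g1, ?g2, s, t]"
  have sgr: "sg v = 1" if "v \<in> set reds5" for v using that by (auto simp: reds5_def sg_def)
  show "linked (hypercube 5 - set (reds5 @ [?g1, ?g2])) s t"
  proof (rule routes_linked[OF routes5_ok])
    show "reds5 @ [?g1, ?g2] \<in> set faults5" using assms by (auto simp: faults5_def reds5_def)
    show "set (reds5 @ [?g1, ?g2]) \<subseteq> hypercube 5" using assms by (auto simp: hypercube_def reds5_def)
    show "s \<notin> set (reds5 @ [?g1, ?g2])" "t \<notin> set (reds5 @ [?g1, ?g2])"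
      using * sgr[of s] sgr[of t] by auto
  qed (use * in auto)
qed

text \<open>Rotating the first three coordinates permutes \<open>reds5\<close> and leaves the last
  two coordinates alone.\<close>

lemma residual_rotate:
  assumes r: "residual ([b, c, a] @ v) ([b, c, a] @ w)" and l: "length v = 2" "length w = 2"
  shows "residual ([a, b, c] @ v) ([a, b, c] @ w)"
  unfolding residual_def
proof (intro allI impI)
  fix s t
  let ?g1 = "[a, b, c] @ v" and ?g2 = "[a, b, c] @ w"
  assume *: "s \<in> hypercube 5 \<and> t \<in> hypercube 5 \<and> sg s = - 1 \<and> sg t = - 1 \<and> distinct [?g1, ?g2, s, t]"
  \<comment> \<open>The cycle sending \<open>0\<close> to \<open>1\<close>, \<open>1\<close> to
    \<open>2\<close> and \<open>2\<close> to \<open>0\<close>. As \<open>permute_list p\<close>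
    reads position \<open>p i\<close>, it moves the first entry behind the third.\<close>
  define p :: "nat \<Rightarrow> nat" where "p = transpose 0 1 \<circ> transpose 1 2"
  have p: "p permutes {..<5}" unfolding p_def by (intro permutes_compose permutes_swap_id) auto
  note f = cube_map_permute[OF p]
  have rot: "permute_list p (x # y # z # u) = y # z # x # u" if lu: "length u = 2" for x y z :: bool and u
  proof -
    obtain k l where u: "u = [k, l]" using lu by (cases u; cases "tl u") auto
    have "p 0 = 1" "p 1 = 2" "p 2 = 0" "p 3 = 3" "p 4 = 4" by (simp_all add: p_def transpose_def)
    moreover have "permute_list p [x, y, z, k, l] = map (\<lambda>i. [x, y, z, k, l] ! p i) [0, 1, 2, 3, 4]"
    proof -
      have "[0..<length [x, y, z, k, l]] = [0, 1, 2, 3, 4]" by (simp add: upt_rec)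
      then show ?thesis by (simp only: permute_list_def)
    qed
    ultimately show ?thesis by (simp add: u)
  qed
  have sgp: "sg (permute_list p x) = sg x" if "x \<in> hypercube 5" for x
    using that p by (simp add: sg_def hypercube_def flip: count_mset)
  have g: "?g1 \<in> hypercube 5" "?g2 \<in> hypercube 5" using l by (auto simp: hypercube_def)
  have "linked (hypercube 5 - set (reds5 @ [[b, c, a] @ v, [b, c, a] @ w])) (permute_list p s) (permute_list p t)"
  proof -
    have "permute_list p ?g1 = [b, c, a] @ v" "permute_list p ?g2 = [b, c, a] @ w" using rot l by auto
    then have "distinct [[b, c, a] @ v, [b, c, a] @ w, permute_list p s, permute_list p t]"
      using cube_map_facts(2)[OF f] g * by (metis distinct_length_2_or_more distinct_singleton)
    then show ?thesis
      using r[unfolded residual_def, rule_format, of "permute_list p s" "permute_list p t"]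
        cube_map_facts(1)[OF f] sgp * by simp
  qed
  moreover have "set (map (permute_list p) (reds5 @ [?g1, ?g2])) = set (reds5 @ [[b, c, a] @ v, [b, c, a] @ w])"
    using rot l by (auto simp: reds5_def)
  ultimately have "linked (hypercube 5 - set (map (permute_list p) (reds5 @ [?g1, ?g2]))) (permute_list p s) (permute_list p t)"
    by metis
  then show "linked (hypercube 5 - set (reds5 @ [?g1, ?g2])) s t"
    by (rule cube_map_transport[OF f, of "reds5 @ [?g1, ?g2]", rotated -1]) (use * g in \<open>auto simp: reds5_def hypercube_def\<close>)
qed

text \<open>Parity determines \<open>x\<close> from \<open>a\<close>, \<open>b\<close>,
  \<open>c\<close>, which leaves eight cases: four are computed, and rotation adds two for prefixes
  of weight one and two for those of weight two.\<close>

lemma residual_odd: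
  assumes "sg ([a, b, c, x, False]) = - 1"
  shows "residual ([a, b, c] @ [x, False]) ([a, b, c] @ [\<not> x, True])"
proof -
  have A: "residual ([True,False,False] @ [False, False]) ([True,False,False] @ [True, True])"
    and B: "residual ([True,True,True] @ [False, False]) ([True,True,True] @ [True, True])"
    and C: "residual ([False,False,False] @ [True, False]) ([False,False,False] @ [False, True])"
    and D: "residual ([True,True,False] @ [True, False]) ([True,True,False] @ [False, True])"
    using residual_routes[of "[True,False,False]" False] residual_routes[of "[True,True,True]" False]
      residual_routes[of "[False,False,False]" True] residual_routes[of "[True,True,False]" True] by simp_all
  have A1: "residual ([False,True,False] @ [False, False]) ([False,True,False] @ [True, True])"
    by (rule residual_rotate[OF A]) simp_all
  have A2: "residual ([False,False,True] @ [False, False]) ([False,False,True] @ [True, True])"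
    by (rule residual_rotate[OF A1]) simp_all
  have D1: "residual ([False,True,True] @ [True, False]) ([False,True,True] @ [False, True])"
    by (rule residual_rotate[OF D]) simp_all
  have D2: "residual ([True,False,True] @ [True, False]) ([True,False,True] @ [False, True])"
    by (rule residual_rotate[OF D1]) simp_all
  show ?thesis using assms A B C D A1 A2 D1 D2
    by (cases a; cases b; cases c; cases x) (simp_all add: sg_def)
qed

text \<open>The subcube of the first three coordinates has only three nonzero even vertices, so the
  reds must be all of \<open>reds5\<close>.\<close>

lemma linked_5_translated:
  assumes r: "{r1, r2, r3} \<subseteq> hypercube 5" "distinct [r1, r2, r3]" "sg r1 = 1" "sg r2 = 1" "sg r3 = 1"
    and r0: "\<And>r. r \<in> {r1, r2, r3} \<Longrightarrow> \<not> r ! 3 \<and> \<not> r ! 4 \<and> r \<noteq> replicate 5 False"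
    and g: "{g1, g2} \<subseteq> hypercube 5" "vxor g1 g2 = [False,False,False,True,True]" "sg g1 = - 1" "sg g2 = - 1"
    and st: "s \<in> hypercube 5" "t \<in> hypercube 5" "sg s = - 1" "sg t = - 1" "distinct [g1, g2, s, t]"
  shows "linked (hypercube 5 - set [r1, r2, r3, g1, g2]) s t"
proof -
  have "r \<in> set reds5" if "r \<in> {r1, r2, r3}" for r
  proof -
    have "r \<in> hypercube 5" "sg r = 1" using that r by auto
    then obtain x y z u v where "r = [x, y, z, u, v]" using hypercube_5_cases by metis
    moreover have "replicate 5 False = [False,False,False,False,False]" by (simp add: eval_nat_numeral)
    ultimately show ?thesis using r0[OF that] \<open>sg r = 1\<close>
      by (cases x; cases y; cases z) (simp_all add: sg_def reds5_def)
  qed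
  then have "{r1, r2, r3} \<subseteq> set reds5" by blast
  moreover have "card {r1, r2, r3} = 3" using r(2) by simp
  moreover have "card (set reds5) = 3" by (simp add: reds5_def)
  ultimately have reds: "{r1, r2, r3} = set reds5" by (intro card_subset_eq) auto
  obtain a b c x u where g1: "g1 = [a, b, c, x, u]" using g(1) hypercube_5_cases by blast
  obtain a' b' c' x' u' where g2: "g2 = [a', b', c', x', u']" using g(1) hypercube_5_cases by blast
  have eq: "a' = a" "b' = b" "c' = c" "x' = (\<not> x)" "u' = (\<not> u)" using g(2) g1 g2 by (auto simp: vxor_def)
  \<comment> \<open>\<open>residual_odd\<close> lists the green with last coordinate
    \<open>False\<close> first. The greens differ there, so one of the two orders fits.\<close>
  have "residual g1 g2 \<or> residual g2 g1"
    using residual_odd[of a b c x] residual_odd[of a b c "\<not> x"] g(3,4) unfolding g1 g2 eq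
    by (cases u) simp_all
  then have "linked (hypercube 5 - set (reds5 @ [g1, g2])) s t"
  proof
    assume "residual g1 g2"
    then show ?thesis using st unfolding residual_def by blast
  next
    assume "residual g2 g1"
    moreover have "distinct [g2, g1, s, t]" using st by auto
    ultimately have "linked (hypercube 5 - set (reds5 @ [g2, g1])) s t" using st unfolding residual_def by blast
    moreover have "set (reds5 @ [g2, g1]) = set (reds5 @ [g1, g2])" by auto
    ultimately show ?thesis by metis
  qed
  moreover have "set (reds5 @ [g1, g2]) = set [r1, r2, r3, g1, g2]" using reds by auto
  ultimately show ?thesis by metis
qed

lemma sg_cube_map_vxor: "w \<in> hypercube n \<Longrightarrow> v \<in> hypercube n \<Longrightarrow> sg (vxor w v) = sg w * sg v"
  by (simp add: sg_vxor hypercube_def)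

text \<open>The reds lie in a subcube of dimension three, which has four even vertices, and their
  sum \<open>m\<close> is the fourth. Translation by \<open>m\<close> preserves signs and takes each
  red to the sum of the other two, which is not zero.\<close>

lemma linked_5_permuted:
  assumes r: "{r1, r2, r3} \<subseteq> hypercube 5" "distinct [r1, r2, r3]" "sg r1 = 1" "sg r2 = 1" "sg r3 = 1"
    and agree: "\<And>i. i \<in> {3, 4} \<Longrightarrow> r2 ! i = r1 ! i \<and> r3 ! i = r1 ! i"
    and g: "{g1, g2} \<subseteq> hypercube 5" "vxor g1 g2 = [False,False,False,True,True]" "sg g1 = - 1" "sg g2 = - 1"
    and st: "s \<in> hypercube 5" "t \<in> hypercube 5" "sg s = - 1" "sg t = - 1" "distinct [g1, g2, s, t]"
  shows "linked (hypercube 5 - set [r1, r2, r3, g1, g2]) s t"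
proof -
  define m where "m = vxor (vxor r1 r2) r3"
  have lr: "length r1 = 5" "length r2 = 5" "length r3 = 5" and lg: "length g1 = 5" "length g2 = 5"
    using r(1) g(1) by (auto simp: hypercube_def)
  have m: "m \<in> hypercube 5" "sg m = 1" using lr r by (simp_all add: m_def hypercube_def sg_vxor)
  note f = cube_map_vxor[OF m(1)]
  have nm: "m ! i = ((r1 ! i \<noteq> r2 ! i) \<noteq> r3 ! i)" if "i < 5" for i using that lr by (simp add: m_def nth_vxor)
  have lm: "length m = 5" using m by (simp add: hypercube_def)
  have sgm: "sg (vxor m v) = sg v" if "v \<in> hypercube 5" for v using that m by (simp add: sg_cube_map_vxor)
  have mem: "r1 \<in> hypercube 5" "r2 \<in> hypercube 5" "r3 \<in> hypercube 5" "g1 \<in> hypercube 5" "g2 \<in> hypercube 5"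
    using r g by auto
  have diff: "\<exists>i<5. x ! i \<noteq> y ! i" if "x \<noteq> y" "length x = 5" "length y = 5" for x y :: vertex
    using that by (auto simp: list_eq_iff_nth_eq)
  have nz: "vxor m r1 \<noteq> replicate 5 False" "vxor m r2 \<noteq> replicate 5 False" "vxor m r3 \<noteq> replicate 5 False"
  proof -
    obtain i where "i < 5" "r2 ! i \<noteq> r3 ! i" using diff[of r2 r3] r(2) lr by auto
    then have "vxor m r1 ! i \<noteq> replicate 5 False ! i" using lm lr nm by (auto simp: nth_vxor)
    then show "vxor m r1 \<noteq> replicate 5 False" by metis
    obtain i where "i < 5" "r1 ! i \<noteq> r3 ! i" using diff[of r1 r3] r(2) lr by auto
    then have "vxor m r2 ! i \<noteq> replicate 5 False ! i" using lm lr nm by (auto simp: nth_vxor)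
    then show "vxor m r2 \<noteq> replicate 5 False" by metis
    obtain i where "i < 5" "r1 ! i \<noteq> r2 ! i" using diff[of r1 r2] r(2) lr by auto
    then have "vxor m r3 ! i \<noteq> replicate 5 False ! i" using lm lr nm by (auto simp: nth_vxor)
    then show "vxor m r3 \<noteq> replicate 5 False" by metis
  qed
  have A: "linked (hypercube 5 - set [vxor m r1, vxor m r2, vxor m r3, vxor m g1, vxor m g2]) (vxor m s) (vxor m t)"
  proof (rule linked_5_translated)
    show "\<not> v ! 3 \<and> \<not> v ! 4 \<and> v \<noteq> replicate 5 False" if v: "v \<in> {vxor m r1, vxor m r2, vxor m r3}" for v
    proof -
      obtain r where r: "r \<in> {r1, r2, r3}" "v = vxor m r" using v by blast
      then have "length r = 5" "r ! 3 = r1 ! 3" "r ! 4 = r1 ! 4" using agree[of 3] agree[of 4] lr by auto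
      moreover have "m ! 3 = r1 ! 3" "m ! 4 = r1 ! 4"
        using nm[of 3] nm[of 4] agree[of 3] agree[of 4] by auto
      ultimately have "\<not> v ! 3 \<and> \<not> v ! 4" using lm by (simp add: r(2) nth_vxor)
      moreover have "v \<noteq> replicate 5 False" using v nz by auto
      ultimately show ?thesis by blast
    qed
    have "vxor (vxor m g1) (vxor m g2) = vxor g1 g2"
      using lm lg by (intro nth_equalityI) (auto simp: nth_vxor)
    then show "vxor (vxor m g1) (vxor m g2) = [False,False,False,True,True]" using g(2) by simp
    show "{vxor m r1, vxor m r2, vxor m r3} \<subseteq> hypercube 5" "{vxor m g1, vxor m g2} \<subseteq> hypercube 5"
      using cube_map_facts(1)[OF f] mem by auto
    show "distinct [vxor m r1, vxor m r2, vxor m r3]" "distinct [vxor m g1, vxor m g2, vxor m s, vxor m t]"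
      using cube_map_facts(2)[OF f] mem st r(2) by simp_all
  qed (use cube_map_facts(1)[OF f] mem st sgm r g in simp_all)
  show ?thesis
    by (rule cube_map_transport[OF f, of "[r1, r2, r3, g1, g2]"]) (use A mem st in simp_all)
qed

lemma linked_5_residual:
  assumes r: "{r1, r2, r3} \<subseteq> hypercube 5" "distinct [r1, r2, r3]" "sg r1 = 1" "sg r2 = 1" "sg r3 = 1"
    and agree: "\<And>i. i < 5 \<Longrightarrow> g1 ! i \<noteq> g2 ! i \<Longrightarrow> r2 ! i = r1 ! i \<and> r3 ! i = r1 ! i"
    and g: "{g1, g2} \<subseteq> hypercube 5" "sg g1 = - 1" "sg g2 = - 1"
    and st: "s \<in> hypercube 5" "t \<in> hypercube 5" "sg s = - 1" "sg t = - 1" "distinct [g1, g2, s, t]"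
  shows "linked (hypercube 5 - set [r1, r2, r3, g1, g2]) s t"
proof -
  define e where "e = vxor g1 g2"
  have lr: "length r1 = 5" "length r2 = 5" "length r3 = 5" and lg: "length g1 = 5" "length g2 = 5"
    using r(1) g(1) by (auto simp: hypercube_def)
  have le: "length e = 5" and ne: "\<And>i. i < 5 \<Longrightarrow> e ! i = (g1 ! i \<noteq> g2 ! i)"
    using lg by (auto simp: e_def nth_vxor)
  have sge: "sg e = 1" using lg g by (simp add: e_def sg_vxor)
  have mem: "r1 \<in> hypercube 5" "r2 \<in> hypercube 5" "r3 \<in> hypercube 5" "g1 \<in> hypercube 5" "g2 \<in> hypercube 5"
    using r g by auto
  have "g1 \<noteq> g2" using st(5) by auto
  then have e0: "e \<noteq> replicate 5 False"
    using ne lg le by (metis nth_equalityI nth_replicate)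
  \<comment> \<open>Greens have equal sign, so they differ in two or four coordinates; a permutation
    moves these to the end.\<close>
  have "\<exists>d\<in>{[False,False,False,True,True], [False,True,True,True,True]}. mset d = mset e"
  proof -
    obtain a b c x y where e: "e = [a, b, c, x, y]" using le hypercube_5_cases by (metis hypercube_def mem_Collect_eq)
    have "replicate 5 False = [False,False,False,False,False]" by (simp add: eval_nat_numeral)
    then show ?thesis using sge e0 unfolding e
      by (cases a; cases b; cases c; cases x; cases y) (simp_all add: sg_def multiset_eq_iff all_bool_eq)
  qed
  then obtain d where d: "d \<in> {[False,False,False,True,True], [False,True,True,True,True]}" "mset d = mset e" by blast
  obtain p where p: "p permutes {..<5}" "permute_list p e = d"
    using mset_eq_permutation[OF d(2)] le by metis
  let ?p = "permute_list p"
  note f = cube_map_permute[OF p(1)]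
  have np: "?p v ! i = v ! p i" "p i < 5" if "v \<in> hypercube 5" "i < 5" for v i
    using that p(1) permutes_in_image[OF p(1), of i] by (auto simp: hypercube_def permute_list_nth)
  have sgp: "sg (?p v) = sg v" if "v \<in> hypercube 5" for v
    using that p(1) by (simp add: sg_def hypercube_def flip: count_mset)
  have agree': "?p r2 ! i = ?p r1 ! i \<and> ?p r3 ! i = ?p r1 ! i" if "i < 5" "d ! i" for i
  proof -
    have "e ! p i" using that p(2) np(1)[of e i] le by (simp add: hypercube_def)
    then show ?thesis using agree[of "p i"] ne np mem that by auto
  qed
  have mem': "?p r1 \<in> hypercube 5" "?p r2 \<in> hypercube 5" "?p r3 \<in> hypercube 5" "?p g1 \<in> hypercube 5" "?p g2 \<in> hypercube 5"
    using cube_map_facts(1)[OF f] mem by auto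
  have dist: "distinct [?p r1, ?p r2, ?p r3]" "distinct [?p g1, ?p g2, ?p s, ?p t]"
    using cube_map_facts(2)[OF f] mem st r(2) by simp_all
  \<comment> \<open>If the greens differed in four coordinates, the reds would agree in these, hence
    by parity also in the fifth, and would coincide.\<close>
  have d2: "d = [False,False,False,True,True]"
  proof (rule ccontr)
    assume "d \<noteq> [False,False,False,True,True]"
    then have d4: "d = [False,True,True,True,True]" using d(1) by simp
    obtain a b c x y where 1: "?p r1 = [a, b, c, x, y]" using mem' hypercube_5_cases by metis
    obtain a' b' c' x' y' where 2: "?p r2 = [a', b', c', x', y']" using mem' hypercube_5_cases by metis
    have "b' = b" "c' = c" "x' = x" "y' = y"
      using agree'[of 1] agree'[of 2] agree'[of 3] agree'[of 4] unfolding d4 1 2 by simp_all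
    moreover from this have "a' = a" using sgp[of r1] sgp[of r2] mem r(3,4) unfolding 1 2
      by (auto simp: sg_Cons split: if_splits)
    ultimately show False using dist(1) 1 2 by simp
  qed
  have A: "linked (hypercube 5 - set [?p r1, ?p r2, ?p r3, ?p g1, ?p g2]) (?p s) (?p t)"
  proof (rule linked_5_permuted)
    show "?p r2 ! i = ?p r1 ! i \<and> ?p r3 ! i = ?p r1 ! i" if "i \<in> {3, 4}" for i
      using agree'[of i] that d2 by auto
    have "vxor (?p g1) (?p g2) = ?p e"
    proof (rule nth_equalityI)
      fix i assume "i < length (vxor (?p g1) (?p g2))"
      then have "i < 5" using lg by simp
      then show "vxor (?p g1) (?p g2) ! i = ?p e ! i"
        using np[of g1 i] np[of g2 i] np[of e i] mem lg le ne[of "p i"] by (simp add: nth_vxor hypercube_def)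
    qed (use lg le in simp)
    then show "vxor (?p g1) (?p g2) = [False,False,False,True,True]" using p(2) d2 by simp
  qed (use mem' dist sgp mem cube_map_facts(1)[OF f] st r g in simp_all)
  show ?thesis
    by (rule cube_map_transport[OF f, of "[r1, r2, r3, g1, g2]"]) (use A mem st in simp_all)
qed

lemma linkable_5: "linkable (hypercube 5) 5"
proof (rule linkable_5I)
  fix r1 r2 r3 g1 g2 s t
  assume sub: "{r1, r2, r3, g1, g2, s, t} \<subseteq> hypercube 5"
    and sg: "sg r1 = 1" "sg r2 = 1" "sg r3 = 1" "sg g1 = - 1" "sg g2 = - 1" "sg s = - 1" "sg t = - 1"
    and d: "distinct [r1, r2, r3]" "distinct [g1, g2, s, t]"
  show "linked (hypercube 5 - {r1, r2, r3, g1, g2}) s t"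
  proof (cases "\<forall>i<5. g1 ! i \<noteq> g2 ! i \<longrightarrow> r2 ! i = r1 ! i \<and> r3 ! i = r1 ! i")
    case True
    then have "linked (hypercube 5 - set [r1, r2, r3, g1, g2]) s t"
      by (intro linked_5_residual) (use sub sg d in auto)
    then show ?thesis by simp
  next
    case False
    then obtain i where i: "i \<le> 4" "g1 ! i \<noteq> g2 ! i" "\<not> (r2 ! i = r1 ! i \<and> r3 ! i = r1 ! i)"
      by (metis less_Suc_eq_le eval_nat_numeral(3))
    have *: "linked (hypercube 5 - {x, y, z, h1, h2}) s t"
      if xyz: "x \<in> half 5 i b" "y \<in> half 5 i (\<not> b)" "z \<in> half 5 i (\<not> b)" "h1 \<in> half 5 i b" "h2 \<in> half 5 i (\<not> b)"
        and sx: "sg x = 1" "sg y = 1" "sg z = 1" "sg h1 = - 1" "sg h2 = - 1" "y \<noteq> z" "distinct [h1, h2, s, t]" for x y z h1 h2 b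
    proof -
      have 5: "Suc 4 = 5" by simp
      interpret cube_halves "half 5 i b" "half 5 i (\<not> b)" "flip i" 4
        using halves[OF i(1), of b] unfolding 5 .
      have "linked (half 5 i b \<union> half 5 i (\<not> b) - {x, y, z, h1, h2}) s t"
      proof (rule linked_11_21)
        show "linkable (half 5 i b) 3" "linkable (half 5 i (\<not> b)) 3"
          using linkable_half[OF linkable_4 i(1)] unfolding 5 by blast+
        show "16 \<le> card (half 5 i (\<not> b))" using card_half[OF i(1)] unfolding 5 by simp
      qed (use xyz sx sg sub half_Un in auto)
      then show ?thesis unfolding half_Un .
    qed
    have mem: "v \<in> half 5 i b \<longleftrightarrow> v ! i = b" if "v \<in> {r1, r2, r3, g1, g2}" for v b
      using sub that by (auto simp: half_def)
    \<comment> \<open>\<open>x\<close> is the red that coordinate \<open>i\<close> separates from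
      the other two. The green in the half of \<open>x\<close> takes the place of
      \<open>h1\<close>.\<close>
    have **: "linked (hypercube 5 - {x, y, z, g1, g2}) s t"
      if xyz: "x \<in> {r1, r2, r3}" "y \<in> {r1, r2, r3}" "z \<in> {r1, r2, r3}" "x ! i \<noteq> y ! i" "z ! i = y ! i" "y \<noteq> z" for x y z
    proof (cases "g1 ! i = x ! i")
      case True
      show ?thesis
        by (rule *[of x "x ! i" y z g1 g2]) (use True i(2) xyz sg d mem in auto)
    next
      case False
      have "linked (hypercube 5 - {x, y, z, g2, g1}) s t"
        by (rule *[of x "x ! i" y z g2 g1]) (use False i(2) xyz sg d mem in auto)
      then show ?thesis by (simp add: insert_commute)
    qed
    consider "r1 ! i \<noteq> r2 ! i" "r3 ! i = r2 ! i" | "r2 ! i \<noteq> r1 ! i" "r3 ! i = r1 ! i" | "r3 ! i \<noteq> r1 ! i" "r2 ! i = r1 ! i"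
      using i(3) by blast
    then show ?thesis
    proof cases
      case 1
      with **[of r1 r2 r3] d show ?thesis by simp
    next
      case 2
      with **[of r2 r1 r3] d show ?thesis by (simp add: insert_commute)
    next
      case 3
      with **[of r3 r1 r2] d show ?thesis by (simp add: insert_commute)
    qed
  qed
qed simp

lemma linkable_ge_5: "5 \<le> n \<Longrightarrow> linkable (hypercube n) 5"
  by (induction rule: dec_induct) (auto intro: linkable_5 linkable_5_step)

section \<open>Prescribed ends\<close>

lemma red_sg: "red c v \<longleftrightarrow> sg v = (if c then 1 else - 1)"
  and green_sg: "green c v \<longleftrightarrow> sg v = (if c then - 1 else 1)"
  by (auto simp: red_def green_def sg_def)

lemma linked_5_2:
  assumes n: "5 \<le> n" and sub: "{r1, r2, r3, g1, g2} \<subseteq> hypercube n"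
    and r: "red c r1" "red c r2" "red c r3" "distinct [r1, r2, r3]" and g: "green c g1" "green c g2" "g1 \<noteq> g2"
    and st: "{s, t} \<subseteq> hypercube n - {r1, r2, r3, g1, g2}" "green c s" "green c t" "s \<noteq> t"
  shows "linked (hypercube n - {r1, r2, r3, g1, g2}) s t"
proof -
  have "linked (hypercube n - set [r1, r2, r3, g1, g2]) s t"
  proof (rule linkableD[OF linkable_ge_5[OF n]])
    have "r \<noteq> g" if "red c r" "green c g" for r g using that by (auto simp: green_def)
    then show "distinct [r1, r2, r3, g1, g2]" using r g by auto
    show "2 * sum_list (map sg [r1, r2, r3, g1, g2]) + sg s + sg t = 0"
      using r g st by (auto simp: red_sg green_sg split: if_splits)
  qed (use sub st in auto)
  then show ?thesis by simp
qed

lemma sum_sg: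
  "finite F \<Longrightarrow> sum sg F = (if c then 1 else - 1) * (int (card {v \<in> F. red c v}) - int (card {v \<in> F. green c v}))"
proof (induction F rule: finite_induct)
  case (insert x F)
  have "{v \<in> insert x F. Q v} = (if Q x then insert x {v \<in> F. Q v} else {v \<in> F. Q v})" for Q by auto
  then have card: "card {v \<in> insert x F. Q v} = card {v \<in> F. Q v} + (if Q x then 1 else 0)" for Q
    using insert(1,2) by simp
  have "sg x = (if c then 1 else - 1) * (if red c x then 1 else - 1)"
    using sg_cases[of x] by (auto simp: red_sg)
  then show ?case using insert unfolding card by (auto simp: green_def algebra_simps)
qed simp

section \<open>Admissible sets consisting of one pair\<close>

lemma red_pair_iff: "u \<noteq> v \<Longrightarrow> red_pair c {u, v} \<longleftrightarrow> red c u \<and> red c v"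
  and green_pair_iff: "u \<noteq> v \<Longrightarrow> green_pair c {u, v} \<longleftrightarrow> green c u \<and> green c v"
  by (auto simp: red_pair_def green_pair_def vertex_pair_def)

lemma neutral_pair_iff: "neutral_pair c {u, v} \<longleftrightarrow> (red c u \<longleftrightarrow> green c v)"
  by (auto simp: neutral_pair_def green_def doubleton_eq_iff)

lemma charged_pair_iff: "u \<noteq> v \<Longrightarrow> charged_pair c {u, v} \<longleftrightarrow> (red c u \<longleftrightarrow> red c v)"
  by (auto simp: charged_pair_def red_pair_iff green_pair_iff green_def)

lemma admissible_single:
  assumes uv: "u \<noteq> v"
  shows "admissible_ends c n F 0 1 {{u, v}} \<longleftrightarrow> {u, v} \<subseteq> hypercube n - F \<and> (red c u \<longleftrightarrow> red c v) \<and>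
     int (card {v \<in> F. red c v}) - int (card {v \<in> F. green c v}) = (if green c u then 1 else - 1)"
proof -
  have *: "card {e. e = {u, v} \<and> Q e} = (if Q {u, v} then 1 else 0)" for Q
    by (cases "Q {u, v}") (auto simp: conj_commute cong: conj_cong)
  have "vertex_pair {u, v}" using uv by (auto simp: vertex_pair_def)
  then show ?thesis
    using uv by (auto simp: admissible_ends_def disjoint_pairs_def in_balance_def * red_pair_iff
        green_pair_iff neutral_pair_iff charged_pair_iff green_def)
qed

lemma admissible_cases:
  assumes E: "admissible_ends c n F 0 1 E"
  obtains u v where "u \<noteq> v" "E = {{u, v}}"
proof -
  have pairs: "vertex_pair e" if "e \<in> E" for e using E that by (auto simp: admissible_ends_def disjoint_pairs_def)
  \<comment> \<open>Finiteness matters: an infinite set of neutral pairs would have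
    \<open>card\<close> 0, too.\<close>
  have "\<Union>E \<subseteq> hypercube n" using E by (auto simp: admissible_ends_def in_balance_def)
  then have fin: "finite E" using finite_hypercube finite_subset finite_UnionD by metis
  have "{e \<in> E. neutral_pair c e} = {}" using E fin by (simp add: admissible_ends_def)
  moreover have "neutral_pair c e \<or> charged_pair c e" if e: "e \<in> E" for e
  proof -
    obtain u v where "u \<noteq> v" "e = {u, v}" using pairs[OF e] by (auto simp: vertex_pair_def)
    then show ?thesis by (auto simp: neutral_pair_iff charged_pair_iff green_def)
  qed
  ultimately have "E = {e \<in> E. charged_pair c e}" by blast
  then have "card E = 1" using E by (simp add: admissible_ends_def)
  then obtain e where e: "E = {e}" by (auto simp: card_1_singleton_iff)
  then obtain u v where "u \<noteq> v" "e = {u, v}" using pairs by (auto simp: vertex_pair_def)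
  then show ?thesis using that e by blast
qed

text \<open>Any vertex of the other sign has \<open>n\<close> neighbours, all of the required
  sign.\<close>

lemma exists_same_sign:
  assumes n: "0 < n" and e: "e \<in> {1, - 1}" and l: "length xs < n"
  shows "\<exists>v\<in>hypercube n. sg v = e \<and> v \<notin> set xs"
proof -
  have "sg (replicate n False) = 1" by (simp add: sg_def)
  then obtain w where w: "w \<in> hypercube n" "sg w = - e"
    using e n sg_flip[of 0 "replicate n False"] by (auto simp: hypercube_def intro: that[of "replicate n False"] that[of "flip 0 (replicate n False)"])
  obtain v where v: "v \<in> hypercube n" "adj w v" "v \<notin> set xs"
    using exists_outside_list[of xs "{u \<in> hypercube n. adj w u}"] card_neighbours_hypercube[OF w(1)] l by auto
  then have "sg v = e" using adj_sg[OF v(2)] w(2) by simp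
  with v show ?thesis by blast
qed

lemma freely_prescribable_5_1:
  assumes n: "5 \<le> n" and F: "fault n F" "mass F = 5" "charge c F = 1"
  shows "freely_prescribable c n F 0 1"
  unfolding freely_prescribable_def
proof (intro conjI allI impI)
  have fin: "finite F" using F(1) finite_hypercube finite_subset by (auto simp: fault_def)
  let ?R = "{v \<in> F. red c v}" and ?G = "{v \<in> F. green c v}"
  have "F = ?R \<union> ?G" "?R \<inter> ?G = {}" by (auto simp: green_def)
  then have RG: "card ?R + card ?G = 5" using F(2) fin by (metis (no_types, lifting) card_Un_disjoint finite_Un mass_def)
  have ch: "\<bar>int (card ?R) - int (card ?G)\<bar> = 1" using F(3) by (simp add: charge_def)
  show "\<exists>E. admissible_ends c n F 0 1 E"
  proof -
    \<comment> \<open>\<open>S\<close> is the minority colour of the fault and \<open>e\<close> its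
      sign. Balance demands a pair of this colour, so the two vertices of \<open>S\<close> are the
      only deleted ones that it could meet.\<close>
    define S where "S = (if card ?G < card ?R then ?G else ?R)"
    define e :: int where "e = (if (card ?G < card ?R) = c then - 1 else 1)"
    have S: "finite S" "card S = 2" "S = {v \<in> F. sg v = e}"
      using fin RG ch by (auto simp: S_def e_def red_sg green_sg)
    obtain xs where xs: "set xs = S" "length xs = 2" using S(1,2) finite_distinct_list distinct_card by metis
    have e: "e \<in> {1, - 1}" by (simp add: e_def)
    obtain u where u: "u \<in> hypercube n" "sg u = e" "u \<notin> set xs"
      using exists_same_sign[of n e xs] n e xs by auto
    obtain v where v: "v \<in> hypercube n" "sg v = e" "v \<notin> set (u # xs)"
      using exists_same_sign[of n e "u # xs"] n e xs by auto
    have "admissible_ends c n F 0 1 {{u, v}}"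
      using u v S(3) xs(1) ch RG by (subst admissible_single) (auto simp: e_def red_sg green_sg split: if_splits)
    then show ?thesis by blast
  qed
  fix E assume E: "admissible_ends c n F 0 1 E"
  obtain u v where uv: "u \<noteq> v" "E = {{u, v}}" using admissible_cases[OF E] .
  have uv': "u \<in> hypercube n - F" "v \<in> hypercube n - F" "red c u = red c v"
    "int (card ?R) - int (card ?G) = (if green c u then 1 else - 1)"
    using E[unfolded uv(2) admissible_single[OF uv(1)]] by auto
  obtain fs where fs: "set fs = F" "distinct fs" using fin finite_distinct_list by blast
  have "linked (hypercube n - set fs) u v"
  proof (rule linkableD[OF linkable_ge_5[OF n] fs(2)])
    show "length fs \<le> 5" using fs F(2) distinct_card[of fs] by (simp add: mass_def)
    have "sum_list (map sg fs) = sum sg F" using fs by (simp add: sum_list_distinct_conv_sum_set)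
    then show "2 * sum_list (map sg fs) + sg u + sg v = 0"
      unfolding sum_sg[OF fin, of c] uv'(4) using uv'(3) sg_cases[of u] sg_cases[of v]
      by (auto simp: red_sg green_sg split: if_splits)
  qed (use fs uv uv' F(1) in \<open>auto simp: fault_def\<close>)
  then obtain p where p: "hamiltonian_path (hypercube n - F) p" "hd p = u" "last p = v"
    unfolding fs(1) linked_def by blast
  then have "path_covering (hypercube n - F) {p}"
    by (simp add: path_covering_def hamiltonian_path_def disjoint_family_on_def)
  moreover have "path_ends ` {p} = E" using p uv by (simp add: path_ends_def)
  ultimately show "\<exists>P. path_covering (hypercube n - F) P \<and> path_ends ` P = E" by blast
qed

text \<open>The prescribed ends are an image of \<open>P\<close>, so several paths might share them.
  But every path of \<open>P\<close> contains \<open>u\<close>, and disjointness leaves only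
  one.\<close>

lemma linked_if_covering:
  assumes P: "path_covering S P" "path_ends ` P = {{u, v}}"
  shows "linked S u v"
proof -
  have path: "is_path S p" if "p \<in> P" for p using P(1) that by (simp add: path_covering_def)
  have ends: "{hd p, last p} = {u, v}" if "p \<in> P" for p
  proof -
    have "path_ends p \<in> path_ends ` P" using that by blast
    then show ?thesis unfolding P(2) by (simp add: path_ends_def)
  qed
  have u: "u \<in> set p" if "p \<in> P" for p
    using ends[OF that] path[OF that] by (metis hd_in_set insertCI insertE is_path_def last_in_set singletonD)
  have "P \<noteq> {}" using P(2) by (metis image_empty insert_not_empty)
  then obtain p where p: "p \<in> P" by blast
  have "q = p" if "q \<in> P" for q
  proof (rule ccontr)
    assume "q \<noteq> p"
    then have "set q \<inter> set p = {}"
      using P(1) p that by (simp add: path_covering_def disjoint_family_on_def)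
    then show False using u[OF p] u[OF that] by blast
  qed
  then have "P = {p}" using p by blast
  then have "hamiltonian_path S p" using P(1) by (auto simp: path_covering_def hamiltonian_path_def)
  then have "linked S (hd p) (last p)" by (auto simp: linked_def)
  then show ?thesis using ends[OF p] linked_rev by (metis doubleton_eq_iff)
qed

section \<open>Counterexamples in dimensions 3 and 4\<close>

text \<open>
  The red vertex \<open>[b, False, False, False]\<close> is not deleted, but its neighbours are the two deleted
  green vertices and the two ends, so a path through it cannot visit anything else.
\<close>

lemma not_linked_4:
  fixes c defines "b \<equiv> \<not> c"
  shows "\<not> linked (hypercube 4 - {[\<not> b,True,False,False], [\<not> b,False,True,False], [\<not> b,False,False,True],
      [\<not> b,False,False,False], [b,True,False,False]}) [b,False,True,False] [b,False,False,True]"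
    (is "\<not> linked ?V ?s ?t")
proof
  assume l: "linked ?V ?s ?t"
  let ?v = "[b, False, False, False]"
  obtain V1 V2 y z where V: "linked V1 ?s y" "linked V2 z ?t" "adj y ?v" "adj ?v z"
    "?V = insert ?v (V1 \<union> V2)" "V1 \<inter> V2 = {}" "?v \<notin> V1" "?v \<notin> V2"
    by (rule linked_cut_around[OF l, of ?v]) (simp_all add: hypercube_def)
  have nb: "w \<in> {?s, ?t}" if w: "adj ?v w" "w \<in> ?V" for w
  proof -
    obtain i where i: "i < length ?v" "w = flip i ?v" using w(1) unfolding adj_iff_flip by blast
    then have "i = 0 \<or> i = 1 \<or> i = 2 \<or> i = 3" by auto
    then show ?thesis using w(2) i(2) by (auto simp: flip_def)
  qed
  have mem: "?s \<in> V1" "y \<in> V1" "z \<in> V2" "?t \<in> V2" using linked_ends V(1,2) by auto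
  then have "y \<in> ?V" "z \<in> ?V" unfolding V(5) by auto
  then have "y \<in> {?s, ?t}" "z \<in> {?s, ?t}" using nb V(3,4) adj_sym by blast+
  then have "y = ?s" "z = ?t" using mem V(6) by auto
  then have "V1 = {?s}" "V2 = {?t}" using V(1,2) linked_same by auto
  moreover have "[\<not> b, True, True, True] \<in> ?V" by (simp add: hypercube_def)
  ultimately show False unfolding V(5) by simp
qed

text \<open>Only one red vertex remains, and it is the antipode of the first end.\<close>

lemma not_linked_3:
  fixes c defines "b \<equiv> \<not> c"
  shows "\<not> linked (hypercube 3 - {[\<not> b,True,False], [\<not> b,False,True], [b,True,True],
      [b,True,False], [b,False,True]}) [\<not> b,True,True] [\<not> b,False,False]"
    (is "\<not> linked ?V ?s ?t")
proof
  assume l: "linked ?V ?s ?t"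
  let ?v = "[b, False, False]"
  obtain V1 V2 y z where V: "linked V1 ?s y" "linked V2 z ?t" "adj y ?v" "adj ?v z"
    "?V = insert ?v (V1 \<union> V2)" "V1 \<inter> V2 = {}" "?v \<notin> V1" "?v \<notin> V2"
    by (rule linked_cut_around[OF l, of ?v]) (simp_all add: hypercube_def)
  have mem: "y \<in> V1" "?t \<in> V2" using linked_ends V(1,2) by auto
  then have y: "y \<in> ?V" "y \<noteq> ?v" "y \<noteq> ?t" using V(5-8) by auto
  have "adj ?v y" using V(3) adj_sym by blast
  then obtain i where i: "i < length ?v" "y = flip i ?v" unfolding adj_iff_flip by blast
  then have "i = 0 \<or> i = 1 \<or> i = 2" by auto
  then show False using y i(2) by (auto simp: flip_def)
qed

lemma not_freely_prescribable_4:
  "\<exists>F. fault 4 F \<and> mass F = 5 \<and> charge c F = 1 \<and> \<not> freely_prescribable c 4 F 0 1"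
proof -
  \<comment> \<open>Changing \<open>c\<close> negates the first coordinate of every listed vertex,
    which exchanges even and odd. Thus one configuration has the right colours in both
    cases.\<close>
  define b where "b = (\<not> c)"
  let ?F = "{[\<not> b,True,False,False], [\<not> b,False,True,False], [\<not> b,False,False,True],
      [\<not> b,False,False,False], [b,True,False,False]}"
  let ?s = "[b,False,True,False]" and ?t = "[b,False,False,True]"
  have R: "{v \<in> ?F. red c v} = {[\<not> b,True,False,False], [\<not> b,False,True,False], [\<not> b,False,False,True]}"
    and G: "{v \<in> ?F. green c v} = {[\<not> b,False,False,False], [b,True,False,False]}"
    by (cases c; auto simp: b_def red_def green_def)+
  have "admissible_ends c 4 ?F 0 1 {{?s, ?t}}"
  proof (subst admissible_single)
    show "?s \<noteq> ?t" by simp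
    show "{?s, ?t} \<subseteq> hypercube 4 - ?F \<and> (red c ?s \<longleftrightarrow> red c ?t) \<and>
      int (card {v \<in> ?F. red c v}) - int (card {v \<in> ?F. green c v}) = (if green c ?s then 1 else - 1)"
      unfolding R G by (cases c) (auto simp: b_def red_def green_def hypercube_def)
  qed
  moreover have "\<not> linked (hypercube 4 - ?F) ?s ?t" unfolding b_def by (rule not_linked_4)
  ultimately have "\<not> freely_prescribable c 4 ?F 0 1"
    unfolding freely_prescribable_def using linked_if_covering by metis
  moreover have "charge c ?F = 1" unfolding charge_def R G by simp
  moreover have "fault 4 ?F" "mass ?F = 5" by (simp_all add: fault_def hypercube_def mass_def)
  ultimately show ?thesis by blast
qed

lemma A_set_5_1: "m \<in> A_set c 5 1 0 1 \<longleftrightarrow> 5 \<le> m"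
proof
  assume m: "m \<in> A_set c 5 1 0 1"
  show "5 \<le> m"
  proof (rule ccontr)
    assume "\<not> 5 \<le> m"
    \<comment> \<open>Membership of \<open>m\<close> concerns all dimensions from \<open>m\<close>
      on, so the failure in dimension 4 excludes every smaller \<open>m\<close> as well.\<close>
    then have "m \<le> 4" by simp
    then show False using m not_freely_prescribable_4[of c] unfolding A_set_def by blast
  qed
next
  assume m: "5 \<le> m"
  \<comment> \<open>The argument is \<open>8\<close>, so the logarithmic bound amounts to
    \<open>m \<ge> 3\<close>.\<close>
  have "log 2 (real (5 + 1 + 2 * 0 + 2 * 1)) = log 2 (2 powr 3)" by simp
  also have "\<dots> = 3" by (subst log_powr_cancel) auto
  finally have "log 2 (real (5 + 1 + 2 * 0 + 2 * 1)) \<le> real m" using m by simp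
  then show "m \<in> A_set c 5 1 0 1"
    unfolding A_set_def using m freely_prescribable_5_1 by (simp add: order_trans)
qed

theorem lemma5p8:
  fixes c :: bool
  shows "A_set c 5 1 0 1 \<noteq> {} \<and> bracket c 5 1 0 1 = 5 \<and>
    (\<forall>n\<ge>5. \<forall>r1 r2 r3 g1 g2 g3 g4.
           {r1, r2, r3, g1, g2} \<subseteq> hypercube n \<and>
           red c r1 \<and> red c r2 \<and> red c r3 \<and> distinct [r1, r2, r3] \<and>
           green c g1 \<and> green c g2 \<and> g1 \<noteq> g2 \<and>
           {g3, g4} \<subseteq> hypercube n - {r1, r2, r3, g1, g2} \<and>
           green c g3 \<and> green c g4 \<and> g3 \<noteq> g4 \<longrightarrow>
           (\<exists>p. hamiltonian_path (hypercube n - {r1, r2, r3, g1, g2}) p \<and>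
                hd p = g3 \<and> last p = g4)) \<and>
    (\<forall>n\<in>{3, 4}. \<exists>r1 r2 r3 g1 g2 g3 g4.
           {r1, r2, r3, g1, g2} \<subseteq> hypercube n \<and>
           red c r1 \<and> red c r2 \<and> red c r3 \<and> distinct [r1, r2, r3] \<and>
           green c g1 \<and> green c g2 \<and> g1 \<noteq> g2 \<and>
           {g3, g4} \<subseteq> hypercube n - {r1, r2, r3, g1, g2} \<and>
           green c g3 \<and> green c g4 \<and> g3 \<noteq> g4 \<and>
           \<not> (\<exists>p. hamiltonian_path (hypercube n - {r1, r2, r3, g1, g2}) p \<and>
                  hd p = g3 \<and> last p = g4))"
proof (intro conjI)
  show "A_set c 5 1 0 1 \<noteq> {}" using A_set_5_1 by blast
  show "bracket c 5 1 0 1 = 5"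
    unfolding bracket_def A_set_5_1 by (rule Least_equality) auto
  show "\<forall>n\<ge>5. \<forall>r1 r2 r3 g1 g2 g3 g4.
           {r1, r2, r3, g1, g2} \<subseteq> hypercube n \<and>
           red c r1 \<and> red c r2 \<and> red c r3 \<and> distinct [r1, r2, r3] \<and>
           green c g1 \<and> green c g2 \<and> g1 \<noteq> g2 \<and>
           {g3, g4} \<subseteq> hypercube n - {r1, r2, r3, g1, g2} \<and>
           green c g3 \<and> green c g4 \<and> g3 \<noteq> g4 \<longrightarrow>
           (\<exists>p. hamiltonian_path (hypercube n - {r1, r2, r3, g1, g2}) p \<and>
                hd p = g3 \<and> last p = g4)"
    unfolding linked_def[symmetric] by (intro allI impI, elim conjE) (rule linked_5_2)
  show "\<forall>n\<in>{3, 4}. \<exists>r1 r2 r3 g1 g2 g3 g4.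
           {r1, r2, r3, g1, g2} \<subseteq> hypercube n \<and>
           red c r1 \<and> red c r2 \<and> red c r3 \<and> distinct [r1, r2, r3] \<and>
           green c g1 \<and> green c g2 \<and> g1 \<noteq> g2 \<and>
           {g3, g4} \<subseteq> hypercube n - {r1, r2, r3, g1, g2} \<and>
           green c g3 \<and> green c g4 \<and> g3 \<noteq> g4 \<and>
           \<not> (\<exists>p. hamiltonian_path (hypercube n - {r1, r2, r3, g1, g2}) p \<and>
                  hd p = g3 \<and> last p = g4)" (is "\<forall>n\<in>_. ?P n")
  proof -
    define b where "b = (\<not> c)"
    have "?P 3"
      unfolding linked_def[symmetric]
    proof (intro exI conjI)
      show "\<not> linked (hypercube 3 - {[\<not> b,True,False], [\<not> b,False,True], [b,True,True],
        [b,True,False], [b,False,True]}) [\<not> b,True,True] [\<not> b,False,False]"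
        unfolding b_def by (rule not_linked_3)
    qed (cases c; auto simp: b_def red_def green_def hypercube_def)+
    moreover have "?P 4"
      unfolding linked_def[symmetric]
    proof (intro exI conjI)
      show "\<not> linked (hypercube 4 - {[\<not> b,True,False,False], [\<not> b,False,True,False], [\<not> b,False,False,True],
        [\<not> b,False,False,False], [b,True,False,False]}) [b,False,True,False] [b,False,False,True]"
        unfolding b_def by (rule not_linked_4)
    qed (cases c; auto simp: b_def red_def green_def hypercube_def)+
    ultimately show ?thesis by simp
  qed
qed

end
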